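(* Let $\mathcal P$ be the space of all $G_2$-structures on $M$ and $\bar{\mathcal G}^E$ the pull back of the Ebin metric by the map $\mathcal F:\varphi\mapsto g_\varphi$. Then for all $\varphi\in\mathcal P$ and all $X,Y\in T_\varphi\mathcal P$, $$\bar{\mathcal G}^E_\varphi(X,Y)=\frac34\bar{\mathcal G}^L_\varphi(X,Y)-\int_M\Big[\frac{11}{18}g(X,\varphi)g(Y,\varphi)-\frac1{16}\big(X_a{}^{jk}Y^{abc}\psi_{jkbc}+\varphi_{ajk}X^{ijk}\varphi_{ibc}Y^{abc}\big)\Big]\mathrm{vol}.$$
   Context: $M$ is a compact oriented smooth 7-manifold. A 3-form $\varphi$ on $M$ is positive (a $G_2$-structure) if the $\Lambda^7T^*M$-valued quadratic form $Q_\varphi(a,b)=(a\lrcorner\varphi)\wedge(b\lrcorner\varphi)\wedge\varphi$ is positive definite; it determines a unique Riemannian metric $g=g_\varphi$ with $6g_\varphi=*_\varphi Q_\varphi$, Hodge star $*=*_\varphi$, dual 4-form $\psi=*\varphi$, volume form $\mathrm{vol}=*1$. $\mathcal P$ is the space of all (not necessarily closed) $G_2$-structures on $M$, with $T_\varphi\mathcal P=\Omega^3(M)$. $\mathfrak G$ is the space of Riemannian metrics on $M$; $T_g\mathfrak G$ consists of symmetric 2-tensors, and $\mathcal F:\mathcal P\to\mathfrak G$, $\mathcal F(\varphi)=g_\varphi$, with differential $\mathcal F_*$. Forms are written $\omega=\frac1{k!}\omega_{i_1\cdots i_k}dx^{i_1\cdots i_k}$, indices are raised with $g$, and the inner product of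 $k$-forms and of $(0,k)$-tensors is $g(S,\bar S)=\frac1{k!}S_{i_1\cdots i_k}\bar S_{j_1\cdots j_k}g^{i_1j_1}\cdots g^{i_kj_k}$ (in particular with the factor $\frac12$ for symmetric 2-tensors). The Ebin metric is $\mathcal G^E_g(A,B)=\int_Mg(A,B)\,\mathrm{vol}_g$ for $A,B\in T_g\mathfrak G$; $\bar{\mathcal G}^E_\varphi(X,Y)=\mathcal G^E_{g_\varphi}(\mathcal F_*X,\mathcal F_*Y)$; the generalised Laplacian metric is $\bar{\mathcal G}^L_\varphi(X,Y)=\int_Mg(X,Y)\,\mathrm{vol}$ for $X,Y\in T_\varphi\mathcal P$. *)

theory Defs
  imports "HOL-Analysis.Analysis"
begin

section \<open>Compact oriented smooth 7-manifolds\<close>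

primrec times_cont_diff_on ::
  "nat \<Rightarrow> ('v::euclidean_space \<Rightarrow> 'w::real_normed_vector) \<Rightarrow> 'v set \<Rightarrow> bool" where
  "times_cont_diff_on 0 f S \<longleftrightarrow> continuous_on S f"
| "times_cont_diff_on (Suc k) f S \<longleftrightarrow>
     (\<forall>x\<in>S. f differentiable (at x)) \<and>
     (\<forall>b\<in>Basis. times_cont_diff_on k (\<lambda>x. frechet_derivative f (at x) b) S)"

text \<open>Only used for open sets \<open>S\<close>.\<close>
definition smooth_on :: "('v::euclidean_space \<Rightarrow> 'w::real_normed_vector) \<Rightarrow> 'v set \<Rightarrow> bool" where
  "smooth_on f S \<longleftrightarrow> (\<forall>k. times_cont_diff_on k f S)"

text \<open>A chart \<open>(U, f)\<close> is a homeomorphism \<open>f\<close> from the open set \<open>U\<close> onto an open subset of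
  \<open>real^7\<close>; the values of \<open>f\<close> off \<open>U\<close> are irrelevant.\<close>
type_synonym 'a chart = "'a set \<times> ('a \<Rightarrow> real^7)"

definition cinv :: "'a chart \<Rightarrow> real^7 \<Rightarrow> 'a" where
  "cinv c = inv_into (fst c) (snd c)"

definition is_chart :: "'a topology \<Rightarrow> 'a chart \<Rightarrow> bool" where
  "is_chart T c \<longleftrightarrow> openin T (fst c) \<and> open (snd c ` fst c) \<and>
     homeomorphic_map (subtopology T (fst c)) (top_of_set (snd c ` fst c)) (snd c)"

definition transition :: "'a chart \<Rightarrow> 'a chart \<Rightarrow> real^7 \<Rightarrow> real^7" where
  "transition c d = snd d \<circ> cinv c"

text \<open>Jacobian matrix at \<open>p\<close> of the change from the coordinates \<open>x\<close> of \<open>c\<close> to the coordinates \<open>y\<close>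
  of \<open>d\<close>: row \<open>j\<close>, column \<open>i\<close> is the partial derivative of \<open>y\<close>-coordinate \<open>j\<close> with respect to
  \<open>x\<close>-coordinate \<open>i\<close>.\<close>
definition trans_jac :: "'a chart \<Rightarrow> 'a chart \<Rightarrow> 'a \<Rightarrow> real^7^7" where
  "trans_jac c d p = jacobian (transition c d) (at (snd c p))"

text \<open>An oriented smooth structure is given by an atlas \<open>A\<close> (not required to be maximal) of
  smoothly compatible charts whose transition maps preserve the orientation of \<open>real^7\<close>.\<close>
definition compact_oriented_manifold :: "'a topology \<Rightarrow> 'a chart set \<Rightarrow> bool" where
  "compact_oriented_manifold T A \<longleftrightarrow>
     compact_space T \<and> Hausdorff_space T \<and> second_countable T \<and>
     (\<forall>c\<in>A. is_chart T c) \<and> \<Union> (fst ` A) = topspace T \<and>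
     (\<forall>c\<in>A. \<forall>d\<in>A. smooth_on (transition c d) (snd c ` (fst c \<inter> fst d)) \<and>
        (\<forall>p\<in>fst c \<inter> fst d. det (trans_jac c d p) > 0))"


section \<open>Tensor algebra at a point, in coordinates\<close>

text \<open>A covariant tensor of degree \<open>k\<close> is given by its components, indexed by the lists of
  length \<open>k\<close>; values at lists of other lengths are irrelevant. The coordinate indices are the
  elements \<open>1, \<dots>, 7\<close> of the type \<open>7\<close> (in which \<open>7 = 0\<close>).\<close>
type_synonym tensor = "7 list \<Rightarrow> real"

definition std_index :: "7 list" where
  "std_index = [1, 2, 3, 4, 5, 6, 7]"

definition alternating :: "nat \<Rightarrow> tensor \<Rightarrow> bool" where
  "alternating k \<omega> \<longleftrightarrow> (\<forall>I \<sigma>. length I = k \<and> \<sigma> permutes {..<k} \<longrightarrow>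
     \<omega> (map (\<lambda>m. I ! \<sigma> m) [0..<k]) = of_int (sign \<sigma>) * \<omega> I)"

definition interior_prod :: "real^7 \<Rightarrow> tensor \<Rightarrow> tensor" where
  "interior_prod a \<omega> = (\<lambda>I. \<Sum>i\<in>UNIV. a $ i * \<omega> (i # I))"

text \<open>Wedge product of a \<open>k\<close>-form and an \<open>l\<close>-form, normalised so that a \<open>k\<close>-form with components
  \<open>\<omega>\<^sub>I\<close> is \<open>(1/k!) \<Sum>\<^sub>I \<omega>\<^sub>I dx\<^sup>I\<close>.\<close>
definition wedge :: "nat \<Rightarrow> nat \<Rightarrow> tensor \<Rightarrow> tensor \<Rightarrow> tensor" where
  "wedge k l \<alpha> \<beta> = (\<lambda>I. (\<Sum>\<sigma> | \<sigma> permutes {..<k + l}. of_int (sign \<sigma>) *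
     \<alpha> (map (\<lambda>m. I ! \<sigma> m) [0..<k]) * \<beta> (map (\<lambda>m. I ! \<sigma> m) [k..<k + l])) / (fact k * fact l))"

text \<open>Components of the form \<open>dx\<^sup>1 \<and> \<dots> \<and> dx\<^sup>7\<close>.\<close>
definition levi_civita :: tensor where
  "levi_civita I = (\<Sum>\<sigma> | \<sigma> permutes {..<7}.
     if I = map (\<lambda>m. std_index ! \<sigma> m) [0..<7] then of_int (sign \<sigma>) else 0)"

text \<open>All indices raised with the metric \<open>g\<close>.\<close>
definition raise :: "real^7^7 \<Rightarrow> tensor \<Rightarrow> tensor" where
  "raise g S = (\<lambda>I. \<Sum>J | length J = length I.
     (\<Prod>m<length I. matrix_inv g $ (I ! m) $ (J ! m)) * S J)"

text \<open>The factor \<open>1/k!\<close> is used for all tensors of degree \<open>k\<close>, in particular \<open>1/2\<close> for symmetric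
  2-tensors.\<close>
definition tensor_inner :: "real^7^7 \<Rightarrow> nat \<Rightarrow> tensor \<Rightarrow> tensor \<Rightarrow> real" where
  "tensor_inner g k S S' = (\<Sum>I | length I = k. \<Sum>J | length J = k.
     S I * S' J * (\<Prod>m<k. matrix_inv g $ (I ! m) $ (J ! m))) / fact k"

definition matrix_tensor :: "real^7^7 \<Rightarrow> tensor" where
  "matrix_tensor A = (\<lambda>I. A $ (I ! 0) $ (I ! 1))"

definition vol_form :: "real^7^7 \<Rightarrow> tensor" where
  "vol_form g = (\<lambda>I. sqrt (det g) * levi_civita I)"

text \<open>Hodge star of a \<open>k\<close>-form for the standard orientation of \<open>real^7\<close>; it satisfies
  \<open>\<alpha> \<and> \<star>\<beta> = g(\<alpha>, \<beta>) vol\<close>.\<close>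
definition hodge :: "real^7^7 \<Rightarrow> nat \<Rightarrow> tensor \<Rightarrow> tensor" where
  "hodge g k \<omega> = (\<lambda>J. (\<Sum>I | length I = k. raise g \<omega> I * vol_form g (I @ J)) / fact k)"

definition inner_product_matrix :: "real^7^7 \<Rightarrow> bool" where
  "inner_product_matrix g \<longleftrightarrow> transpose g = g \<and> (\<forall>v. v \<noteq> 0 \<longrightarrow> v \<bullet> (g *v v) > 0)"

definition Q_form :: "tensor \<Rightarrow> real^7 \<Rightarrow> real^7 \<Rightarrow> tensor" where
  "Q_form \<phi> a b = wedge 4 3 (wedge 2 2 (interior_prod a \<phi>) (interior_prod b \<phi>)) \<phi>"

text \<open>A 7-form is positive for the standard orientation iff its component at
  \<open>(1, \<dots>, 7)\<close> is.\<close>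
definition positive_form :: "tensor \<Rightarrow> bool" where
  "positive_form \<phi> \<longleftrightarrow> (\<forall>a. a \<noteq> 0 \<longrightarrow> Q_form \<phi> a a std_index > 0)"

text \<open>The metric determined by a positive 3-form through \<open>6 g = \<star>\<^sub>g Q\<close>; both sides of this equation
  involve the unknown \<open>g\<close>.\<close>
definition g2_metric_at :: "tensor \<Rightarrow> real^7^7" where
  "g2_metric_at \<phi> = (THE g. inner_product_matrix g \<and>
     (\<forall>a b. 6 * (a \<bullet> (g *v b)) = hodge g 7 (Q_form \<phi> a b) []))"


section \<open>Fields on the manifold\<close>

text \<open>A tensor field is given by its components in every chart, as functions of the point;
  \<open>\<omega> c p\<close> only matters for charts \<open>c\<close> of the atlas and points \<open>p\<close> of the domain of \<open>c\<close>.\<close>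
type_synonym 'a tensor_field = "'a chart \<Rightarrow> 'a \<Rightarrow> tensor"
type_synonym 'a matrix_field = "'a chart \<Rightarrow> 'a \<Rightarrow> real^7^7"
type_synonym 'a scalar_field = "'a chart \<Rightarrow> 'a \<Rightarrow> real"

definition smooth_forms :: "'a chart set \<Rightarrow> nat \<Rightarrow> 'a tensor_field set" where
  "smooth_forms A k = {\<omega>.
     (\<forall>c\<in>A. \<forall>p\<in>fst c. alternating k (\<omega> c p)) \<and>
     (\<forall>c\<in>A. \<forall>d\<in>A. \<forall>p\<in>fst c \<inter> fst d. \<forall>I. length I = k \<longrightarrow>
        \<omega> c p I = (\<Sum>J | length J = k. (\<Prod>m<k. trans_jac c d p $ (J ! m) $ (I ! m)) * \<omega> d p J)) \<and>
     (\<forall>c\<in>A. \<forall>I. length I = k \<longrightarrow> smooth_on (\<lambda>x. \<omega> c (cinv c x) I) (snd c ` fst c))}"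

definition G2_structures :: "'a chart set \<Rightarrow> 'a tensor_field set" where
  "G2_structures A = {\<phi> \<in> smooth_forms A 3. \<forall>c\<in>A. \<forall>p\<in>fst c. positive_form (\<phi> c p)}"

text \<open>The map from G2-structures to Riemannian metrics, and its differential at \<open>\<phi>\<close> in the
  direction \<open>X\<close>. For fixed \<open>p\<close> the form \<open>\<phi> + t X\<close> is positive at \<open>p\<close> for all small \<open>t\<close>.\<close>
definition g2_metric :: "'a tensor_field \<Rightarrow> 'a matrix_field" where
  "g2_metric \<phi> = (\<lambda>c p. g2_metric_at (\<phi> c p))"

definition g2_metric_diff :: "'a tensor_field \<Rightarrow> 'a tensor_field \<Rightarrow> 'a matrix_field" where
  "g2_metric_diff \<phi> X = (\<lambda>c p.
     vector_derivative (\<lambda>t. g2_metric (\<lambda>c p I. \<phi> c p I + t * X c p I) c p) (at 0))"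

definition g2_psi :: "'a tensor_field \<Rightarrow> 'a tensor_field" where
  "g2_psi \<phi> = (\<lambda>c p. hodge (g2_metric \<phi> c p) 3 (\<phi> c p))"

definition field_inner ::
  "'a matrix_field \<Rightarrow> nat \<Rightarrow> 'a tensor_field \<Rightarrow> 'a tensor_field \<Rightarrow> 'a scalar_field" where
  "field_inner g k S S' = (\<lambda>c p. tensor_inner (g c p) k (S c p) (S' c p))"


section \<open>Integration\<close>

text \<open>Continuous functions suffice here: a partition of unity is only used to localise integrals.\<close>
definition partition_of_unity ::
  "'a topology \<Rightarrow> 'a chart set \<Rightarrow> ('a chart \<times> ('a \<Rightarrow> real)) list \<Rightarrow> bool" where
  "partition_of_unity T A P \<longleftrightarrow>
     (\<forall>(c, \<rho>) \<in> set P. c \<in> A \<and> continuous_map T euclideanreal \<rho> \<and>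
        (\<forall>p\<in>topspace T. \<rho> p \<ge> 0) \<and>
        T closure_of {p \<in> topspace T. \<rho> p \<noteq> 0} \<subseteq> fst c) \<and>
     (\<forall>p\<in>topspace T. (\<Sum>(c, \<rho>)\<leftarrow>P. \<rho> p) = 1)"

text \<open>The integral of a 7-form over the oriented manifold. By the change of variables formula it
  does not depend on the chosen partition of unity.\<close>
definition form_integral :: "'a topology \<Rightarrow> 'a chart set \<Rightarrow> 'a tensor_field \<Rightarrow> real" where
  "form_integral T A \<omega> = (\<Sum>(c, \<rho>) \<leftarrow> (SOME P. partition_of_unity T A P).
     LINT x:snd c ` fst c|lborel. \<rho> (cinv c x) * \<omega> c (cinv c x) std_index)"

text \<open>The integral of \<open>f vol\<^sub>g\<close>.\<close>
definition vol_integral ::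
  "'a topology \<Rightarrow> 'a chart set \<Rightarrow> 'a matrix_field \<Rightarrow> 'a scalar_field \<Rightarrow> real" where
  "vol_integral T A g f = form_integral T A (\<lambda>c p I. f c p * vol_form (g c p) I)"


section \<open>Metrics on spaces of metrics and of G2-structures\<close>

definition ebin_metric ::
  "'a topology \<Rightarrow> 'a chart set \<Rightarrow> 'a matrix_field \<Rightarrow> 'a matrix_field \<Rightarrow> 'a matrix_field \<Rightarrow> real" where
  "ebin_metric T A g B C = vol_integral T A g
     (field_inner g 2 (\<lambda>c p. matrix_tensor (B c p)) (\<lambda>c p. matrix_tensor (C c p)))"

definition pullback_ebin_metric ::
  "'a topology \<Rightarrow> 'a chart set \<Rightarrow> 'a tensor_field \<Rightarrow> 'a tensor_field \<Rightarrow> 'a tensor_field \<Rightarrow> real" where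
  "pullback_ebin_metric T A \<phi> X Y =
     ebin_metric T A (g2_metric \<phi>) (g2_metric_diff \<phi> X) (g2_metric_diff \<phi> Y)"

definition laplacian_metric ::
  "'a topology \<Rightarrow> 'a chart set \<Rightarrow> 'a tensor_field \<Rightarrow> 'a tensor_field \<Rightarrow> 'a tensor_field \<Rightarrow> real" where
  "laplacian_metric T A \<phi> X Y =
     vol_integral T A (g2_metric \<phi>) (field_inner (g2_metric \<phi>) 3 X Y)"

text \<open>The scalars \<open>X\<^sub>a\<^sup>j\<^sup>k Y\<^sup>a\<^sup>b\<^sup>c \<psi>\<^sub>j\<^sub>k\<^sub>b\<^sub>c\<close> and
  \<open>\<phi>\<^sub>a\<^sub>j\<^sub>k X\<^sup>i\<^sup>j\<^sup>k \<phi>\<^sub>i\<^sub>b\<^sub>c Y\<^sup>a\<^sup>b\<^sup>c\<close>.\<close>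
definition psi_contraction ::
  "'a tensor_field \<Rightarrow> 'a tensor_field \<Rightarrow> 'a tensor_field \<Rightarrow> 'a scalar_field" where
  "psi_contraction \<phi> X Y = (\<lambda>c p.
     \<Sum>a\<in>UNIV. \<Sum>j\<in>UNIV. \<Sum>k\<in>UNIV. \<Sum>b\<in>UNIV. \<Sum>d\<in>UNIV.
       raise (g2_metric \<phi> c p) (\<lambda>L. X c p (a # L)) [j, k] *
       raise (g2_metric \<phi> c p) (Y c p) [a, b, d] * g2_psi \<phi> c p [j, k, b, d])"

definition phi_contraction ::
  "'a tensor_field \<Rightarrow> 'a tensor_field \<Rightarrow> 'a tensor_field \<Rightarrow> 'a scalar_field" where
  "phi_contraction \<phi> X Y = (\<lambda>c p.
     \<Sum>a\<in>UNIV. \<Sum>j\<in>UNIV. \<Sum>k\<in>UNIV. \<Sum>i\<in>UNIV. \<Sum>b\<in>UNIV. \<Sum>d\<in>UNIV.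
       \<phi> c p [a, j, k] * raise (g2_metric \<phi> c p) (X c p) [i, j, k] *
       \<phi> c p [i, b, d] * raise (g2_metric \<phi> c p) (Y c p) [a, b, d])"

end

(* By GL(7)-equivariance everything is computed in a frame that puts the positive form into the
   standard shape phi0. Such a frame exists: on the unit sphere of Q, a triple maximising phi is
   orthonormal and its Q-complement K splits phi as lambda e^012 + sum e^i wedge omega_i, with
   omega_i 2-forms on K (the 3-form part on K vanishes because K is Q-orthogonal to the triple).
   That Q is a multiple of the identity on the triple says omega_i wedge omega_j is proportional
   to delta_ij, which forces the quaternionic normal form after rescaling; positivity of Q
   excludes the split form. At phi0 the linearisation of Q in direction X is (3/2)(S + S^T) with
   S_ab = X_aij phi0_bij, and since g = Q / (6 (det Q / 6^7)^(1/9)), the metric varies by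
   (1/4)(S + S^T) - (1/3) g(X, phi0) id. The identity phi0_mij phi0_mkl = delta_ik delta_jl
   - delta_il delta_jk + psi0_ijkl expresses the contraction of the two S-tensors through g(X, Y)
   and psi, which gives the equality of the integrands. Integrability, needed to split the
   integral, holds as the integrands are continuous and the partition functions have compact
   support in their charts. *)

theory Submission
  imports Defs
begin

section \<open>Tensors and changes of frame\<close>

text \<open>The metric occurs on both sides of its defining equation, on the right through the
  volume form. The computations are therefore made with Q, which is a cubic polynomial in the form
  and transforms by congruence together with one factor \<open>det P\<close>; a scalar root then
  recovers the metric.

  The normal form on K is built from a single vector. For f \<noteq> 0 in K, positivity makes the
  covectors phi(e_i, f, -) independent on K. Vectors of K dual to them complete the frame, and
  adding multiples of f to these removes three further components. So many components are then fixed
  that the entries of Q determine the others through small polynomial equations.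

  The standard shape is a predicate on components rather than an equation with a fixed tensor,
  because a tensor here also has irrelevant values at lists of the wrong length. Once the simplifier
  can sort the indices of alternating components, the algebra in a standard frame is a finite
  check.\<close>

lemma finite_lists_length: "finite {J::7 list. length J = n}"
  using finite_lists_length_eq[of "UNIV::7 set" n] by simp

lemma sum_lists_Suc:
  "(\<Sum>J | length J = Suc n. F J) = (\<Sum>i\<in>UNIV. \<Sum>J | length J = n. F (i # J))"
  for F :: "7 list \<Rightarrow> 'b::comm_monoid_add"
proof -
  have "{J::7 list. length J = Suc n} = (\<lambda>(i, J). i # J) ` (UNIV \<times> {J. length J = n})"
    by (auto simp: length_Suc_conv image_iff)
  then have "(\<Sum>J | length J = Suc n. F J) = (\<Sum>(i, J)\<in>UNIV \<times> {J. length J = n}. F (i # J))"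
    by (simp add: sum.reindex inj_on_def case_prod_beta)
  also have "\<dots> = (\<Sum>i\<in>UNIV. \<Sum>J | length J = n. F (i # J))"
    by (simp add: sum.cartesian_product)
  finally show ?thesis .
qed

lemma sum_lists_0: "(\<Sum>J | length J = 0. F J) = F ([]::7 list)"
  for F :: "7 list \<Rightarrow> 'b::comm_monoid_add"
  by simp

lemma sum_lists_append:
  "(\<Sum>J | length J = k + l. F J) = (\<Sum>I | length I = k. \<Sum>J | length J = l. F (I @ J))"
  for F :: "7 list \<Rightarrow> 'b::comm_monoid_add"
  by (induction k arbitrary: F) (simp_all only: sum_lists_0 add_0 add_Suc sum_lists_Suc append.simps)

text \<open>Distributivity over all index lists at once; it makes the components of a composite
  change of frame factor slot by slot.\<close>

lemma sum_lists_prod: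
  "(\<Sum>J | length J = n. \<Prod>m<n. f m (J ! m)) = (\<Prod>m<n. \<Sum>j\<in>(UNIV::7 set). f m j)"
  for f :: "nat \<Rightarrow> 7 \<Rightarrow> 'b::comm_semiring_1"
proof (induction n arbitrary: f)
  case (Suc n)
  have "(\<Sum>J | length J = Suc n. \<Prod>m<Suc n. f m (J ! m)) =
      (\<Sum>i\<in>UNIV. \<Sum>J | length J = n. f 0 i * (\<Prod>m<n. f (Suc m) (J ! m)))"
    unfolding sum_lists_Suc by (simp add: prod.lessThan_Suc_shift del: prod.lessThan_Suc)
  also have "\<dots> = (\<Sum>i\<in>UNIV. f 0 i) * (\<Prod>m<n. \<Sum>j\<in>UNIV. f (Suc m) j)"
    by (simp add: sum_distrib_left[symmetric] sum_distrib_right[symmetric] Suc.IH[of "\<lambda>m. f (Suc m)"])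
  also have "\<dots> = (\<Prod>m<Suc n. \<Sum>j\<in>UNIV. f m j)"
    by (simp add: prod.lessThan_Suc_shift del: prod.lessThan_Suc)
  finally show ?case .
qed simp

section \<open>Permutations acting on index lists\<close>

lemma nth_permute_list [simp]: "m < length I \<Longrightarrow> permute_list \<sigma> I ! m = I ! \<sigma> m"
  by (simp add: permute_list_def)

lemma permutes_lessThan: "\<sigma> permutes {..<n} \<Longrightarrow> m < n \<Longrightarrow> \<sigma> m < (n::nat)"
  using permutes_in_image[of \<sigma> "{..<n}" m] by auto

lemma permute_list_permute_list:
  "\<tau> permutes {..<length I} \<Longrightarrow> permute_list \<tau> (permute_list \<sigma> I) = permute_list (\<sigma> \<circ> \<tau>) I"
  by (auto intro!: nth_equalityI simp: permutes_lessThan)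

lemma permute_list_inv:
  assumes "\<sigma> permutes {..<length I}"
  shows "permute_list (inv \<sigma>) (permute_list \<sigma> I) = I" "permute_list \<sigma> (permute_list (inv \<sigma>) I) = I"
  using assms by (auto intro!: nth_equalityI simp: permutes_lessThan permutes_inv permutes_inverses)

lemma bij_betw_permute_list:
  assumes "\<sigma> permutes {..<n}"
  shows "bij_betw (permute_list \<sigma>) {I. length I = n} {I. length I = n}"
  by (rule bij_betwI[where g = "permute_list (inv \<sigma>)"])
     (use assms in \<open>auto simp: permute_list_inv\<close>)

lemma alternatingD:
  "alternating k \<omega> \<Longrightarrow> length I = k \<Longrightarrow> \<sigma> permutes {..<k} \<Longrightarrow>
     \<omega> (permute_list \<sigma> I) = of_int (sign \<sigma>) * \<omega> I"
  by (simp add: alternating_def permute_list_def)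

lemma alternatingI:
  "(\<And>I \<sigma>. length I = k \<Longrightarrow> \<sigma> permutes {..<k} \<Longrightarrow>
     \<omega> (permute_list \<sigma> I) = of_int (sign \<sigma>) * \<omega> I) \<Longrightarrow> alternating k \<omega>"
  by (auto simp: alternating_def permute_list_def)

text \<open>The product inside \<open>wedge\<close> before antisymmetrisation. It is isolated
  because a change of frame commutes with it and, separately, with each permutation of the
  slots.\<close>

definition tensor_prod :: "nat \<Rightarrow> tensor \<Rightarrow> tensor \<Rightarrow> tensor" where
  "tensor_prod k S S' = (\<lambda>I. S (take k I) * S' (drop k I))"

lemma wedge_eq:
  assumes "length I = k + l"
  shows "wedge k l \<alpha> \<beta> I = (\<Sum>\<sigma> | \<sigma> permutes {..<k + l}. of_int (sign \<sigma>) *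
    tensor_prod k \<alpha> \<beta> (permute_list \<sigma> I)) / (fact k * fact l)"
  using assms by (simp add: wedge_def tensor_prod_def permute_list_def take_map drop_map mult.assoc)

lemma sign_mult_of_int:
  assumes "\<sigma> permutes {..<n::nat}" "\<tau> permutes {..<n}"
  shows "of_int (sign (\<sigma> \<circ> \<tau>)) = (of_int (sign \<sigma>) * of_int (sign \<tau>) :: real)"
  using assms by (metis finite_lessThan of_int_mult permutation_permutes sign_compose)

lemma sign_sq_of_int [simp]: "of_int (sign \<sigma>) * of_int (sign \<sigma>) = (1::real)"
  by (metis of_int_1 of_int_mult sign_idempotent)

lemma sign_sq_of_int' [simp]: "of_int (sign \<sigma>) * (of_int (sign \<sigma>) * x) = (x::real)"
  by (metis mult.assoc mult_1 sign_sq_of_int)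

lemma sum_sign_comp_left:
  assumes "\<tau> permutes {..<n}"
  shows "(\<Sum>\<sigma> | \<sigma> permutes {..<n}. of_int (sign \<sigma>) * f (\<tau> \<circ> \<sigma>)) =
     of_int (sign \<tau>) * (\<Sum>\<sigma> | \<sigma> permutes {..<n::nat}. of_int (sign \<sigma>) * (f \<sigma> :: real))"
proof -
  have "(\<Sum>\<sigma> | \<sigma> permutes {..<n}. of_int (sign \<sigma>) * f (\<tau> \<circ> \<sigma>)) =
    (\<Sum>\<sigma> | \<sigma> permutes {..<n}. of_int (sign \<tau>) * (of_int (sign (\<tau> \<circ> \<sigma>)) * f (\<tau> \<circ> \<sigma>)))"
    using assms by (intro sum.cong refl) (simp add: sign_mult_of_int mult.assoc)
  also have "\<dots> = of_int (sign \<tau>) * (\<Sum>\<sigma> | \<sigma> permutes {..<n}. of_int (sign (\<tau> \<circ> \<sigma>)) * f (\<tau> \<circ> \<sigma>))"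
    by (simp add: sum_distrib_left)
  also have "\<dots> = of_int (sign \<tau>) * (\<Sum>\<sigma> | \<sigma> permutes {..<n}. of_int (sign \<sigma>) * f \<sigma>)"
    using setum_permutations_compose_left[OF assms, of "\<lambda>\<sigma>. of_int (sign \<sigma>) * f \<sigma>"]
    by (simp add: o_def)
  finally show ?thesis .
qed

lemma alternating_wedge: "alternating (k + l) (wedge k l \<alpha> \<beta>)"
proof (rule alternatingI)
  fix I :: "7 list" and \<tau> assume I: "length I = k + l" and \<tau>: "\<tau> permutes {..<k + l}"
  have "wedge k l \<alpha> \<beta> (permute_list \<tau> I) = (\<Sum>\<sigma> | \<sigma> permutes {..<k + l}. of_int (sign \<sigma>) *
      tensor_prod k \<alpha> \<beta> (permute_list (\<tau> \<circ> \<sigma>) I)) / (fact k * fact l)"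
    using I by (subst wedge_eq) (auto simp: permute_list_permute_list intro!: arg_cong2[of _ _ _ _
        divide] sum.cong)
  also have "\<dots> = of_int (sign \<tau>) * wedge k l \<alpha> \<beta> I"
    using I by (simp add: sum_sign_comp_left[OF \<tau>, of "\<lambda>\<sigma>. tensor_prod k \<alpha> \<beta> (permute_list \<sigma> I)"] wedge_eq)
  finally show "wedge k l \<alpha> \<beta> (permute_list \<tau> I) = of_int (sign \<tau>) * wedge k l \<alpha> \<beta> I" .
qed

text \<open>Components in the frame formed by the columns of \<open>P\<close>.\<close>
definition pull :: "real^7^7 \<Rightarrow> tensor \<Rightarrow> tensor" where
  "pull P S = (\<lambda>I. \<Sum>J | length J = length I. (\<Prod>m<length I. P $ (J ! m) $ (I ! m)) * S J)"

lemma pull_cong: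
  assumes "\<And>J. length J = length I \<Longrightarrow> S J = S' J"
  shows "pull P S I = pull P S' I"
  unfolding pull_def by (rule sum.cong) (auto simp: assms)

lemma pull_pull: "pull P (pull R S) = pull (R ** P) S"
proof
  fix I :: "7 list"
  let ?n = "length I"
  have "pull P (pull R S) I = (\<Sum>J | length J = ?n. \<Sum>K | length K = ?n.
      (\<Prod>m<?n. P $ (J ! m) $ (I ! m)) * ((\<Prod>m<?n. R $ (K ! m) $ (J ! m)) * S K))"
    unfolding pull_def by (intro sum.cong refl) (simp add: sum_distrib_left)
  also have "\<dots> = (\<Sum>K | length K = ?n. \<Sum>J | length J = ?n.
      (\<Prod>m<?n. P $ (J ! m) $ (I ! m)) * ((\<Prod>m<?n. R $ (K ! m) $ (J ! m)) * S K))"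
    by (rule sum.swap)
  also have "\<dots> = (\<Sum>K | length K = ?n. (\<Sum>J | length J = ?n.
      (\<Prod>m<?n. R $ (K ! m) $ (J ! m) * P $ (J ! m) $ (I ! m))) * S K)"
    by (intro sum.cong refl) (simp add: sum_distrib_left sum_distrib_right prod.distrib mult_ac)
  also have "\<dots> = pull (R ** P) S I"
    unfolding pull_def sum_lists_prod[where f = "\<lambda>m j. R $ (_ ! m) $ j * P $ j $ (I ! m)"]
    by (simp add: matrix_matrix_mult_def)
  finally show "pull P (pull R S) I = pull (R ** P) S I" .
qed

text \<open>Exchanging two finite sums makes \<open>pull P\<close> and
  \<open>pull (transpose P)\<close> adjoint for full contraction. This is how contractions with
  raised indices are moved into a frame.\<close>

lemma sum_pull:
  "(\<Sum>I | length I = k. pull P S I * S' I) = (\<Sum>J | length J = k. S J * pull (transpose P) S' J)"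
proof -
  have "(\<Sum>I | length I = k. pull P S I * S' I) = (\<Sum>I | length I = k. \<Sum>J | length J = k.
     (\<Prod>m<k. P $ (J ! m) $ (I ! m)) * S J * S' I)"
    unfolding pull_def by (intro sum.cong refl) (simp add: sum_distrib_right)
  also have "\<dots> = (\<Sum>J | length J = k. \<Sum>I | length I = k.
     (\<Prod>m<k. P $ (J ! m) $ (I ! m)) * S J * S' I)"
    by (rule sum.swap)
  also have "\<dots> = (\<Sum>J | length J = k. S J * pull (transpose P) S' J)"
    unfolding pull_def by (intro sum.cong refl) (simp add: sum_distrib_left transpose_def mult_ac)
  finally show ?thesis .
qed

lemma prod_lessThan_add: "(\<Prod>m<k + l. f m) = (\<Prod>m<k. f m) * (\<Prod>m<l. f (k + m :: nat))"
  for f :: "nat \<Rightarrow> 'b::comm_monoid_mult"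
  by (induction l) (simp_all add: mult.assoc)

lemma pull_append:
  "pull P S (I @ J) = (\<Sum>I' | length I' = length I. \<Sum>J' | length J' = length J.
     (\<Prod>m<length I. P $ (I' ! m) $ (I ! m)) * (\<Prod>m<length J. P $ (J' ! m) $ (J ! m)) * S (I' @ J'))"
  unfolding pull_def length_append sum_lists_append
  by (intro sum.cong refl) (simp add: prod_lessThan_add nth_append)

lemma pull_append':
  "pull P S (I @ J) = pull P (\<lambda>I'. pull P (\<lambda>J'. S (I' @ J')) J) I"
  unfolding pull_append by (simp add: pull_def sum_distrib_left mult.assoc)

lemma pull_tensor_prod:
  assumes "k \<le> length I"
  shows "pull P (tensor_prod k S S') I = tensor_prod k (pull P S) (pull P S') I"
proof -
  have "pull P (tensor_prod k S S') (take k I @ drop k I) = tensor_prod k (pull P S) (pull P S') I"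
    unfolding pull_append using assms
    by (auto simp: tensor_prod_def pull_def sum_product mult_ac intro!: sum.cong)
  then show ?thesis by simp
qed

lemma pull_permute_list:
  assumes \<sigma>: "\<sigma> permutes {..<length I}"
  shows "pull P S (permute_list \<sigma> I) = pull P (\<lambda>J. S (permute_list \<sigma> J)) I"
proof -
  let ?n = "length I"
  have "pull P S (permute_list \<sigma> I) =
     (\<Sum>J | length J = ?n. (\<Prod>m<?n. P $ (J ! m) $ (I ! \<sigma> m)) * S J)"
    unfolding pull_def by simp
  also have "\<dots> = (\<Sum>J | length J = ?n. (\<Prod>m<?n. P $ (permute_list \<sigma> J ! m) $ (I ! \<sigma> m)) * S
      (permute_list \<sigma> J))"
    using sum.reindex_bij_betw[OF bij_betw_permute_list[OF \<sigma>], symmetric] .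
  also have "\<dots> = (\<Sum>J | length J = ?n. (\<Prod>m<?n. P $ (J ! \<sigma> m) $ (I ! \<sigma> m)) * S (permute_list \<sigma> J))"
    by simp
  also have "\<dots> = (\<Sum>J | length J = ?n. (\<Prod>m<?n. P $ (J ! m) $ (I ! m)) * S (permute_list \<sigma> J))"
    using prod.permute[OF \<sigma>, of "\<lambda>m. P $ (_ ! m) $ (I ! m)"] by (simp add: o_def)
  finally show ?thesis by (simp add: pull_def)
qed

lemma alternating_pull:
  assumes "alternating k \<omega>" shows "alternating k (pull P \<omega>)"
proof (rule alternatingI)
  fix I :: "7 list" and \<tau> assume I: "length I = k" and \<tau>: "\<tau> permutes {..<k}"
  have "pull P \<omega> (permute_list \<tau> I) = pull P (\<lambda>J. of_int (sign \<tau>) * \<omega> J) I"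
    using I \<tau> assms by (subst pull_permute_list) (auto intro!: pull_cong simp: alternatingD)
  also have "\<dots> = of_int (sign \<tau>) * pull P \<omega> I"
    by (simp add: pull_def sum_distrib_left mult_ac)
  finally show "pull P \<omega> (permute_list \<tau> I) = of_int (sign \<tau>) * pull P \<omega> I" .
qed

text \<open>Naturality of the wedge product: a change of frame treats all slots alike, so it
  commutes with permuting them.\<close>

lemma wedge_pull:
  assumes I: "length I = k + l"
  shows "wedge k l (pull P \<alpha>) (pull P \<beta>) I = pull P (wedge k l \<alpha> \<beta>) I"
proof -
  have "wedge k l (pull P \<alpha>) (pull P \<beta>) I = (\<Sum>\<sigma> | \<sigma> permutes {..<k + l}. of_int (sign \<sigma>) *
      pull P (\<lambda>J. tensor_prod k \<alpha> \<beta> (permute_list \<sigma> J)) I) / (fact k * fact l)"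
    unfolding wedge_eq[OF I] using I
    by (auto simp: pull_tensor_prod[symmetric] pull_permute_list intro!: arg_cong2[of _ _ _ _
        divide] sum.cong)
  also have "\<dots> = (\<Sum>J | length J = k + l. \<Sum>\<sigma> | \<sigma> permutes {..<k + l}. of_int (sign \<sigma>) *
      ((\<Prod>m<k + l. P $ (J ! m) $ (I ! m)) * tensor_prod k \<alpha> \<beta> (permute_list \<sigma> J))) / (fact k * fact l)"
    unfolding pull_def I sum_distrib_left by (subst sum.swap) simp
  also have "\<dots> = pull P (wedge k l \<alpha> \<beta>) I"
    unfolding pull_def I sum_divide_distrib
    by (intro sum.cong refl) (simp add: wedge_eq sum_distrib_left sum_divide_distrib mult_ac)
  finally show ?thesis .
qed

lemma wedge_cong:
  assumes "\<And>J. length J = k \<Longrightarrow> \<alpha> J = \<alpha>' J" "\<And>J. length J = l \<Longrightarrow> \<beta> J = \<beta>' J"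
  shows "wedge k l \<alpha> \<beta> I = wedge k l \<alpha>' \<beta>' I"
  unfolding wedge_def by (simp add: assms)

lemma interior_prod_pull:
  "interior_prod a (pull P \<phi>) I = pull P (interior_prod (P *v a) \<phi>) I"
proof -
  have "interior_prod a (pull P \<phi>) I = (\<Sum>i\<in>UNIV. \<Sum>j\<in>UNIV. a $ i * (P $ j $ i * pull P (\<lambda>J. \<phi> (j # J)) I))"
    unfolding interior_prod_def sum_distrib_left[symmetric]
    by (intro sum.cong refl arg_cong2[of _ _ _ _ "(*)"])
       (simp add: pull_def sum_lists_Suc prod.lessThan_Suc_shift sum_distrib_left mult_ac del:
           prod.lessThan_Suc)
  also have "\<dots> = (\<Sum>j\<in>UNIV. \<Sum>i\<in>UNIV. a $ i * (P $ j $ i * pull P (\<lambda>J. \<phi> (j # J)) I))"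
    by (rule sum.swap)
  also have "\<dots> = (\<Sum>j\<in>UNIV. (P *v a) $ j * pull P (\<lambda>J. \<phi> (j # J)) I)"
    by (simp add: matrix_vector_mult_def sum_distrib_left sum_distrib_right mult_ac)
  also have "\<dots> = (\<Sum>J | length J = length I. \<Sum>j\<in>UNIV. (P *v a) $ j * ((\<Prod>m<length I. P $ (J ! m) $ (I
      ! m)) * \<phi> (j # J)))"
    unfolding pull_def sum_distrib_left by (rule sum.swap)
  also have "\<dots> = pull P (interior_prod (P *v a) \<phi>) I"
    unfolding pull_def interior_prod_def by (intro sum.cong refl) (simp add: sum_distrib_left
        sum_distrib_right mult_ac)
  finally show ?thesis .
qed

text \<open>\<open>ix\<close> translates \<open>0, \<dots>, 6\<close> to the indices \<open>1, \<dots>, 7\<close>: on natural numbers the simplifier can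
  decide the order of indices, which normalises components of alternating tensors.\<close>
abbreviation "ix n \<equiv> std_index ! n"

lemma length_std_index [simp]: "length std_index = 7"
  by (simp add: std_index_def)

lemma distinct_std_index [simp]: "distinct std_index"
  by (simp add: std_index_def)

lemma set_std_index [simp]: "set std_index = UNIV"
  by (rule card_subset_eq) (simp_all add: distinct_card)

lemma bij_betw_ix: "bij_betw ((!) std_index) {..<7} UNIV"
  using bij_betw_nth[of std_index "{..<7}" UNIV] by simp

lemma sum_ix: "(\<Sum>i\<in>UNIV. f i) = (\<Sum>n<7. f (ix n))"
  by (rule sum.reindex_bij_betw[OF bij_betw_ix, symmetric])

lemma prod_ix: "(\<Prod>i\<in>UNIV. f i) = (\<Prod>n<7. f (ix n))"
  by (rule prod.reindex_bij_betw[OF bij_betw_ix, symmetric])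

lemma ix_eq_iff [simp]: "m < 7 \<Longrightarrow> n < 7 \<Longrightarrow> ix m = ix n \<longleftrightarrow> m = n"
  by (simp add: nth_eq_iff_index_eq)

definition pos :: "7 \<Rightarrow> nat" where "pos = inv_into {..<7} ((!) std_index)"

lemma pos_ix [simp]: "n < 7 \<Longrightarrow> pos (ix n) = n"
  unfolding pos_def using bij_betw_inv_into_left[OF bij_betw_ix, of n] by simp

lemma ix_pos [simp]: "ix (pos i) = i"
  unfolding pos_def using bij_betw_inv_into_right[OF bij_betw_ix, of i] by simp

lemma pos_less [simp]: "pos i < 7"
  unfolding pos_def using bij_betw_inv_into[OF bij_betw_ix] by (auto simp: bij_betw_def)

section \<open>Determinants and the Levi-Civita symbol\<close>

lemma det_ix:
  "det (M :: real^7^7) = (\<Sum>\<sigma> | \<sigma> permutes {..<7}. of_int (sign \<sigma>) * (\<Prod>m<7. M $ ix m $ ix (\<sigma> m)))"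
proof -
  let ?c = "map_permutation {..<7} ((!) std_index)"
  \<comment> \<open>Conjugation by the bijection \<open>(!) std_index\<close> turns permutations of
    \<open>{..<7}\<close> into permutations of the index type and keeps their signs; conjugation by
    \<open>pos\<close> is the inverse.\<close>
  have bij: "bij_betw ?c {\<sigma>. \<sigma> permutes {..<7}} {p. p permutes UNIV}"
  proof (rule bij_betwI[where g = "map_permutation UNIV pos"])
    show "?c \<in> {\<sigma>. \<sigma> permutes {..<7}} \<rightarrow> {p. p permutes UNIV}"
      using map_permutation_permutes[OF bij_betw_ix] by auto
    have b: "bij_betw pos UNIV {..<7}"
      unfolding pos_def by (rule bij_betw_inv_into[OF bij_betw_ix])
    show "map_permutation UNIV pos \<in> {p. p permutes UNIV} \<rightarrow> {\<sigma>. \<sigma> permutes {..<7}}"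
      using map_permutation_permutes[OF b] by auto
    show "map_permutation UNIV pos (?c \<sigma>) = \<sigma>" if "\<sigma> \<in> {\<sigma>. \<sigma> permutes {..<7}}" for \<sigma>
    proof
      fix n
      show "map_permutation UNIV pos (?c \<sigma>) n = \<sigma> n"
      proof (cases "n < 7")
        case True
        then have "map_permutation UNIV pos (?c \<sigma>) (pos (ix n)) = pos (?c \<sigma> (ix n))"
          using b by (intro map_permutation_apply) (auto simp: bij_betw_def)
        also have "\<dots> = \<sigma> n"
          using True that bij_betw_ix by (subst map_permutation_apply) (auto simp: bij_betw_def
              permutes_lessThan)
        finally show ?thesis using True by simp
      next
        case False
        then show ?thesis
          using that map_permutation_permutes[OF b map_permutation_permutes[OF bij_betw_ix, of \<sigma>]]
          by (auto simp: permutes_not_in)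
      qed
    qed
    show "?c (map_permutation UNIV pos p) = p" if "p \<in> {p. p permutes UNIV}" for p
    proof
      fix i :: 7
      have "?c (map_permutation UNIV pos p) (ix (pos i)) = ix (map_permutation UNIV pos p (pos i))"
        using bij_betw_ix by (intro map_permutation_apply) (auto simp: bij_betw_def)
      also have "\<dots> = p i"
        using b by (subst map_permutation_apply) (auto simp: bij_betw_def)
      finally show "?c (map_permutation UNIV pos p) i = p i" by simp
    qed
  qed
  show ?thesis
    unfolding det_def
    apply (subst sum.reindex_bij_betw[OF bij, symmetric])
    using bij_betw_ix
    by (intro sum.cong refl)
       (auto simp: prod_ix sign_map_permutation map_permutation_apply bij_betw_def intro!: prod.cong)
qed

lemma levi_civita_eq:
  "levi_civita I = (\<Sum>\<sigma> | \<sigma> permutes {..<7}. if I = permute_list \<sigma> std_index then of_int (sign \<sigma>) else 0)"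
  by (simp add: levi_civita_def permute_list_def)

lemma levi_civita_sum:
  assumes "length I = 7"
  shows "levi_civita I = (\<Sum>\<sigma> | \<sigma> permutes {..<7}. of_int (sign \<sigma>) * (\<Prod>m<7. if I ! m = ix (\<sigma> m) then
      1 else 0))"
proof -
  have "(\<Prod>m<7. if I ! m = ix (\<sigma> m) then 1 else 0) = (if I = permute_list \<sigma> std_index then 1 else (0::real))"
    for \<sigma> :: "nat \<Rightarrow> nat"
    using assms by (auto simp: list_eq_iff_nth_eq)
  then show ?thesis unfolding levi_civita_eq by (intro sum.cong refl) simp
qed

lemma sum_sign_prod_rows:
  fixes P :: "real^7^7"
  assumes "length J = 7"
  shows "(\<Sum>\<sigma> | \<sigma> permutes {..<7}. of_int (sign \<sigma>) * (\<Prod>m<7. P $ (J ! m) $ ix (\<sigma> m))) = levi_civita J * det P"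
proof -
  have "(\<Sum>\<sigma> | \<sigma> permutes {..<7}. of_int (sign \<sigma>) * (\<Prod>m<7. P $ (J ! m) $ ix (\<sigma> m))) =
      det (\<chi> i. P $ (J ! pos i))"
    by (simp add: det_ix)
  \<comment> \<open>Selecting the rows listed in \<open>J\<close> is multiplication by a 0-1 matrix,
    whose determinant is \<open>levi_civita J\<close>.\<close>
  also have "(\<chi> i. P $ (J ! pos i)) = (\<chi> i j. if J ! pos i = j then 1 else 0) ** P"
    by (simp add: vec_eq_iff matrix_matrix_mult_def of_bool_def[symmetric])
  also have "det \<dots> = levi_civita J * det P"
    unfolding det_mul levi_civita_sum[OF assms] by (simp add: det_ix)
  finally show ?thesis .
qed

lemma pull_levi_civita:
  assumes "length I = 7"
  shows "pull P levi_civita I = det P * levi_civita I"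
proof -
  have "pull P levi_civita I = (\<Sum>\<sigma> | \<sigma> permutes {..<7}. \<Sum>J | length J = 7.
     (\<Prod>m<7. P $ (J ! m) $ (I ! m)) * (if J = permute_list \<sigma> std_index then of_int (sign \<sigma>) else 0))"
    unfolding pull_def levi_civita_eq assms sum_distrib_left by (rule sum.swap)
  also have "\<dots> = (\<Sum>\<sigma> | \<sigma> permutes {..<7}. of_int (sign \<sigma>) * (\<Prod>m<7. transpose P $ (I ! m) $ ix (\<sigma> m)))"
    by (intro sum.cong refl) (simp add: if_distrib[of "(*) _"] sum.If_cases transpose_def
        finite_lists_length Int_def conj_commute cong: conj_cong)
  also have "\<dots> = det P * levi_civita I"
    by (simp add: sum_sign_prod_rows assms)
  finally show ?thesis .
qed

lemma sum_levi_civita: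
  "(\<Sum>J | length J = 7. levi_civita J * S J) =
   (\<Sum>\<sigma> | \<sigma> permutes {..<7}. of_int (sign \<sigma>) * S (permute_list \<sigma> std_index))"
proof -
  have "(\<Sum>J | length J = 7. levi_civita J * S J) = (\<Sum>\<sigma> | \<sigma> permutes {..<7}. \<Sum>J | length J = 7.
     (if J = permute_list \<sigma> std_index then of_int (sign \<sigma>) else 0) * S J)"
    unfolding levi_civita_eq sum_distrib_right by (rule sum.swap)
  also have "\<dots> = (\<Sum>\<sigma> | \<sigma> permutes {..<7}. of_int (sign \<sigma>) * S (permute_list \<sigma> std_index))"
    by (intro sum.cong refl) (simp add: if_distrib[of "\<lambda>x. x * _"] sum.If_cases finite_lists_length
        Int_def conj_commute cong: conj_cong)
  finally show ?thesis .
qed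

lemma sum_levi_civita_alternating:
  assumes "alternating 7 \<omega>"
  shows "(\<Sum>J | length J = 7. levi_civita J * \<omega> J) = fact 7 * \<omega> std_index"
  unfolding sum_levi_civita using assms
  by (simp add: alternatingD card_permutations)

text \<open>Full contraction with \<open>levi_civita\<close> recovers \<open>fact 7\<close> times
  the component at \<open>std_index\<close>, and \<open>sum_pull\<close> moves the change of frame
  onto \<open>levi_civita\<close>, where it acts as a determinant.\<close>

lemma pull_top_form:
  assumes "alternating 7 \<omega>"
  shows "pull P \<omega> std_index = det P * \<omega> std_index"
proof -
  have "fact 7 * pull P \<omega> std_index = (\<Sum>J | length J = 7. pull P \<omega> J * levi_civita J)"
    using sum_levi_civita_alternating[OF alternating_pull[OF assms]] by (simp add: mult.commute)
  also have "\<dots> = (\<Sum>J | length J = 7. \<omega> J * (det P * levi_civita J))"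
    unfolding sum_pull by (simp add: pull_levi_civita)
  also have "\<dots> = det P * (\<Sum>J | length J = 7. levi_civita J * \<omega> J)"
    by (simp add: sum_distrib_left mult_ac)
  also have "\<dots> = fact 7 * (det P * \<omega> std_index)"
    by (simp add: sum_levi_civita_alternating[OF assms])
  finally show ?thesis by simp
qed

text \<open>The vectors transform by \<open>P\<close>, and the value, being a 7-form, contributes
  the determinant.\<close>

lemma Q_form_pull: "Q_form (pull P \<phi>) a b std_index = det P * Q_form \<phi> (P *v a) (P *v b) std_index"
proof -
  have "Q_form (pull P \<phi>) a b std_index =
     wedge 4 3 (pull P (wedge 2 2 (interior_prod (P *v a) \<phi>) (interior_prod (P *v b) \<phi>))) (pull P \<phi>)
         std_index"
    unfolding Q_form_def
    by (rule wedge_cong) (simp_all add: interior_prod_pull[abs_def] wedge_pull)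
  also have "\<dots> = det P * Q_form \<phi> (P *v a) (P *v b) std_index"
    unfolding Q_form_def using alternating_wedge[of 4 3] by (simp add: wedge_pull pull_top_form)
  finally show ?thesis .
qed

section \<open>Wedge products in components\<close>

lemma alternating_transpose:
  assumes "alternating k \<omega>" "length I = k" "i < k" "j < k" "i \<noteq> j"
  shows "\<omega> (I[i := I ! j, j := I ! i]) = - \<omega> I"
proof -
  have "permute_list (Transposition.transpose i j) I = I[i := I ! j, j := I ! i]"
    using assms by (auto intro!: nth_equalityI simp: nth_list_update Transposition.transpose_def)
  then show ?thesis
    using alternatingD[OF assms(1,2), of "Transposition.transpose i j"] assms
    by (simp add: permutes_swap_id sign_swap_id)
qed

definition comp2 :: "tensor \<Rightarrow> nat \<Rightarrow> nat \<Rightarrow> real" where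
  "comp2 \<omega> i j = \<omega> [ix i, ix j]"
definition comp3 :: "tensor \<Rightarrow> nat \<Rightarrow> nat \<Rightarrow> nat \<Rightarrow> real" where
  "comp3 \<omega> i j k = \<omega> [ix i, ix j, ix k]"
definition comp4 :: "tensor \<Rightarrow> nat \<Rightarrow> nat \<Rightarrow> nat \<Rightarrow> nat \<Rightarrow> real" where
  "comp4 \<omega> i j k l = \<omega> [ix i, ix j, ix k, ix l]"

lemma comp2_swap:
  assumes "alternating 2 \<omega>"
  shows "comp2 \<omega> j i = - comp2 \<omega> i j"
  using alternating_transpose[OF assms, of "[ix i, ix j]" 0 1] by (simp add: comp2_def)

lemma comp3_swap:
  assumes "alternating 3 \<omega>"
  shows "comp3 \<omega> j i k = - comp3 \<omega> i j k" "comp3 \<omega> i k j = - comp3 \<omega> i j k"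
  using alternating_transpose[OF assms, of "[ix i, ix j, ix k]" 0 1]
    alternating_transpose[OF assms, of "[ix i, ix j, ix k]" 1 2] by (simp_all add: comp3_def)

lemma comp4_swap:
  assumes "alternating 4 \<omega>"
  shows "comp4 \<omega> j i k l = - comp4 \<omega> i j k l" "comp4 \<omega> i k j l = - comp4 \<omega> i j k l"
    "comp4 \<omega> i j l k = - comp4 \<omega> i j k l"
  using alternating_transpose[OF assms, of "[ix i, ix j, ix k, ix l]" 0 1]
    alternating_transpose[OF assms, of "[ix i, ix j, ix k, ix l]" 1 2]
    alternating_transpose[OF assms, of "[ix i, ix j, ix k, ix l]" 2 3] by (simp_all add: comp4_def)

text \<open>The guards make antisymmetry a terminating rewrite system that sorts numeral indices;
  components with a repeated index vanish since x = - x forces x = 0.\<close>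

lemma comp3_normal:
  assumes "alternating 3 \<omega>"
  shows "comp3 \<omega> i i k = 0" "comp3 \<omega> k i i = 0" "i < j \<Longrightarrow> comp3 \<omega> j i k = - comp3 \<omega> i j k"
    "j < k \<Longrightarrow> comp3 \<omega> i k j = - comp3 \<omega> i j k"
  using comp3_swap[OF assms] by (metis neg_equal_zero)+

lemma comp4_normal:
  assumes "alternating 4 \<omega>"
  shows "comp4 \<omega> i i k l = 0" "comp4 \<omega> k i i l = 0" "comp4 \<omega> k l i i = 0"
    "i < j \<Longrightarrow> comp4 \<omega> j i k l = - comp4 \<omega> i j k l"
    "j < k \<Longrightarrow> comp4 \<omega> i k j l = - comp4 \<omega> i j k l"
    "k < l \<Longrightarrow> comp4 \<omega> i j l k = - comp4 \<omega> i j k l"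
  using comp4_swap[OF assms] by (metis neg_equal_zero)+

lemma alternating_interior_prod:
  assumes "alternating (Suc k) \<omega>" shows "alternating k (interior_prod a \<omega>)"
proof (rule alternatingI)
  fix I :: "7 list" and \<tau> assume I: "length I = k" and \<tau>: "\<tau> permutes {..<k}"
  \<comment> \<open>Shifting by \<open>Suc\<close> leaves slot 0, which receives the contracted
    vector, fixed, and does not change the sign.\<close>
  let ?t = "map_permutation {..<k} Suc \<tau>"
  have b: "bij_betw Suc {..<k} {1..<Suc k}"
    by (simp add: lessThan_atLeast0)
  have t: "?t permutes {1..<Suc k}" by (rule map_permutation_permutes[OF b \<tau>])
  have t': "?t permutes {..<Suc k}" by (rule permutes_subset[OF t]) auto
  have s: "sign ?t = sign \<tau>" using \<tau> by (simp add: sign_map_permutation)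
  have "permute_list ?t (i # I) = i # permute_list \<tau> I" for i
  proof (rule nth_equalityI)
    fix m assume m: "m < length (permute_list ?t (i # I))"
    show "permute_list ?t (i # I) ! m = (i # permute_list \<tau> I) ! m"
    proof (cases m)
      case 0
      have "?t 0 = 0" using t by (auto simp: permutes_def)
      then show ?thesis using 0 by simp
    next
      case (Suc n)
      then have "?t m = Suc (\<tau> n)" using m I by (auto intro!: map_permutation_apply)
      then show ?thesis using m Suc by simp
    qed
  qed simp
  then show "interior_prod a \<omega> (permute_list \<tau> I) = of_int (sign \<tau>) * interior_prod a \<omega> I"
    unfolding interior_prod_def sum_distrib_left using alternatingD[OF assms _ t', of "_ # I"] I s
    by (simp add: mult_ac)
qed

text \<open>Cosets of the stabiliser of \<open>n\<close>: a permutation of \<open>{..<Suc n}\<close>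
  is uniquely a transposition of \<open>n\<close> and \<open>b\<close> composed with a permutation
  of \<open>{..<n}\<close>, and the transposition has sign -1 unless \<open>b = n\<close>.\<close>

lemma sum_permutes_lessThan_Suc:
  "(\<Sum>\<sigma> | \<sigma> permutes {..<Suc n}. of_int (sign \<sigma>) * f \<sigma>) =
   (\<Sum>b<Suc n. (if b = n then 1 else -1) * (\<Sum>\<sigma> | \<sigma> permutes {..<n}. of_int (sign \<sigma>) * (f
       (Transposition.transpose n b \<circ> \<sigma>) :: real)))"
proof -
  have "sign (Transposition.transpose n b \<circ> \<sigma>) = (if b = n then 1 else -1) * sign \<sigma>" if "\<sigma> permutes
      {..<n}" for b \<sigma>
    using that by (subst sign_compose) (auto simp: sign_swap_id permutation_swap_id intro:
        permutes_imp_permutation)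
  then have "of_int (sign (Transposition.transpose n b \<circ> \<sigma>)) = ((if b = n then 1 else -1) * of_int
      (sign \<sigma>) :: real)" if "\<sigma> permutes {..<n}" for b \<sigma>
    using that by simp
  then show ?thesis
    unfolding lessThan_Suc
    by (subst sum_over_permutations_insert) (auto simp: sum_distrib_left mult.assoc intro!: sum.cong)
qed

lemma sum_permutes_lessThan_0:
  "(\<Sum>\<sigma> | \<sigma> permutes {..<0::nat}. of_int (sign \<sigma>) * (f \<sigma> :: real)) = f id"
  by simp

text \<open>The 24 permutations agree in groups of 2! 2! = 4 by antisymmetry, which cancels the
  denominator in \<open>wedge\<close>; the six splittings of the four slots remain.\<close>

lemma wedge_2_2:
  assumes "alternating 2 \<alpha>" "alternating 2 \<beta>"
  shows "comp4 (wedge 2 2 \<alpha> \<beta>) i j k l =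
    comp2 \<alpha> i j * comp2 \<beta> k l - comp2 \<alpha> i k * comp2 \<beta> j l + comp2 \<alpha> i l * comp2 \<beta> j k
    + comp2 \<alpha> j k * comp2 \<beta> i l - comp2 \<alpha> j l * comp2 \<beta> i k + comp2 \<alpha> k l * comp2 \<beta> i j"
proof -
  have 4: "{..<2 + 2} = {..<Suc (Suc (Suc (Suc 0)))}" by auto
  have w: "wedge 2 2 \<alpha> \<beta> I = (\<Sum>\<sigma> | \<sigma> permutes {..<2 + 2}. of_int (sign \<sigma>) *
      tensor_prod 2 \<alpha> \<beta> (permute_list \<sigma> I)) / 4" if "length I = 4" for I
    using that by (simp add: wedge_eq)
  show ?thesis
    unfolding comp4_def
    apply (subst w, simp)
    unfolding 4 sum_permutes_lessThan_Suc sum_permutes_lessThan_0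
    by (simp add: lessThan_Suc permute_list_def tensor_prod_def Transposition.transpose_def
        numeral_eq_Suc comp2_def[symmetric]
          comp2_swap[OF assms(1), of j i] comp2_swap[OF assms(1), of k i] comp2_swap[OF assms(1), of l i]
          comp2_swap[OF assms(1), of k j] comp2_swap[OF assms(1), of l j] comp2_swap[OF assms(1), of l k]
          comp2_swap[OF assms(2), of j i] comp2_swap[OF assms(2), of k i] comp2_swap[OF assms(2), of l i]
          comp2_swap[OF assms(2), of k j] comp2_swap[OF assms(2), of l j] comp2_swap[OF assms(2), of
              l k]  upt_rec)
qed

lemma wedge_4_3:
  assumes "alternating 4 \<alpha>" "alternating 3 \<beta>"
  shows "wedge 4 3 \<alpha> \<beta> std_index =
    comp4 \<alpha> 0 1 2 3 * comp3 \<beta> 4 5 6 - comp4 \<alpha> 0 1 2 4 * comp3 \<beta> 3 5 6 + comp4 \<alpha> 0 1 2 5 * comp3 \<beta> 3 4 6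
    - comp4 \<alpha> 0 1 2 6 * comp3 \<beta> 3 4 5 + comp4 \<alpha> 0 1 3 4 * comp3 \<beta> 2 5 6 - comp4 \<alpha> 0 1 3 5 * comp3 \<beta> 2 4 6
    + comp4 \<alpha> 0 1 3 6 * comp3 \<beta> 2 4 5 + comp4 \<alpha> 0 1 4 5 * comp3 \<beta> 2 3 6 - comp4 \<alpha> 0 1 4 6 * comp3 \<beta> 2 3 5
    + comp4 \<alpha> 0 1 5 6 * comp3 \<beta> 2 3 4 - comp4 \<alpha> 0 2 3 4 * comp3 \<beta> 1 5 6 + comp4 \<alpha> 0 2 3 5 * comp3 \<beta> 1 4 6
    - comp4 \<alpha> 0 2 3 6 * comp3 \<beta> 1 4 5 - comp4 \<alpha> 0 2 4 5 * comp3 \<beta> 1 3 6 + comp4 \<alpha> 0 2 4 6 * comp3 \<beta> 1 3 5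
    - comp4 \<alpha> 0 2 5 6 * comp3 \<beta> 1 3 4 + comp4 \<alpha> 0 3 4 5 * comp3 \<beta> 1 2 6 - comp4 \<alpha> 0 3 4 6 * comp3 \<beta> 1 2 5
    + comp4 \<alpha> 0 3 5 6 * comp3 \<beta> 1 2 4 - comp4 \<alpha> 0 4 5 6 * comp3 \<beta> 1 2 3 + comp4 \<alpha> 1 2 3 4 * comp3 \<beta> 0 5 6
    - comp4 \<alpha> 1 2 3 5 * comp3 \<beta> 0 4 6 + comp4 \<alpha> 1 2 3 6 * comp3 \<beta> 0 4 5 + comp4 \<alpha> 1 2 4 5 * comp3 \<beta> 0 3 6
    - comp4 \<alpha> 1 2 4 6 * comp3 \<beta> 0 3 5 + comp4 \<alpha> 1 2 5 6 * comp3 \<beta> 0 3 4 - comp4 \<alpha> 1 3 4 5 * comp3 \<beta> 0 2 6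
    + comp4 \<alpha> 1 3 4 6 * comp3 \<beta> 0 2 5 - comp4 \<alpha> 1 3 5 6 * comp3 \<beta> 0 2 4 + comp4 \<alpha> 1 4 5 6 * comp3 \<beta> 0 2 3
    + comp4 \<alpha> 2 3 4 5 * comp3 \<beta> 0 1 6 - comp4 \<alpha> 2 3 4 6 * comp3 \<beta> 0 1 5 + comp4 \<alpha> 2 3 5 6 * comp3 \<beta> 0 1 4
    - comp4 \<alpha> 2 4 5 6 * comp3 \<beta> 0 1 3 + comp4 \<alpha> 3 4 5 6 * comp3 \<beta> 0 1 2"
proof -
  have 7: "{..<7} = {..<Suc 6}" and 6: "{..<6} = {..<Suc 5}" and 5: "{..<5} = {..<Suc 4}" by auto
  \<comment> \<open>The inner sum over permutations of the first four slots has 4! = 24 equal terms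
    because \<open>\<alpha>\<close> alternates. Only 7 * 6 * 5 = 210 cosets have to be enumerated
    instead of 5040 permutations.\<close>
  have *: "(\<Sum>\<sigma> | \<sigma> permutes {..<4}. of_int (sign \<sigma>) *
     tensor_prod 4 \<alpha> \<beta> (permute_list (t \<circ> \<sigma>) std_index)) =
     24 * (comp4 \<alpha> (t 0) (t 1) (t 2) (t 3) * comp3 \<beta> (t 4) (t 5) (t 6))" (is "?l = _") for t
  proof -
    have "tensor_prod 4 \<alpha> \<beta> (permute_list (t \<circ> \<sigma>) std_index) =
      of_int (sign \<sigma>) * (comp4 \<alpha> (t 0) (t 1) (t 2) (t 3) * comp3 \<beta> (t 4) (t 5) (t 6))"
      if s: "\<sigma> permutes {..<4}" for \<sigma>
    proof -
      let ?I = "[ix (t 0), ix (t 1), ix (t 2), ix (t 3)]"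
      have u: "[0..<7] = [0,1,2,3,4,5,6]" by (simp add: upt_rec)
      have "n = 0 \<or> n = 1 \<or> n = 2 \<or> n = 3" if "n < 4" for n :: nat using that by auto
      then have "?I ! \<sigma> m = ix (t (\<sigma> m))" if "m < 4" for m
        using permutes_lessThan[OF s that] by fastforce
      then have "take 4 (permute_list (t \<circ> \<sigma>) std_index) = permute_list \<sigma> ?I"
        by (auto intro!: nth_equalityI)
      moreover have "\<sigma> 4 = 4" "\<sigma> 5 = 5" "\<sigma> 6 = 6" using s by (auto simp: permutes_def)
      then have "drop 4 (permute_list (t \<circ> \<sigma>) std_index) = [ix (t 4), ix (t 5), ix (t 6)]"
        by (simp add: permute_list_def drop_map u)
      ultimately show ?thesis
        using alternatingD[OF assms(1), of ?I \<sigma>] s by (simp add: tensor_prod_def comp4_def comp3_def)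
    qed
    then have "?l = (\<Sum>\<sigma> | \<sigma> permutes {..<4::nat}. comp4 \<alpha> (t 0) (t 1) (t 2) (t 3) * comp3 \<beta> (t 4) (t
        5) (t 6))"
      by (intro sum.cong refl) simp
    then show ?thesis by (simp add: card_permutations fact_numeral)
  qed
  have S: "{..<Suc 6} = {0,1,2,3,4,5,6}" "{..<Suc 5} = {0,1,2,3,4,5}" "{..<Suc 4} = {0,1,2,3,4}"
    by auto
  have "(\<Sum>\<sigma> | \<sigma> permutes {..<7}. of_int (sign \<sigma>) * tensor_prod 4 \<alpha> \<beta> (permute_list \<sigma> std_index)) =
    (\<Sum>x\<in>{0,1,2,3,4,5,6}. \<Sum>y\<in>{0,1,2,3,4,5}. \<Sum>z\<in>{0,1,2,3,4}. (if x = 6 then 1 else -1) * ((if y = 5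
        then 1 else -1) * ((if z = 4 then 1 else -1) *
      (24 * (let t = Transposition.transpose 6 x \<circ> Transposition.transpose 5 y \<circ>
          Transposition.transpose 4 z in
        comp4 \<alpha> (t 0) (t 1) (t 2) (t 3) * comp3 \<beta> (t 4) (t 5) (t 6))))))"
    unfolding 7 sum_permutes_lessThan_Suc
    unfolding 6 sum_permutes_lessThan_Suc
    unfolding 5 sum_permutes_lessThan_Suc
    unfolding comp_assoc[symmetric] *
    unfolding S sum_distrib_left Let_def mult.assoc ..
  \<comment> \<open>Each of the 35 splittings occurs in 3! = 6 cosets, one for each order of the
    last three slots; 24 * 6 = 144 is the denominator \<open>fact 4 * fact 3\<close> in
    \<open>wedge\<close>.\<close>
  also have "\<dots> = 144 * (comp4 \<alpha> 0 1 2 3 * comp3 \<beta> 4 5 6 - comp4 \<alpha> 0 1 2 4 * comp3 \<beta> 3 5 6 + comp4 \<alpha>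
      0 1 2 5 * comp3 \<beta> 3 4 6
    - comp4 \<alpha> 0 1 2 6 * comp3 \<beta> 3 4 5 + comp4 \<alpha> 0 1 3 4 * comp3 \<beta> 2 5 6 - comp4 \<alpha> 0 1 3 5 * comp3 \<beta> 2 4 6
    + comp4 \<alpha> 0 1 3 6 * comp3 \<beta> 2 4 5 + comp4 \<alpha> 0 1 4 5 * comp3 \<beta> 2 3 6 - comp4 \<alpha> 0 1 4 6 * comp3 \<beta> 2 3 5
    + comp4 \<alpha> 0 1 5 6 * comp3 \<beta> 2 3 4 - comp4 \<alpha> 0 2 3 4 * comp3 \<beta> 1 5 6 + comp4 \<alpha> 0 2 3 5 * comp3 \<beta> 1 4 6
    - comp4 \<alpha> 0 2 3 6 * comp3 \<beta> 1 4 5 - comp4 \<alpha> 0 2 4 5 * comp3 \<beta> 1 3 6 + comp4 \<alpha> 0 2 4 6 * comp3 \<beta> 1 3 5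
    - comp4 \<alpha> 0 2 5 6 * comp3 \<beta> 1 3 4 + comp4 \<alpha> 0 3 4 5 * comp3 \<beta> 1 2 6 - comp4 \<alpha> 0 3 4 6 * comp3 \<beta> 1 2 5
    + comp4 \<alpha> 0 3 5 6 * comp3 \<beta> 1 2 4 - comp4 \<alpha> 0 4 5 6 * comp3 \<beta> 1 2 3 + comp4 \<alpha> 1 2 3 4 * comp3 \<beta> 0 5 6
    - comp4 \<alpha> 1 2 3 5 * comp3 \<beta> 0 4 6 + comp4 \<alpha> 1 2 3 6 * comp3 \<beta> 0 4 5 + comp4 \<alpha> 1 2 4 5 * comp3 \<beta> 0 3 6
    - comp4 \<alpha> 1 2 4 6 * comp3 \<beta> 0 3 5 + comp4 \<alpha> 1 2 5 6 * comp3 \<beta> 0 3 4 - comp4 \<alpha> 1 3 4 5 * comp3 \<beta> 0 2 6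
    + comp4 \<alpha> 1 3 4 6 * comp3 \<beta> 0 2 5 - comp4 \<alpha> 1 3 5 6 * comp3 \<beta> 0 2 4 + comp4 \<alpha> 1 4 5 6 * comp3 \<beta> 0 2 3
    + comp4 \<alpha> 2 3 4 5 * comp3 \<beta> 0 1 6 - comp4 \<alpha> 2 3 4 6 * comp3 \<beta> 0 1 5 + comp4 \<alpha> 2 3 5 6 * comp3 \<beta> 0 1 4
    - comp4 \<alpha> 2 4 5 6 * comp3 \<beta> 0 1 3 + comp4 \<alpha> 3 4 5 6 * comp3 \<beta> 0 1 2)"
    apply (simp only: Let_def Transposition.transpose_def comp4_normal[OF assms(1)] comp3_normal[OF
        assms(2)]
        sum.insert sum.empty finite.intros insert_iff empty_iff o_apply rel_simps if_True if_False simp_thms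
        mult_1 mult_minus_left mult_minus_right minus_minus mult_zero_left mult_zero_right
            minus_zero add_0 add_0_right)
    by algebra
  finally show ?thesis
    by (simp add: wedge_eq fact_numeral)
qed

section \<open>The metric of a positive form\<close>

lemma wedge_sum_left:
  "wedge k l (\<lambda>I. \<Sum>i\<in>S. c i * A i I) \<beta> I = (\<Sum>i\<in>S. c i * wedge k l (A i) \<beta> I)"
proof -
  have "(\<Sum>\<sigma> | \<sigma> permutes {..<k + l}. of_int (sign \<sigma>) *
     (\<Sum>i\<in>S. c i * A i (map (\<lambda>m. I ! \<sigma> m) [0..<k])) * \<beta> (map (\<lambda>m. I ! \<sigma> m) [k..<k + l])) =
     (\<Sum>\<sigma> | \<sigma> permutes {..<k + l}. \<Sum>i\<in>S. c i * (of_int (sign \<sigma>) *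
     A i (map (\<lambda>m. I ! \<sigma> m) [0..<k]) * \<beta> (map (\<lambda>m. I ! \<sigma> m) [k..<k + l])))" (is "?l = _")
    by (intro sum.cong refl) (simp add: sum_distrib_left sum_distrib_right mult_ac)
  also have "\<dots> = (\<Sum>i\<in>S. \<Sum>\<sigma> | \<sigma> permutes {..<k + l}. c i * (of_int (sign \<sigma>) *
     A i (map (\<lambda>m. I ! \<sigma> m) [0..<k]) * \<beta> (map (\<lambda>m. I ! \<sigma> m) [k..<k + l])))"
    by (rule sum.swap)
  finally have eq: "?l = \<dots>" .
  show ?thesis
    unfolding wedge_def eq by (simp add: sum_distrib_left sum_divide_distrib)
qed

lemma wedge_sum_right:
  "wedge k l \<alpha> (\<lambda>I. \<Sum>i\<in>S. c i * B i I) I = (\<Sum>i\<in>S. c i * wedge k l \<alpha> (B i) I)"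
proof -
  have "(\<Sum>\<sigma> | \<sigma> permutes {..<k + l}. of_int (sign \<sigma>) *
     \<alpha> (map (\<lambda>m. I ! \<sigma> m) [0..<k]) * (\<Sum>i\<in>S. c i * B i (map (\<lambda>m. I ! \<sigma> m) [k..<k + l]))) =
     (\<Sum>\<sigma> | \<sigma> permutes {..<k + l}. \<Sum>i\<in>S. c i * (of_int (sign \<sigma>) *
     \<alpha> (map (\<lambda>m. I ! \<sigma> m) [0..<k]) * B i (map (\<lambda>m. I ! \<sigma> m) [k..<k + l])))" (is "?l = _")
    by (intro sum.cong refl) (simp add: sum_distrib_left sum_distrib_right mult_ac)
  also have "\<dots> = (\<Sum>i\<in>S. \<Sum>\<sigma> | \<sigma> permutes {..<k + l}. c i * (of_int (sign \<sigma>) *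
     \<alpha> (map (\<lambda>m. I ! \<sigma> m) [0..<k]) * B i (map (\<lambda>m. I ! \<sigma> m) [k..<k + l])))"
    by (rule sum.swap)
  finally have eq: "?l = \<dots>" .
  show ?thesis
    unfolding wedge_def eq by (simp add: sum_distrib_left sum_divide_distrib)
qed

definition Q_matrix :: "tensor \<Rightarrow> real^7^7" where
  "Q_matrix \<phi> = (\<chi> i j. wedge 4 3 (wedge 2 2 (\<lambda>I. \<phi> (i # I)) (\<lambda>I. \<phi> (j # I))) \<phi> std_index)"

lemma Q_form_eq: "Q_form \<phi> a b std_index = a \<bullet> (Q_matrix \<phi> *v b)"
proof -
  have "Q_form \<phi> a b std_index = (\<Sum>i\<in>UNIV. a $ i * (\<Sum>j\<in>UNIV. b $ j * Q_matrix \<phi> $ i $ j))"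
    unfolding Q_form_def interior_prod_def Q_matrix_def
    by (simp only: wedge_sum_left[abs_def] wedge_sum_right[abs_def] wedge_sum_left wedge_sum_right
        vec_lambda_beta)
  then show ?thesis
    by (simp add: inner_vec_def matrix_vector_mult_def mult_ac)
qed

lemma vec_matrix_eqI:
  assumes "\<And>a b. a \<bullet> (M *v b) = a \<bullet> (N *v b)"
  shows "M = (N :: real^7^7)"
proof -
  have "M *v b = N *v b" for b
    using assms vector_eq_ldot by blast
  then show ?thesis by (simp add: matrix_eq)
qed

lemma inner_matrix_congruence:
  "a \<bullet> ((transpose P ** M ** P) *v b) = (P *v a) \<bullet> (M *v (P *v b))" for M P :: "real^7^7"
  unfolding matrix_vector_mul_assoc[symmetric] dot_lmul_matrix[of a "transpose P", symmetric]
      vector_transpose_matrix ..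

lemma Q_matrix_pull: "Q_matrix (pull P \<phi>) = det P *\<^sub>R (transpose P ** Q_matrix \<phi> ** P)"
proof (rule vec_matrix_eqI)
  fix a b
  show "a \<bullet> (Q_matrix (pull P \<phi>) *v b) = a \<bullet> ((det P *\<^sub>R (transpose P ** Q_matrix \<phi> ** P)) *v b)"
    using Q_form_pull[of P \<phi> a b]
    by (simp add: Q_form_eq inner_matrix_congruence scaleR_matrix_vector_assoc[symmetric])
qed

lemma alternating_Cons:
  assumes "alternating (Suc k) \<omega>" shows "alternating k (\<lambda>I. \<omega> (i # I))"
proof -
  have "interior_prod (axis i 1) \<omega> = (\<lambda>I. \<omega> (i # I))"
    by (simp add: interior_prod_def axis_def if_distrib[of "\<lambda>x. x * _"] cong: if_cong)
  then show ?thesis using alternating_interior_prod[OF assms, of "axis i 1"] by simp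
qed

lemma comp2_Cons: "comp2 (\<lambda>I. \<phi> (ix a # I)) i j = comp3 \<phi> a i j"
  by (simp add: comp2_def comp3_def)

text \<open>2-forms commute under the wedge product, visibly so in the component formula
  \<open>wedge_2_2\<close>.\<close>

lemma transpose_Q_matrix:
  assumes "alternating 3 \<phi>"
  shows "transpose (Q_matrix \<phi>) = Q_matrix \<phi>"
proof -
  have alt: "alternating 2 (\<lambda>I. \<phi> (i # I))" for i
    using alternating_Cons[of 2 \<phi>] assms by simp
  have "comp4 (wedge 2 2 (\<lambda>I. \<phi> (i # I)) (\<lambda>I. \<phi> (j # I))) =
     comp4 (wedge 2 2 (\<lambda>I. \<phi> (j # I)) (\<lambda>I. \<phi> (i # I)))" for i j
    by (intro ext) (simp add: wedge_2_2 alt)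
  moreover have "alternating 4 (wedge 2 2 (\<lambda>I. \<phi> (i # I)) (\<lambda>I. \<phi> (j # I)))" for i j
    using alternating_wedge[of 2 2] by simp
  ultimately have "Q_matrix \<phi> $ i $ j = Q_matrix \<phi> $ j $ i" for i j
    unfolding Q_matrix_def vec_lambda_beta wedge_4_3[OF \<open>\<And>i j. alternating 4 (wedge 2 2 (\<lambda>I. \<phi> (i #
        I)) (\<lambda>I. \<phi> (j # I)))\<close> assms]
    by metis
  then show ?thesis by (simp add: transpose_def vec_eq_iff)
qed

section \<open>Positive matrices and the implicit equation for the metric\<close>

lemma det_scaleR: "det (c *\<^sub>R M) = c ^ 7 * det (M :: real^7^7)"
proof -
  have "(\<chi> i. c *s (M $ i)) = c *\<^sub>R M" by (simp add: vec_eq_iff)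
  then show ?thesis using det_rows_mul[of "\<lambda>i. c" "\<lambda>i. M $ i"] by simp
qed

lemma positive_matrix_det:
  fixes M :: "real^7^7"
  assumes "\<And>v. v \<noteq> 0 \<Longrightarrow> v \<bullet> (M *v v) > 0"
  shows "det M > 0"
proof (rule ccontr)
  assume neg: "\<not> det M > 0"
  \<comment> \<open>The segment from the identity to \<open>M\<close> consists of positive, hence
    invertible, matrices, so the determinant cannot reach zero along it.\<close>
  let ?N = "\<lambda>t. (1 - t) *\<^sub>R mat 1 + t *\<^sub>R M"
  have "continuous_on {0..1} (\<lambda>t. det (?N t))"
    unfolding det_def by (auto intro!: continuous_intros)
  then obtain t where t: "0 \<le> t" "t \<le> 1" "det (?N t) = 0"
    using IVT2'[of "\<lambda>t. det (?N t)" 1 0 0] neg by auto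
  then have "\<not> inj ((*v) (?N t))"
    by (simp add: det_nz_iff_inj[symmetric])
  then obtain v where v: "v \<noteq> 0" "?N t *v v = 0"
    by (metis linear_injective_0 matrix_vector_mul_linear)
  have "v \<bullet> (?N t *v v) = (1 - t) * (v \<bullet> v) + t * (v \<bullet> (M *v v))"
    by (simp add: matrix_vector_mult_add_rdistrib scaleR_matrix_vector_assoc[symmetric] inner_add_right)
  moreover have "v \<bullet> v > 0" "v \<bullet> (M *v v) > 0" using v assms by auto
  then have "(1 - t) * (v \<bullet> v) + t * (v \<bullet> (M *v v)) > 0"
    using t by (cases "t = 0") (auto intro!: add_nonneg_pos)
  ultimately show False using v by simp
qed

lemma inner_product_matrix_det: "inner_product_matrix g \<Longrightarrow> det g > 0"
  by (rule positive_matrix_det) (simp add: inner_product_matrix_def)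

lemma matrix_inv_mult:
  assumes "det (M :: real^7^7) \<noteq> 0"
  shows "M ** matrix_inv M = mat 1" "matrix_inv M ** M = mat 1"
proof -
  have "\<exists>N. M ** N = mat 1 \<and> N ** M = mat 1"
    using assms by (simp add: invertible_det_nz[symmetric] invertible_def)
  then have "M ** matrix_inv M = mat 1 \<and> matrix_inv M ** M = mat 1"
    unfolding matrix_inv_def by (rule someI_ex)
  then show "M ** matrix_inv M = mat 1" "matrix_inv M ** M = mat 1" by auto
qed

lemma matrix_inv_eqI: "M ** N = mat 1 \<Longrightarrow> matrix_inv M = (N :: real^7^7)"
proof -
  assume *: "M ** N = mat 1"
  then have "det M * det N = 1" by (metis det_I det_mul)
  then have "matrix_inv M ** M = mat 1" by (intro matrix_inv_mult) auto
  then show ?thesis by (metis * matrix_mul_assoc matrix_mul_lid matrix_mul_rid)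
qed

lemma raise_eq_pull: "raise g S = pull (transpose (matrix_inv g)) S"
  by (simp add: raise_def pull_def transpose_def)

text \<open>Raising seven indices multiplies by \<open>1 / det g\<close>, and the volume form brings
  \<open>sqrt (det g)\<close>.\<close>

lemma hodge_top:
  assumes "alternating 7 \<omega>" and g: "inner_product_matrix g"
  shows "hodge g 7 \<omega> [] = \<omega> std_index / sqrt (det g)"
proof -
  have d: "det g > 0" using g by (rule inner_product_matrix_det)
  have "det g * det (matrix_inv g) = 1"
    using d matrix_inv_mult[of g] by (metis det_I det_mul less_irrefl)
  then have i: "det (matrix_inv g) = 1 / det g" using d by (simp add: field_simps)
  have "(\<Sum>I | length I = 7. raise g \<omega> I * vol_form g (I @ [])) =
      sqrt (det g) * (\<Sum>I | length I = 7. pull (transpose (matrix_inv g)) \<omega> I * levi_civita I)"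
    by (simp add: raise_eq_pull vol_form_def sum_distrib_left mult_ac)
  also have "(\<Sum>I | length I = 7. pull (transpose (matrix_inv g)) \<omega> I * levi_civita I) =
      (1 / det g) * (\<Sum>I | length I = 7. levi_civita I * \<omega> I)"
    unfolding sum_pull sum_distrib_left by (simp add: pull_levi_civita i mult_ac)
  also have "(\<Sum>I | length I = 7. levi_civita I * \<omega> I) = fact 7 * \<omega> std_index"
    by (rule sum_levi_civita_alternating[OF assms(1)])
  finally have "hodge g 7 \<omega> [] = sqrt (det g) * (1 / det g * \<omega> std_index)"
    by (simp add: hodge_def)
  also have "\<dots> = \<omega> std_index / sqrt (det g)"
    using d by (simp add: field_simps)
  finally show ?thesis .
qed

lemma g2_equation_iff:
  assumes "inner_product_matrix g"
  shows "(\<forall>a b. 6 * (a \<bullet> (g *v b)) = hodge g 7 (Q_form \<phi> a b) []) \<longleftrightarrow> (6 * sqrt (det g)) *\<^sub>R g = Q_matrix \<phi>"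
proof -
  have d: "det g > 0" using assms by (rule inner_product_matrix_det)
  have "alternating 7 (Q_form \<phi> a b)" for a b
    unfolding Q_form_def using alternating_wedge[of 4 3] by simp
  then have "hodge g 7 (Q_form \<phi> a b) [] = (a \<bullet> (Q_matrix \<phi> *v b)) / sqrt (det g)" for a b
    by (simp add: hodge_top assms Q_form_eq)
  moreover have "6 * (a \<bullet> (g *v b)) = (a \<bullet> (Q_matrix \<phi> *v b)) / sqrt (det g) \<longleftrightarrow>
     a \<bullet> (((6 * sqrt (det g)) *\<^sub>R g) *v b) = a \<bullet> (Q_matrix \<phi> *v b)" for a b
    using d by (simp add: scaleR_matrix_vector_assoc[symmetric] field_simps)
  ultimately show ?thesis
    using vec_matrix_eqI[of "(6 * sqrt (det g)) *\<^sub>R g" "Q_matrix \<phi>"] by auto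
qed

text \<open>The value forced on \<open>sqrt (det g)\<close>: determinants of the matrix equation in
  \<open>g2_equation_iff\<close> give
  \<open>6 ^ 7 * sqrt (det g) ^ 9 = det (Q_matrix \<phi>)\<close>, the exponent being 7 from the
  scalar and 2 from \<open>det g\<close>.\<close>

definition Q_scale :: "tensor \<Rightarrow> real" where
  "Q_scale \<phi> = root 9 (det (Q_matrix \<phi>) / 6 ^ 7)"

lemma positive_form_iff: "positive_form \<phi> \<longleftrightarrow> (\<forall>v. v \<noteq> 0 \<longrightarrow> v \<bullet> (Q_matrix \<phi> *v v) > 0)"
  by (simp add: positive_form_def Q_form_eq)

lemma Q_scale_pos:
  assumes "positive_form \<phi>" shows "Q_scale \<phi> > 0"
  using positive_matrix_det[of "Q_matrix \<phi>"] assms by (simp add: Q_scale_def positive_form_iff)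

lemma g2_metric_at_eq:
  assumes "alternating 3 \<phi>" "positive_form \<phi>"
  shows "g2_metric_at \<phi> = (1 / (6 * Q_scale \<phi>)) *\<^sub>R Q_matrix \<phi>"
    and "inner_product_matrix (g2_metric_at \<phi>)"
    and "(6 * sqrt (det (g2_metric_at \<phi>))) *\<^sub>R g2_metric_at \<phi> = Q_matrix \<phi>"
proof -
  let ?r = "Q_scale \<phi>"
  let ?g = "(1 / (6 * ?r)) *\<^sub>R Q_matrix \<phi>"
  have r: "?r > 0" by (rule Q_scale_pos[OF assms(2)])
  have r9: "?r ^ 9 = det (Q_matrix \<phi>) / 6 ^ 7"
    using positive_matrix_det[of "Q_matrix \<phi>"] assms by (simp add: Q_scale_def positive_form_iff)
  have "det ?g = ?r ^ 9 / ?r ^ 7"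
    unfolding det_scaleR r9 by (simp add: field_simps)
  also have "\<dots> = ?r\<^sup>2" using r by (simp add: field_simps flip: power_add)
  finally have det: "sqrt (det ?g) = ?r" using r by simp
  have ip: "inner_product_matrix ?g"
    unfolding inner_product_matrix_def
  proof (intro conjI allI impI)
    show "transpose ?g = ?g"
      using transpose_Q_matrix[OF assms(1)] by (simp add: transpose_def vec_eq_iff)
    show "v \<bullet> (?g *v v) > 0" if "v \<noteq> 0" for v
      using r assms(2) that by (simp add: positive_form_iff scaleR_matrix_vector_assoc[symmetric])
  qed
  have eq: "(6 * sqrt (det ?g)) *\<^sub>R ?g = Q_matrix \<phi>"
    unfolding det using r by simp
  have uniq: "h = ?g" if h: "inner_product_matrix h" "(6 * sqrt (det h)) *\<^sub>R h = Q_matrix \<phi>" for h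
  proof -
    let ?s = "sqrt (det h)"
    have s: "?s > 0" using inner_product_matrix_det[OF h(1)] by simp
    \<comment> \<open>The unknown volume factor is determined first; once \<open>?s = ?r\<close>,
      the equation for \<open>h\<close> is linear.\<close>
    have "(6 * ?s) ^ 7 * ?s\<^sup>2 = det (Q_matrix \<phi>)"
      using h(2) det_scaleR[of "6 * ?s" h] s by simp
    then have "?s ^ 9 = ?r ^ 9"
      unfolding r9 by (simp add: power_mult_distrib field_simps flip: power_add)
    then have "?s = ?r" by (rule power_eq_imp_eq_base) (use s r in auto)
    then have "(6 * ?r) *\<^sub>R h = Q_matrix \<phi>" using h(2) by simp
    then have "(1 / (6 * ?r)) *\<^sub>R ((6 * ?r) *\<^sub>R h) = ?g" by (rule arg_cong)
    then show ?thesis using r by simp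
  qed
  have "g2_metric_at \<phi> = ?g"
    unfolding g2_metric_at_def
  proof (rule the_equality)
    show "inner_product_matrix ?g \<and> (\<forall>a b. 6 * (a \<bullet> (?g *v b)) = hodge ?g 7 (Q_form \<phi> a b) [])"
      using ip eq g2_equation_iff[OF ip] by blast
  next
    fix h assume "inner_product_matrix h \<and> (\<forall>a b. 6 * (a \<bullet> (h *v b)) = hodge h 7 (Q_form \<phi> a b) [])"
    then show "h = ?g" using uniq g2_equation_iff by blast
  qed
  then show "g2_metric_at \<phi> = ?g" "inner_product_matrix (g2_metric_at \<phi>)"
    "(6 * sqrt (det (g2_metric_at \<phi>))) *\<^sub>R g2_metric_at \<phi> = Q_matrix \<phi>"
    using ip eq by simp_all
qed

section \<open>The standard form of a positive form\<close>

text \<open>In the frame \<open>e\<^sub>0, e\<^sub>1, e\<^sub>2, f\<^sub>3, f\<^sub>4, f\<^sub>5, f\<^sub>6\<close> the assumptions fix the components \<open>(i, 3 + j, 6)\<close>, so that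
  the remaining freedom is removed by the values of \<open>Q\<close>.\<close>
lemma frame_normal:
  assumes alt: "alternating 3 \<omega>"
    and W: "\<And>i j k. i < j \<Longrightarrow> j < 3 \<Longrightarrow> 3 \<le> k \<Longrightarrow> k < 7 \<Longrightarrow> comp3 \<omega> i j k = 0"
    and f: "comp3 \<omega> 0 3 6 = -1" "comp3 \<omega> 0 4 6 = 0" "comp3 \<omega> 0 5 6 = 0"
      "comp3 \<omega> 1 3 6 = 0" "comp3 \<omega> 1 4 6 = -1" "comp3 \<omega> 1 5 6 = 0"
      "comp3 \<omega> 2 3 6 = 0" "comp3 \<omega> 2 4 6 = 0" "comp3 \<omega> 2 5 6 = -1"
      "comp3 \<omega> 0 3 4 = 0" "comp3 \<omega> 0 3 5 = 0" "comp3 \<omega> 1 3 4 = 0"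
    and nz: "comp3 \<omega> 0 1 2 \<noteq> 0"
    and Q0: "\<And>i k. i < 3 \<Longrightarrow> 3 \<le> k \<Longrightarrow> k < 7 \<Longrightarrow> Q_matrix \<omega> $ ix i $ ix k = 0"
    and Q1: "Q_matrix \<omega> $ ix 0 $ ix 1 = 0" "Q_matrix \<omega> $ ix 0 $ ix 2 = 0" "Q_matrix \<omega> $ ix 1 $ ix 2 = 0"
    and Q2: "Q_matrix \<omega> $ ix 0 $ ix 0 = Q_matrix \<omega> $ ix 1 $ ix 1"
      "Q_matrix \<omega> $ ix 0 $ ix 0 = Q_matrix \<omega> $ ix 2 $ ix 2"
  shows "comp3 \<omega> 3 4 5 = 0" "comp3 \<omega> 3 4 6 = 0" "comp3 \<omega> 3 5 6 = 0" "comp3 \<omega> 4 5 6 = 0"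
    "comp3 \<omega> 1 4 5 = 0" "comp3 \<omega> 2 4 5 = 0" "comp3 \<omega> 2 3 5 = 0"
    "comp3 \<omega> 1 3 5 = - comp3 \<omega> 0 4 5" "comp3 \<omega> 2 3 4 = comp3 \<omega> 0 4 5"
    "Q_matrix \<omega> $ ix 6 $ ix 6 = 6"
    "Q_matrix \<omega> $ ix 0 $ ix 0 = - 6 * comp3 \<omega> 0 1 2 * comp3 \<omega> 0 4 5"
proof -
  have alt2: "alternating 2 (\<lambda>I. \<omega> (i # I))" for i
    using alternating_Cons[of 2 \<omega>] alt by simp
  have alt4: "alternating 4 (wedge 2 2 (\<lambda>I. \<omega> (i # I)) (\<lambda>I. \<omega> (j # I)))" for i j
    using alternating_wedge[of 2 2] by simp
  note Q = Q_matrix_def vec_lambda_beta wedge_4_3[OF alt4 alt] wedge_2_2[OF alt2 alt2] comp2_Cons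
      comp3_normal[OF alt] W f
  \<comment> \<open>Let omega_i be the 2-form on the last four vectors that multiplies e^i, and rho
    the 3-form part there. Up to a constant, Q of e_i and f_k is \<open>comp3 \<omega> 0 1 2\<close>
    times omega_i wedge the contraction of rho with f_k, so these six values make rho
    vanish.\<close>
  have 1: "Q_matrix \<omega> $ ix 0 $ ix 3 = 0" "Q_matrix \<omega> $ ix 0 $ ix 4 = 0"  "Q_matrix \<omega> $ ix 0 $ ix 5 = 0"
     "Q_matrix \<omega> $ ix 0 $ ix 6 = 0" "Q_matrix \<omega> $ ix 1 $ ix 6 = 0"  "Q_matrix \<omega> $ ix 2 $ ix 6 = 0"
    by (rule Q0; simp)+
  show rho: "comp3 \<omega> 3 4 5 = 0" "comp3 \<omega> 3 4 6 = 0" "comp3 \<omega> 3 5 6 = 0" "comp3 \<omega> 4 5 6 = 0"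
    using 1 nz by (simp_all add: Q del: One_nat_def)
  \<comment> \<open>With rho = 0, Q of e_i and e_j is 3 times \<open>comp3 \<omega> 0 1 2\<close>
    times omega_i wedge omega_j. Each off-diagonal entry isolates one component; the diagonal ones
    compare the squares of the omega_i.\<close>
  show "comp3 \<omega> 1 4 5 = 0" "comp3 \<omega> 2 4 5 = 0" "comp3 \<omega> 2 3 5 = 0"
    using Q1 nz by (simp_all add: Q rho del: One_nat_def)
  show "comp3 \<omega> 1 3 5 = - comp3 \<omega> 0 4 5" "comp3 \<omega> 2 3 4 = comp3 \<omega> 0 4 5"
  proof -
    have "comp3 \<omega> 0 1 2 * (comp3 \<omega> 1 3 5 + comp3 \<omega> 0 4 5) = 0"
      using Q2(1) by (simp add: Q rho algebra_simps del: One_nat_def)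
    then show *: "comp3 \<omega> 1 3 5 = - comp3 \<omega> 0 4 5"
      using nz by (simp add: eq_neg_iff_add_eq_0 del: One_nat_def)
    have "comp3 \<omega> 0 1 2 = 0 \<or> comp3 \<omega> 0 4 5 = comp3 \<omega> 2 3 4"
      using Q2(2) by (simp add: Q rho * algebra_simps del: One_nat_def)
    then show "comp3 \<omega> 2 3 4 = comp3 \<omega> 0 4 5"
      using nz by metis
  qed
  show "Q_matrix \<omega> $ ix 6 $ ix 6 = 6"
    by (simp add: Q rho del: One_nat_def)
  show "Q_matrix \<omega> $ ix 0 $ ix 0 = - 6 * comp3 \<omega> 0 1 2 * comp3 \<omega> 0 4 5"
    by (simp add: Q rho del: One_nat_def)
qed

section \<open>The trilinear form of a positive 3-form\<close>

definition triform :: "tensor \<Rightarrow> real^7 \<Rightarrow> real^7 \<Rightarrow> real^7 \<Rightarrow> real" where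
  "triform \<phi> x y z = (\<Sum>i\<in>UNIV. \<Sum>j\<in>UNIV. \<Sum>k\<in>UNIV. x $ i * y $ j * z $ k * \<phi> [i, j, k])"

lemma triform_add:
  "triform \<phi> (x + x') y z = triform \<phi> x y z + triform \<phi> x' y z"
  "triform \<phi> x (y + y') z = triform \<phi> x y z + triform \<phi> x y' z"
  "triform \<phi> x y (z + z') = triform \<phi> x y z + triform \<phi> x y z'"
  by (simp_all add: triform_def sum.distrib algebra_simps)

lemma triform_scaleR:
  "triform \<phi> (c *\<^sub>R x) y z = c * triform \<phi> x y z"
  "triform \<phi> x (c *\<^sub>R y) z = c * triform \<phi> x y z"
  "triform \<phi> x y (c *\<^sub>R z) = c * triform \<phi> x y z"
  by (simp_all add: triform_def sum_distrib_left mult_ac)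

lemma triform_minus:
  "triform \<phi> (- x) y z = - triform \<phi> x y z"
  "triform \<phi> x (- y) z = - triform \<phi> x y z"
  "triform \<phi> x y (- z) = - triform \<phi> x y z"
  by (simp_all add: triform_def sum_negf)

lemma triform_diff:
  "triform \<phi> (x - x') y z = triform \<phi> x y z - triform \<phi> x' y z"
  "triform \<phi> x (y - y') z = triform \<phi> x y z - triform \<phi> x y' z"
  "triform \<phi> x y (z - z') = triform \<phi> x y z - triform \<phi> x y z'"
  by (simp_all add: triform_def sum_subtractf algebra_simps)

lemma triform_swap:
  assumes "alternating 3 \<phi>"
  shows "triform \<phi> y x z = - triform \<phi> x y z" "triform \<phi> x z y = - triform \<phi> x y z"
proof -
  have s: "\<phi> [j, i, k] = - \<phi> [i, j, k]" "\<phi> [i, k, j] = - \<phi> [i, j, k]" for i j k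
    using comp3_swap[OF assms, of "pos i" "pos j" "pos k"] by (simp_all add: comp3_def)
  have "triform \<phi> y x z = (\<Sum>j\<in>UNIV. \<Sum>i\<in>UNIV. \<Sum>k\<in>UNIV. y $ i * x $ j * z $ k * \<phi> [i, j, k])"
    unfolding triform_def by (rule sum.swap)
  also have "\<dots> = - triform \<phi> x y z"
    unfolding triform_def sum_negf[symmetric] by (intro sum.cong refl) (subst s(1), simp add: mult_ac)
  finally show "triform \<phi> y x z = - triform \<phi> x y z" .
  have "triform \<phi> x z y = (\<Sum>i\<in>UNIV. \<Sum>k\<in>UNIV. \<Sum>j\<in>UNIV. x $ i * z $ j * y $ k * \<phi> [i, j, k])"
    unfolding triform_def by (rule sum.cong[OF refl], rule sum.swap)
  also have "\<dots> = - triform \<phi> x y z"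
    unfolding triform_def sum_negf[symmetric] by (intro sum.cong refl) (subst s(2), simp add: mult_ac)
  finally show "triform \<phi> x z y = - triform \<phi> x y z" .
qed

lemma triform_same:
  assumes "alternating 3 \<phi>"
  shows "triform \<phi> x x z = 0" "triform \<phi> z x x = 0" "triform \<phi> x z x = 0"
proof -
  show "triform \<phi> x x z = 0" "triform \<phi> z x x = 0"
    using triform_swap[OF assms, of x x z] triform_swap[OF assms, of z x x] by simp_all
  then show "triform \<phi> x z x = 0" using triform_swap(1)[OF assms, of x z x] by simp
qed

definition frame :: "(nat \<Rightarrow> real^7) \<Rightarrow> real^7^7" where
  "frame v = (\<chi> r c. v (pos c) $ r)"

lemma column_frame: "n < 7 \<Longrightarrow> column (ix n) (frame v) = v n"
  by (simp add: column_def frame_def vec_eq_iff)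

lemma comp3_pull: "comp3 (pull P \<phi>) i j k = triform \<phi> (column (ix i) P) (column (ix j) P) (column (ix k) P)"
  by (simp add: comp3_def pull_def triform_def sum_lists_Suc prod.lessThan_Suc_shift column_def mult_ac
     numeral_eq_Suc del: prod.lessThan_Suc)

lemma comp3_pull_frame:
  "i < 7 \<Longrightarrow> j < 7 \<Longrightarrow> k < 7 \<Longrightarrow> comp3 (pull (frame v) \<phi>) i j k = triform \<phi> (v i) (v j) (v k)"
  by (simp add: comp3_pull column_frame)

lemma matrix_component: "M $ i $ j = axis i 1 \<bullet> (M *v axis j 1)" for M :: "real^7^7"
  by (simp add: matrix_vector_mult_basis inner_commute[of "axis i 1"] cart_eq_inner_axis[symmetric]
      column_def)

lemma Q_matrix_pull_frame:
  assumes "i < 7" "j < 7"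
  shows "Q_matrix (pull (frame v) \<phi>) $ ix i $ ix j = det (frame v) * (v i \<bullet> (Q_matrix \<phi> *v v j))"
proof -
  let ?M = "transpose (frame v) ** Q_matrix \<phi> ** frame v"
  have "?M $ ix i $ ix j = v i \<bullet> (Q_matrix \<phi> *v v j)"
    by (subst matrix_component, subst inner_matrix_congruence)
       (simp add: matrix_vector_mult_basis column_frame assms)
  then show ?thesis by (simp add: Q_matrix_pull)
qed

lemma exists_frame_extending:
  assumes ind: "\<And>a b. a *\<^sub>R x + b *\<^sub>R y = 0 \<Longrightarrow> a = 0 \<and> b = 0"
  obtains v where "v 0 = x" "v 1 = y" "det (frame v) \<noteq> 0"
proof -
  have "x \<noteq> y" using ind[of 1 "-1"] by auto
  have "independent {x, y}"
  proof -
    have "y \<noteq> 0" using ind[of 0 1] by auto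
    moreover have "x \<notin> span {y}"
    proof
      assume "x \<in> span {y}"
      then obtain k where "x = k *\<^sub>R y" by (auto simp: span_singleton)
      then show False using ind[of 1 "-k"] by simp
    qed
    ultimately show ?thesis using \<open>x \<noteq> y\<close> by (simp add: independent_insert)
  qed
  from maximal_independent_subset_extend[OF subset_UNIV this]
  obtain B where B: "{x, y} \<subseteq> B" "independent B" "span B = (UNIV :: (real^7) set)"
    by (metis top.extremum_uniqueI)
  have fin: "finite B" and card: "card B = 7"
    using B independent_imp_finite[OF B(2)] dim_eq_card[of B UNIV] by auto
  let ?C = "B - {x, y}"
  have "card ?C = 5" using B(1) card fin \<open>x \<noteq> y\<close> by (simp add: card_Diff_subset)
  then obtain h where h: "bij_betw h {0..<5::nat} ?C"
    using ex_bij_betw_nat_finite[of ?C] fin by (metis finite_Diff)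
  define v where "v n = (if n = 0 then x else if n = 1 then y else h (n - 2))" for n :: nat
  have "B \<subseteq> v ` {..<7}"
  proof
    fix b assume "b \<in> B"
    show "b \<in> v ` {..<7}"
    proof (cases "b = x \<or> b = y")
      case True
      have "v 0 = x" "v 1 = y" by (auto simp: v_def)
      then show ?thesis using True by force
    next
      case False
      then have "b \<in> h ` {0..<5}" using h \<open>b \<in> B\<close> by (simp add: bij_betw_def)
      then obtain m where "m < 5" "b = h m" by auto
      then have "b = v (m + 2)" "m + 2 < 7" by (auto simp: v_def)
      then show ?thesis by blast
    qed
  qed
  moreover have "v n \<in> range ((*v) (frame v))" if "n < 7" for n
  proof -
    have "frame v *v axis (ix n) 1 = v n"
      using that by (simp add: matrix_vector_mult_basis column_frame)
    then show ?thesis by (metis rangeI)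
  qed
  ultimately have "B \<subseteq> range ((*v) (frame v))" by auto
  then have "span B \<subseteq> range ((*v) (frame v))"
    by (intro span_minimal linear_subspace_image) auto
  then have "surj ((*v) (frame v))" using B(3) by auto
  then have "inj ((*v) (frame v))"
    by (intro linear_surjective_imp_injective) auto
  then have "det (frame v) \<noteq> 0" using det_nz_iff_inj[OF matrix_vector_mul_linear, of "frame v"] by simp
  then show thesis using that[of v] by (simp add: v_def)
qed

text \<open>Here positivity enters: \<open>Q(x, x)\<close> vanishes if \<open>x\<close> and an independent \<open>y\<close> span a plane
  annihilated by the form.\<close>
lemma triform_nondegenerate:
  assumes alt: "alternating 3 \<phi>" and pos: "positive_form \<phi>"
    and ind: "\<And>a b. a *\<^sub>R x + b *\<^sub>R y = 0 \<Longrightarrow> a = 0 \<and> b = 0"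
  shows "\<exists>z. triform \<phi> x y z \<noteq> 0"
proof (rule ccontr)
  assume "\<not> ?thesis"
  then have 0: "triform \<phi> x y z = 0" for z by blast
  obtain v where v: "v 0 = x" "v 1 = y" "det (frame v) \<noteq> 0"
    using exists_frame_extending[OF ind] by blast
  let ?\<omega> = "pull (frame v) \<phi>"
  have alt': "alternating 3 ?\<omega>" by (rule alternating_pull[OF alt])
  have alt2: "alternating 2 (\<lambda>I. ?\<omega> (i # I))" for i
    using alternating_Cons[of 2 ?\<omega>] alt' by simp
  have alt4: "alternating 4 (wedge 2 2 (\<lambda>I. ?\<omega> (i # I)) (\<lambda>I. ?\<omega> (j # I)))" for i j
    using alternating_wedge[of 2 2] by simp
  have z: "comp3 ?\<omega> 0 1 k = 0" if "k < 7" for k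
    using that 0 v by (simp add: comp3_pull_frame)
  have "Q_matrix ?\<omega> $ ix 0 $ ix 0 = 0"
    by (simp add: Q_matrix_def wedge_4_3[OF alt4 alt'] wedge_2_2[OF alt2 alt2] comp2_Cons
        comp3_normal[OF alt'] z
       del: One_nat_def)
  then have "x \<bullet> (Q_matrix \<phi> *v x) = 0"
    using v by (simp add: Q_matrix_pull_frame)
  moreover have "x \<noteq> 0" using ind[of 1 0] by auto
  ultimately show False using pos by (metis less_irrefl positive_form_iff)
qed

lemma triform_nonzero:
  assumes alt: "alternating 3 \<phi>" and pos: "positive_form \<phi>"
  shows "\<exists>x y z. triform \<phi> x y z \<noteq> 0"
proof -
  have "axis 1 1 \<noteq> (axis 2 1 :: real^7)" by (simp add: axis_eq_axis)
  have "a = 0 \<and> b = 0" if "a *\<^sub>R axis 1 1 + b *\<^sub>R axis 2 1 = (0 :: real^7)" for a b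
    using arg_cong[OF that, of "\<lambda>v. v $ 1"] arg_cong[OF that, of "\<lambda>v. v $ 2"] by (simp add: axis_def)
  then show ?thesis using triform_nondegenerate[OF alt pos, of "axis 1 1" "axis 2 1"] by blast
qed

section \<open>Triples maximising the form\<close>

lemma positive_unit_sphere:
  fixes M :: "real^7^7"
  assumes pos: "\<And>v. v \<noteq> 0 \<Longrightarrow> v \<bullet> (M *v v) > 0"
  shows "compact {v. v \<bullet> (M *v v) = 1}"
proof -
  have cont: "continuous_on UNIV (\<lambda>v. v \<bullet> (M *v v))"
    by (intro continuous_intros)
  have "axis 1 1 \<in> sphere (0 :: real^7) 1" by simp
  then have "sphere (0 :: real^7) 1 \<noteq> {}" by blast
  then obtain m where m: "m \<in> sphere 0 1" "\<And>v. v \<in> sphere 0 1 \<Longrightarrow> m \<bullet> (M *v m) \<le> v \<bullet> (M *v v)"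
    using continuous_attains_inf[OF compact_sphere _ continuous_on_subset[OF cont subset_UNIV], of 0
        1] by blast
  let ?m = "m \<bullet> (M *v m)"
  have "m \<noteq> 0" using m(1) by auto
  then have mpos: "?m > 0" by (rule pos)
  have bound: "?m * (norm v)\<^sup>2 \<le> v \<bullet> (M *v v)" for v
  proof (cases "v = 0")
    case False
    then have "?m \<le> ((1 / norm v) *\<^sub>R v) \<bullet> (M *v ((1 / norm v) *\<^sub>R v))" by (intro m) simp
    also have "\<dots> = (v \<bullet> (M *v v)) / (norm v)\<^sup>2"
      by (simp add: matrix_vector_mult_scaleR power2_eq_square)
    finally show ?thesis using False by (simp add: field_simps)
  qed simp
  have "norm v \<le> 1 / ?m + 1" if "v \<bullet> (M *v v) = 1" for v
  proof -
    have "(norm v)\<^sup>2 \<le> 1 / ?m" using bound[of v] that mpos by (simp add: field_simps)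
    \<comment> \<open>This replaces the square root of \<open>1 / ?m\<close> by a cruder bound
      linear in it.\<close>
    moreover have "2 * norm v \<le> (norm v)\<^sup>2 + 1" using sum_squares_bound[of "norm v" 1] by simp
    moreover have "0 \<le> (norm v)\<^sup>2" by simp
    ultimately show ?thesis using norm_ge_zero[of v] by linarith
  qed
  then have "bounded {v. v \<bullet> (M *v v) = 1}" by (auto simp: bounded_iff)
  moreover have "closed {v. v \<bullet> (M *v v) = 1}"
    using continuous_closed_preimage_constant[OF cont closed_UNIV, of 1] by simp
  ultimately show ?thesis by (simp add: compact_eq_bounded_closed)
qed

lemma exists_maximal_triple:
  assumes alt: "alternating 3 \<phi>" and pos: "positive_form \<phi>"
  defines "B \<equiv> \<lambda>x y. x \<bullet> (Q_matrix \<phi> *v y)"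
  obtains x y z where "B x x = 1" "B y y = 1" "B z z = 1" "triform \<phi> x y z > 0"
    "\<And>x' y' z'. B x' x' = 1 \<Longrightarrow> B y' y' = 1 \<Longrightarrow> B z' z' = 1 \<Longrightarrow> triform \<phi> x' y' z' \<le> triform \<phi> x y z"
proof -
  have Bpos: "B v v > 0" if "v \<noteq> 0" for v using pos that by (simp add: B_def positive_form_iff)
  let ?S = "{v. B v v = 1}"
  let ?f = "\<lambda>p. triform \<phi> (fst p) (fst (snd p)) (snd (snd p))"
  have comp: "compact ?S" using positive_unit_sphere Bpos unfolding B_def .
  have ne: "(1 / sqrt (B v v)) *\<^sub>R v \<in> ?S" if "v \<noteq> 0" for v
  proof -
    have "B ((1 / sqrt (B v v)) *\<^sub>R v) ((1 / sqrt (B v v)) *\<^sub>R v) = (1 / sqrt (B v v))\<^sup>2 * B v v"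
      by (simp add: B_def matrix_vector_mult_scaleR power2_eq_square)
    then show ?thesis using Bpos[OF that] by (simp add: power_divide)
  qed
  have "continuous_on (?S \<times> ?S \<times> ?S) ?f"
    unfolding triform_def by (intro continuous_intros)
  moreover have "?S \<noteq> {}" using ne[of "axis 1 1"] by (force simp: axis_eq_0_iff)
  moreover have "compact (?S \<times> ?S \<times> ?S)" by (intro compact_Times comp)
  ultimately obtain p where p: "p \<in> ?S \<times> ?S \<times> ?S" "\<And>q. q \<in> ?S \<times> ?S \<times> ?S \<Longrightarrow> ?f q \<le> ?f p"
    using continuous_attains_sup[of "?S \<times> ?S \<times> ?S" ?f] by blast
  obtain x y z where xyz: "p = (x, y, z)" by (cases p) auto
  have max: "triform \<phi> x' y' z' \<le> triform \<phi> x y z" if "B x' x' = 1" "B y' y' = 1" "B z' z' = 1" for x' y' z'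
    using p(2)[of "(x', y', z')"] that xyz by simp
  obtain u v w where uvw: "triform \<phi> u v w \<noteq> 0" using triform_nonzero[OF alt pos] by blast
  have nz: "u \<noteq> 0" "v \<noteq> 0" "w \<noteq> 0" using uvw by (auto simp: triform_def)
  let ?u = "(1 / sqrt (B u u)) *\<^sub>R u" and ?v = "(1 / sqrt (B v v)) *\<^sub>R v" and ?w = "(1 / sqrt (B w
      w)) *\<^sub>R w"
  have "triform \<phi> ?u ?v ?w \<noteq> 0"
    using uvw nz Bpos[of u] Bpos[of v] Bpos[of w] by (simp add: triform_scaleR)
  moreover have "B (- a) (- a) = B a a" for a
    unfolding B_def using matrix_vector_mult_scaleR[of "Q_matrix \<phi>" "-1" a] by simp
  \<comment> \<open>Reversing one vector reverses the sign of the value, so the maximum dominates a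
    nonzero absolute value.\<close>
  ultimately have "triform \<phi> x y z > 0"
    using max[of ?u ?v ?w] max[of "- ?u" ?v ?w] ne nz unfolding triform_minus by force
  then show thesis using that[of x y z] p(1) xyz max by auto
qed

text \<open>First-order condition for \<open>t \<mapsto> \<phi>(x, y, z + t v)\<close>, normalised to the unit sphere.\<close>
lemma maximal_triple_orthogonal:
  assumes alt: "alternating 3 \<phi>" and pos: "positive_form \<phi>"
  defines "B \<equiv> \<lambda>x y. x \<bullet> (Q_matrix \<phi> *v y)"
  assumes z: "B z z = 1" and F: "triform \<phi> x y z > 0"
    and max: "\<And>z'. B z' z' = 1 \<Longrightarrow> triform \<phi> x y z' \<le> triform \<phi> x y z"
    and v: "B z v = 0"
  shows "triform \<phi> x y v = 0"
proof (rule ccontr)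
  assume nz: "triform \<phi> x y v \<noteq> 0"
  let ?l = "triform \<phi> x y z" and ?d = "triform \<phi> x y v"
  have sym: "B a b = B b a" for a b
    unfolding B_def using transpose_Q_matrix[OF alt]
    by (metis dot_lmul_matrix inner_commute vector_transpose_matrix)
  have v': "B v z = 0" using v sym by simp
  have Bv: "B v v \<ge> 0"
    using pos by (cases "v = 0") (auto simp: B_def positive_form_iff less_imp_le)
  have ineq: "?l + t * ?d \<le> ?l * (1 + t\<^sup>2 * B v v)" for t
  proof -
    let ?w = "z + t *\<^sub>R v"
    let ?b = "1 + t\<^sup>2 * B v v"
    have Bw: "B ?w ?w = ?b"
      using z v v' by (simp add: B_def matrix_vector_right_distrib matrix_vector_mult_scaleR inner_add_left
          inner_add_right power2_eq_square algebra_simps)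
    have b: "?b \<ge> 1" using Bv by simp
    have "B ((1 / sqrt ?b) *\<^sub>R ?w) ((1 / sqrt ?b) *\<^sub>R ?w) = (1 / sqrt ?b)\<^sup>2 * B ?w ?w"
      by (simp only: B_def matrix_vector_mult_scaleR power2_eq_square inner_scaleR_left
          inner_scaleR_right mult.assoc)
    also have "\<dots> = 1" using b by (simp add: Bw power_divide)
    finally have "triform \<phi> x y ((1 / sqrt ?b) *\<^sub>R ?w) \<le> ?l" by (rule max)
    then have "?l + t * ?d \<le> ?l * sqrt ?b" using b by (simp add: triform_scaleR triform_add field_simps)
    \<comment> \<open>Since \<open>?b\<close> is at least 1, the root coming from the normalisation
      can be replaced by \<open>?b\<close> itself, which leaves a polynomial inequality in
      \<open>t\<close>.\<close>
    also have "sqrt ?b \<le> ?b" using b by (intro real_le_lsqrt self_le_power) auto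
    then have "?l * sqrt ?b \<le> ?l * ?b" using F by simp
    finally show ?thesis .
  qed
  \<comment> \<open>For small t the linear gain t d exceeds the quadratic loss. The choice t = d / c
    makes this explicit: the loss is t^2 (c - 1), less than t^2 c = t d.\<close>
  let ?c = "?l * B v v + 1"
  have c: "?c > 0" using F Bv by (simp add: add_nonneg_pos)
  have "(?d / ?c) * ?d \<le> ?l * ((?d / ?c)\<^sup>2 * B v v)"
    using ineq[of "?d / ?c"] by (simp add: algebra_simps)
  also have "\<dots> = (?d / ?c)\<^sup>2 * (?c - 1)" by simp
  also have "\<dots> < (?d / ?c)\<^sup>2 * ?c" using nz c by simp
  also have "\<dots> = (?d / ?c) * ?d" using c by (simp add: power2_eq_square)
  finally show False by simp
qed

text \<open>The indices \<open>0, 1, 2\<close> span an associative 3-plane, and \<open>3, 4, 5, 6\<close> its complement.\<close>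
definition standard_form :: "tensor \<Rightarrow> bool" where
  "standard_form \<omega> \<longleftrightarrow> alternating 3 \<omega> \<and>
     comp3 \<omega> 0 1 2 = 1 \<and> comp3 \<omega> 0 1 3 = 0 \<and> comp3 \<omega> 0 1 4 = 0 \<and> comp3 \<omega> 0 1 5 = 0 \<and>
     comp3 \<omega> 0 1 6 = 0 \<and> comp3 \<omega> 0 2 3 = 0 \<and> comp3 \<omega> 0 2 4 = 0 \<and> comp3 \<omega> 0 2 5 = 0 \<and>
     comp3 \<omega> 0 2 6 = 0 \<and> comp3 \<omega> 0 3 4 = 0 \<and> comp3 \<omega> 0 3 5 = 0 \<and> comp3 \<omega> 0 3 6 = -1 \<and>
     comp3 \<omega> 0 4 5 = -1 \<and> comp3 \<omega> 0 4 6 = 0 \<and> comp3 \<omega> 0 5 6 = 0 \<and> comp3 \<omega> 1 2 3 = 0 \<and>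
     comp3 \<omega> 1 2 4 = 0 \<and> comp3 \<omega> 1 2 5 = 0 \<and> comp3 \<omega> 1 2 6 = 0 \<and> comp3 \<omega> 1 3 4 = 0 \<and>
     comp3 \<omega> 1 3 5 = 1 \<and> comp3 \<omega> 1 3 6 = 0 \<and> comp3 \<omega> 1 4 5 = 0 \<and> comp3 \<omega> 1 4 6 = -1 \<and>
     comp3 \<omega> 1 5 6 = 0 \<and> comp3 \<omega> 2 3 4 = -1 \<and> comp3 \<omega> 2 3 5 = 0 \<and> comp3 \<omega> 2 3 6 = 0 \<and>
     comp3 \<omega> 2 4 5 = 0 \<and> comp3 \<omega> 2 4 6 = 0 \<and> comp3 \<omega> 2 5 6 = -1 \<and> comp3 \<omega> 3 4 5 = 0 \<and>
     comp3 \<omega> 3 4 6 = 0 \<and> comp3 \<omega> 3 5 6 = 0 \<and> comp3 \<omega> 4 5 6 = 0"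

lemma less_7_cases: "i < 7 \<Longrightarrow> i = 0 \<or> i = 1 \<or> i = 2 \<or> i = 3 \<or> i = 4 \<or> i = 5 \<or> i = (6::nat)"
  by arith

lemma Q_matrix_standard_ix:
  assumes "standard_form \<omega>" "i < 7" "j < 7"
  shows "Q_matrix \<omega> $ ix i $ ix j = (if i = j then 6 else 0)"
proof -
  have alt: "alternating 3 \<omega>" using assms by (simp add: standard_form_def)
  have alt2: "alternating 2 (\<lambda>I. \<omega> (i # I))" for i
    using alternating_Cons[of 2 \<omega>] alt by simp
  have alt4: "alternating 4 (wedge 2 2 (\<lambda>I. \<omega> (i # I)) (\<lambda>I. \<omega> (j # I)))" for i j
    using alternating_wedge[of 2 2] by simp
  note std = assms(1)[unfolded standard_form_def]
  note Q = Q_matrix_def vec_lambda_beta wedge_4_3[OF alt4 alt] wedge_2_2[OF alt2 alt2] comp2_Cons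
      comp3_normal[OF alt] std
  show ?thesis
    using less_7_cases[OF assms(2)] less_7_cases[OF assms(3)]
    apply (elim disjE; hypsubst)
    apply (simp_all add: Q del: One_nat_def)
    done
qed

lemma Q_matrix_standard: "standard_form \<omega> \<Longrightarrow> Q_matrix \<omega> = 6 *\<^sub>R mat 1"
  using Q_matrix_standard_ix[of \<omega> "pos i" "pos j" for i j]
  by (simp add: vec_eq_iff mat_def) (metis ix_pos)

section \<open>Dual vectors and the adapted frame\<close>

definition covector :: "tensor \<Rightarrow> real^7 \<Rightarrow> real^7 \<Rightarrow> real^7" where
  "covector \<phi> x y = (\<chi> k. \<Sum>i\<in>UNIV. \<Sum>j\<in>UNIV. x $ i * y $ j * \<phi> [i, j, k])"

lemma covector: "covector \<phi> x y \<bullet> z = triform \<phi> x y z"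
proof -
  have "covector \<phi> x y \<bullet> z = (\<Sum>k\<in>UNIV. \<Sum>i\<in>UNIV. \<Sum>j\<in>UNIV. x $ i * y $ j * z $ k * \<phi> [i, j, k])"
    by (simp add: covector_def inner_vec_def sum_distrib_left sum_distrib_right mult_ac)
  also have "\<dots> = (\<Sum>i\<in>UNIV. \<Sum>k\<in>UNIV. \<Sum>j\<in>UNIV. x $ i * y $ j * z $ k * \<phi> [i, j, k])"
    by (rule sum.swap)
  also have "\<dots> = triform \<phi> x y z"
    unfolding triform_def by (rule sum.cong[OF refl], rule sum.swap)
  finally show ?thesis .
qed

lemma exists_dual_vector:
  fixes x :: "'a::euclidean_space"
  assumes "x \<notin> span S"
  obtains v where "x \<bullet> v = 1" "\<And>s. s \<in> S \<Longrightarrow> s \<bullet> v = 0"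
proof -
  \<comment> \<open>The component \<open>z\<close> of \<open>x\<close> orthogonal to
    \<open>span S\<close>, divided by its squared length, is the dual vector.\<close>
  obtain y z where yz: "y \<in> span S" "\<And>w. w \<in> span S \<Longrightarrow> orthogonal z w" "x = y + z"
    using orthogonal_subspace_decomp_exists[of S x] by blast
  have "z \<noteq> 0" using yz assms by auto
  then have "z \<bullet> z \<noteq> 0" by simp
  moreover have "x \<bullet> z = z \<bullet> z"
    using yz by (simp add: inner_add_left) (metis orthogonal_def inner_commute)
  ultimately have "x \<bullet> ((1 / (z \<bullet> z)) *\<^sub>R z) = 1" by simp
  moreover have "s \<bullet> ((1 / (z \<bullet> z)) *\<^sub>R z) = 0" if "s \<in> S" for s
    using yz(2)[OF span_base[OF that]] by (simp add: orthogonal_def inner_commute)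
  ultimately show thesis using that by blast
qed

text \<open>If \<open>covector \<phi> x f\<close> depended on the other five covectors, then
  \<open>f\<close> and a combination of \<open>x\<close>, \<open>y\<close>, \<open>z\<close> would
  span a plane annihilated by the form, against \<open>triform_nondegenerate\<close>. Independence
  allows the values on a vector Q-orthogonal to \<open>x\<close>, \<open>y\<close>, \<open>z\<close>
  to be prescribed.\<close>

lemma exists_dual_frame_vector:
  assumes alt: "alternating 3 \<phi>" and pos: "positive_form \<phi>"
  defines "B \<equiv> \<lambda>x y. x \<bullet> (Q_matrix \<phi> *v y)"
  assumes B: "B x x = 1" "B y y = 1" "B z z = 1" "B x y = 0" "B x z = 0" "B y z = 0"
    and f: "f \<noteq> 0" "B x f = 0" "B y f = 0" "B z f = 0"
    and F: "triform \<phi> x y f = 0" "triform \<phi> x z f = 0" "triform \<phi> y z f = 0"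
  obtains h where "B x h = 0" "B y h = 0" "B z h = 0" "triform \<phi> x f h = 1" "triform \<phi> y f h = 0"
      "triform \<phi> z f h = 0"
proof -
  let ?M = "Q_matrix \<phi>"
  have sym: "B a b = B b a" for a b
    unfolding B_def using transpose_Q_matrix[OF alt]
    by (metis dot_lmul_matrix inner_commute vector_transpose_matrix)
  have MB: "(?M *v a) \<bullet> b = B a b" for a b
    using sym[of b a] by (simp add: B_def inner_commute)
  let ?S = "{?M *v x, ?M *v y, ?M *v z, covector \<phi> y f, covector \<phi> z f}"
  have "covector \<phi> x f \<notin> span ?S"
  proof
    assume "covector \<phi> x f \<in> span ?S"
    then obtain a b c d e where "covector \<phi> x f - a *\<^sub>R (?M *v x) - b *\<^sub>R (?M *v y) - c *\<^sub>R (?M *v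
        z) - d *\<^sub>R covector \<phi> y f
      - e *\<^sub>R covector \<phi> z f = 0"
      by (auto simp: span_insert)
    then have "(covector \<phi> x f - a *\<^sub>R (?M *v x) - b *\<^sub>R (?M *v y) - c *\<^sub>R (?M *v z) - d *\<^sub>R covector \<phi> y f
      - e *\<^sub>R covector \<phi> z f) \<bullet> v = 0" for v by simp
    then have lin: "triform \<phi> x f v = a * B x v + b * B y v + c * B z v + d * triform \<phi> y f v + e *
        triform \<phi> z f v" for v
      by (simp add: inner_diff_left covector MB algebra_simps)
    note sw = triform_swap[OF alt]
    have F0: "triform \<phi> p f q = 0" if "p \<in> {x, y, z}" "q \<in> {x, y, z}" for p q
    proof -
      have "triform \<phi> y x f = 0" "triform \<phi> z x f = 0" "triform \<phi> z y f = 0"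
        using F sw(1)[of y x f] sw(1)[of z x f] sw(1)[of z y f] by simp_all
      then have "triform \<phi> p q f = 0" using that F triform_same[OF alt] by auto
      then show ?thesis using sw(2)[of p f q] by simp
    qed
    \<comment> \<open>At \<open>x\<close>, \<open>y\<close> and \<open>z\<close> all terms with the
      trilinear form vanish by \<open>F0\<close>, which isolates the coefficients of the
      Q-covectors.\<close>
    have "a = 0" using lin[of x] F0 B sym by simp
    moreover have "b = 0" using lin[of y] F0 B sym by simp
    moreover have "c = 0" using lin[of z] F0 B sym by simp
    ultimately have "triform \<phi> (x - d *\<^sub>R y - e *\<^sub>R z) f v = 0" for v
      using lin[of v] by (simp add: triform_diff triform_scaleR)
    moreover have "\<alpha> = 0 \<and> \<beta> = 0" if "\<alpha> *\<^sub>R (x - d *\<^sub>R y - e *\<^sub>R z) + \<beta> *\<^sub>R f = 0" for \<alpha> \<beta>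
    proof -
      have "(?M *v x) \<bullet> (\<alpha> *\<^sub>R (x - d *\<^sub>R y - e *\<^sub>R z) + \<beta> *\<^sub>R f) = \<alpha>"
        using B f by (simp add: inner_add_right inner_diff_right MB)
      then have "\<alpha> = 0" using that by simp
      then show ?thesis using that f(1) by simp
    qed
    ultimately show False using triform_nondegenerate[OF alt pos] by blast
  qed
  then obtain h where h: "covector \<phi> x f \<bullet> h = 1" "\<And>s. s \<in> ?S \<Longrightarrow> s \<bullet> h = 0"
    by (rule exists_dual_vector) blast
  show thesis
    by (rule that[of h])
       (use h(1) h(2)[of "?M *v x"] h(2)[of "?M *v y"] h(2)[of "?M *v z"] h(2)[of "covector \<phi> y f"]
         h(2)[of "covector \<phi> z f"] in \<open>simp_all add: covector MB\<close>)
qed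

lemma exists_standard_frame:
  assumes alt: "alternating 3 \<phi>" and pos: "positive_form \<phi>"
  obtains P where "det P > 0" "standard_form (pull P \<phi>)"
proof -
  let ?M = "Q_matrix \<phi>"
  define B where "B x y = x \<bullet> (?M *v y)" for x y
  define F where "F = triform \<phi>"
  have sym: "B a b = B b a" for a b
    unfolding B_def using transpose_Q_matrix[OF alt]
    by (metis dot_lmul_matrix inner_commute vector_transpose_matrix)
  have Blin: "B a (b + c) = B a b + B a c" "B a (b - c) = B a b - B a c" "B a (r *\<^sub>R b) = r * B a b"
      for a b c r
    by (simp_all add: B_def matrix_vector_right_distrib matrix_vector_mult_diff_distrib
        matrix_vector_mult_scaleR
        inner_add_right inner_diff_right)
  have Bpos: "B v v > 0" if "v \<noteq> 0" for v using pos that by (simp add: B_def positive_form_iff)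
  note Flin = triform_add[of \<phi>, folded F_def] triform_diff[of \<phi>, folded F_def] triform_scaleR[of \<phi>,
      folded F_def]
  note Fswap = triform_swap[OF alt, folded F_def]
  note Fsame = triform_same[OF alt, folded F_def]
  obtain x y z where unit: "B x x = 1" "B y y = 1" "B z z = 1" and Fpos: "F x y z > 0"
    and max: "\<And>x' y' z'. B x' x' = 1 \<Longrightarrow> B y' y' = 1 \<Longrightarrow> B z' z' = 1 \<Longrightarrow> F x' y' z' \<le> F x y z"
    using exists_maximal_triple[OF alt pos, folded B_def F_def] by metis
  \<comment> \<open>The first-order condition concerns the last slot; cyclic rotation brings each
    vector of the triple there without a sign.\<close>
  have cyc: "F b c a = F a b c" for a b c using Fswap(1)[of b a c] Fswap(2)[of b c a] by simp
  note orth = maximal_triple_orthogonal[OF alt pos, folded B_def F_def]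
  have Fz: "F x y v = 0" if "B z v = 0" for v
    by (rule orth[of z]) (use unit Fpos max that in auto)
  have Fpos': "F y z x > 0" "F z x y > 0"
    using Fpos cyc[of y z x] cyc[of z x y] by simp_all
  have "F y z v \<le> F y z x" if "B v v = 1" for v
    using max[OF that unit(2,3)] by (simp add: cyc[of y z])
  then have Fx: "F y z v = 0" if "B x v = 0" for v
    by (intro orth[of x]) (use unit Fpos' that in simp_all)
  have "F z x v \<le> F z x y" if "B v v = 1" for v
    using max[OF unit(1) that unit(3)] cyc[of z x v] cyc[of v z x] cyc[of z x y] cyc[of y z x] by linarith
  then have Fy: "F z x v = 0" if "B y v = 0" for v
    by (intro orth[of y]) (use unit Fpos' that in simp_all)
  \<comment> \<open>The vector \<open>x - B z x *\<^sub>R z\<close> is Q-orthogonal to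
    \<open>z\<close>, and \<open>F x y\<close> takes the value \<open>- B z x * F x y z\<close> on
    it.\<close>
  have "B z x = 0"
    using Fz[of "x - B z x *\<^sub>R z"] Fpos unit by (simp add: Blin Flin Fsame)
  moreover have "B z y = 0"
    using Fz[of "y - B z y *\<^sub>R z"] Fpos unit by (simp add: Blin Flin Fsame)
  moreover have "B x y = 0"
    using Fx[of "y - B x y *\<^sub>R x"] Fpos' unit by (simp add: Blin Flin Fsame)
  ultimately have orthB: "B x y = 0" "B x z = 0" "B y z = 0" "B y x = 0" "B z x = 0" "B z y = 0"
    using sym by metis+
  \<comment> \<open>Three covectors cannot cut out zero in dimension 7, so the complement contains a
    nonzero \<open>f\<close>.\<close>
  have "dim {?M *v x, ?M *v y, ?M *v z} \<le> card {?M *v x, ?M *v y, ?M *v z}"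
    by (rule dim_le_card') simp
  also have "\<dots> < DIM(real^7)" by (simp add: card_insert_if)
  finally obtain f where f: "f \<noteq> 0" "\<And>s. s \<in> span {?M *v x, ?M *v y, ?M *v z} \<Longrightarrow> orthogonal f s"
    by (rule orthogonal_to_subspace_exists) blast
  have Bf: "B x f = 0" "B y f = 0" "B z f = 0"
    using f(2)[OF span_base] sym by (auto simp: orthogonal_def B_def)
  have Ff: "F x y f = 0" "F x z f = 0" "F y z f = 0"
    using Fz Fx Fy Bf Fswap(1)[of x z] by auto
  have Ff': "F y x f = 0" "F z x f = 0" "F z y f = 0"
    using Ff Fswap(1)[of y x] Fswap(1)[of z x] Fswap(1)[of z y] by auto
  note dual = exists_dual_frame_vector[OF alt pos, folded B_def F_def]
  obtain h1 where h1: "B x h1 = 0" "B y h1 = 0" "B z h1 = 0" "F x f h1 = 1" "F y f h1 = 0" "F z f h1 = 0"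
    using dual[of x y z f] unit orthB f(1) Bf Ff Ff' by metis
  obtain h2 where h2: "B x h2 = 0" "B y h2 = 0" "B z h2 = 0" "F x f h2 = 0" "F y f h2 = 1" "F z f h2 = 0"
    using dual[of y x z f] unit orthB f(1) Bf Ff Ff' by metis
  obtain h3 where h3: "B x h3 = 0" "B y h3 = 0" "B z h3 = 0" "F x f h3 = 0" "F y f h3 = 0" "F z f h3 = 1"
    using dual[of z x y f] unit orthB f(1) Bf Ff Ff' by metis
  \<comment> \<open>Adding multiples of \<open>f\<close> to the dual vectors removes three components.\<close>
  define k1 where "k1 = h1 - F y h1 h2 *\<^sub>R f"
  define k2 where "k2 = h2 + F x h1 h2 *\<^sub>R f"
  define k3 where "k3 = h3 + F x h1 h3 *\<^sub>R f"
  note k_defs = k1_def k2_def k3_def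
  have Bk: "B x k1 = 0" "B y k1 = 0" "B z k1 = 0" "B x k2 = 0" "B y k2 = 0" "B z k2 = 0"
    "B x k3 = 0" "B y k3 = 0" "B z k3 = 0"
    using h1 h2 h3 Bf by (simp_all add: k_defs Blin)
  have Fk: "F x k1 f = -1" "F x k2 f = 0" "F x k3 f = 0" "F y k1 f = 0" "F y k2 f = -1" "F y k3 f = 0"
    "F z k1 f = 0" "F z k2 f = 0" "F z k3 f = -1"
    using h1 h2 h3 by (simp_all add: k_defs Flin Fsame Fswap(2)[of _ _ f])
  have Fk': "F x k1 k2 = 0" "F x k1 k3 = 0" "F y k1 k2 = 0"
    using h1 h2 h3 by (simp_all add: k_defs Flin Fsame Fswap(2)[of _ _ f])
  define v where "v n = [x, y, z, k1, k2, k3, f] ! n" for n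
  have v: "v 0 = x" "v 1 = y" "v 2 = z" "v 3 = k1" "v 4 = k2" "v 5 = k3" "v 6 = f"
    by (simp_all add: v_def)
  let ?\<omega> = "pull (frame v) \<phi>"
  have comp: "comp3 ?\<omega> i j k = F (v i) (v j) (v k)" if "i < 7" "j < 7" "k < 7" for i j k
    using that by (simp add: comp3_pull_frame F_def)
  have Qv: "Q_matrix ?\<omega> $ ix i $ ix j = det (frame v) * B (v i) (v j)" if "i < 7" "j < 7" for i j
    using that by (simp add: Q_matrix_pull_frame B_def)
  have W: "comp3 ?\<omega> i j k = 0" if "i < j" "j < 3" "3 \<le> k" "k < 7" for i j k
  proof -
    have "i = 0 \<and> j = 1 \<or> i = 0 \<and> j = 2 \<or> i = 1 \<and> j = 2" "k = 3 \<or> k = 4 \<or> k = 5 \<or> k = 6" using that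
        by arith+
    then show ?thesis
      using Fx Fz Fy Bf Bk Fswap(1)[of x z] by (auto simp: comp v simp del: One_nat_def)
  qed
  have QW: "Q_matrix ?\<omega> $ ix i $ ix k = 0" if "i < 3" "3 \<le> k" "k < 7" for i k
  proof -
    have "i = 0 \<or> i = 1 \<or> i = 2" "k = 3 \<or> k = 4 \<or> k = 5 \<or> k = 6" using that by arith+
    then show ?thesis using Bf Bk by (auto simp: Qv v simp del: One_nat_def)
  qed
  have nz: "comp3 ?\<omega> 0 1 2 \<noteq> 0" using Fpos by (simp add: comp v del: One_nat_def)
  note normal = frame_normal[OF alternating_pull[OF alt] W _ _ _ _ _ _ _ _ _ _ _ _ nz QW]
  have N: "F k1 k2 k3 = 0" "F k1 k2 f = 0" "F k1 k3 f = 0" "F k2 k3 f = 0"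
    "F y k2 k3 = 0" "F z k2 k3 = 0" "F z k1 k3 = 0" "F y k1 k3 = - F x k2 k3" "F z k1 k2 = F x k2 k3"
    and Q6: "det (frame v) * B f f = 6" and Q1: "det (frame v) = - 6 * F x y z * F x k2 k3"
    using normal Fk Fk' unit orthB by (simp_all add: comp Qv v del: One_nat_def)
  \<comment> \<open>Positivity of Q at \<open>f\<close> fixes the orientation of the frame, and unit
    length of \<open>x\<close> then fixes the sign of \<open>F x k2 k3\<close>. The split form would
    have the opposite sign here.\<close>
  have "det (frame v) > 0" using Q6 Bpos[OF f(1)] by (metis zero_less_mult_pos2 zero_less_numeral)
  then have "0 < (6 * F x y z) * (- F x k2 k3)" using Q1 by simp
  moreover have "0 < 6 * F x y z" using Fpos by simp
  ultimately have s: "- F x k2 k3 > 0" by (rule zero_less_mult_pos)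
  \<comment> \<open>Scaling the triple by \<open>\<epsilon>\<close>, the vectors \<open>k1\<close>,
    \<open>k2\<close>, \<open>k3\<close> by \<open>\<sigma>\<close> and \<open>f\<close> by
    \<open>\<tau>\<close> preserves all zeros. The three kinds of remaining components lead to
    \<open>\<epsilon> ^ 3 * F x y z = 1\<close>,
    \<open>\<epsilon> * \<sigma>\<^sup>2 * F x k2 k3 = -1\<close> and
    \<open>\<epsilon> * \<sigma> * \<tau> = 1\<close>.\<close>
  define \<epsilon> where "\<epsilon> = 1 / root 3 (F x y z)"
  define \<sigma> where "\<sigma> = 1 / sqrt (\<epsilon> * (- F x k2 k3))"
  define \<tau> where "\<tau> = 1 / (\<epsilon> * \<sigma>)"
  have \<epsilon>: "\<epsilon> > 0" "\<epsilon> ^ 3 * F x y z = 1" using Fpos by (auto simp: \<epsilon>_def power_divide)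
  have p: "\<epsilon> * (- F x k2 k3) > 0" using \<epsilon>(1) s by (rule mult_pos_pos)
  then have "\<sigma>\<^sup>2 = 1 / (\<epsilon> * (- F x k2 k3))" by (simp add: \<sigma>_def power_divide)
  moreover have "\<sigma> > 0" using p by (simp add: \<sigma>_def)
  ultimately have \<sigma>: "\<sigma> > 0" "\<epsilon> * \<sigma>\<^sup>2 * F x k2 k3 = -1" using p by auto
  have \<tau>: "\<tau> > 0" "\<epsilon> * \<sigma> * \<tau> = 1" using \<epsilon> \<sigma> by (auto simp: \<tau>_def)
  define w where "w n = [\<epsilon> *\<^sub>R x, \<epsilon> *\<^sub>R y, \<epsilon> *\<^sub>R z, \<sigma> *\<^sub>R k1, \<sigma> *\<^sub>R k2, \<sigma> *\<^sub>R k3, \<tau> *\<^sub>R f] ! n" for n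
  have w: "w 0 = \<epsilon> *\<^sub>R x" "w 1 = \<epsilon> *\<^sub>R y" "w 2 = \<epsilon> *\<^sub>R z" "w 3 = \<sigma> *\<^sub>R k1" "w 4 = \<sigma> *\<^sub>R k2" "w 5 = \<sigma>
      *\<^sub>R k3" "w 6 = \<tau> *\<^sub>R f"
    by (simp_all add: w_def)
  let ?\<eta> = "pull (frame w) \<phi>"
  have compw: "comp3 ?\<eta> i j k = F (w i) (w j) (w k)" if "i < 7" "j < 7" "k < 7" for i j k
    using that by (simp add: comp3_pull_frame F_def)
  have Wv: "F x y k1 = 0" "F x y k2 = 0" "F x y k3 = 0" "F x z k1 = 0" "F x z k2 = 0" "F x z k3 = 0"
    "F y z k1 = 0" "F y z k2 = 0" "F y z k3 = 0"
    using Fx Fz Fy Bk Fswap(1)[of x z] by auto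
  have scales: "\<epsilon> * (\<epsilon> * (\<epsilon> * F x y z)) = 1" "\<tau> * (\<sigma> * \<epsilon>) = 1" "\<sigma> * (\<sigma> * (\<epsilon> * F x k2 k3)) = -1"
    using \<epsilon>(2) \<sigma>(2) \<tau>(2) by (simp_all add: power2_eq_square power3_eq_cube mult_ac)
  have "standard_form ?\<eta>"
    unfolding standard_form_def
    by (simp add: alternating_pull[OF alt] compw w Flin N Wv Fk Fk' Ff scales del: One_nat_def)
  moreover have "det (frame w) > 0"
  proof -
    \<comment> \<open>The orientation is read off from the transformation law of Q at the last
      vector, where Q is positive before and after the change of frame.\<close>
    have "Q_matrix ?\<eta> $ ix 6 $ ix 6 = 6" using Q_matrix_standard_ix[OF \<open>standard_form ?\<eta>\<close>, of 6 6] by simp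
    then have "det (frame w) * B (w 6) (w 6) = 6" by (simp add: Q_matrix_pull_frame B_def)
    moreover have "B (w 6) (w 6) > 0" using f \<tau> by (intro Bpos) (simp add: w)
    ultimately show ?thesis by (metis zero_less_mult_pos2 zero_less_numeral)
  qed
  ultimately show thesis using that by blast
qed

section \<open>The identity in a standard frame\<close>

lemma wedge_add_left:
  "wedge k l (\<lambda>I. A I + t * A' I) \<beta> I = wedge k l A \<beta> I + t * wedge k l A' \<beta> I"
  by (simp add: wedge_def algebra_simps sum.distrib sum_distrib_left add_divide_distrib)

lemma wedge_add_right:
  "wedge k l \<alpha> (\<lambda>I. B I + t * B' I) I = wedge k l \<alpha> B I + t * wedge k l \<alpha> B' I"
  by (simp add: wedge_def algebra_simps sum.distrib sum_distrib_left add_divide_distrib)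

text \<open>The three occurrences of the form in the cubic expression Q are made independent, so
  that its expansion along a line can be written down.\<close>

definition Q_polar :: "tensor \<Rightarrow> tensor \<Rightarrow> tensor \<Rightarrow> 7 \<Rightarrow> 7 \<Rightarrow> real" where
  "Q_polar \<alpha> \<beta> \<gamma> i j = wedge 4 3 (wedge 2 2 (\<lambda>I. \<alpha> (i # I)) (\<lambda>I. \<beta> (j # I))) \<gamma> std_index"

definition Q_linear :: "tensor \<Rightarrow> tensor \<Rightarrow> 7 \<Rightarrow> 7 \<Rightarrow> real" where
  "Q_linear \<phi> X i j = Q_polar X \<phi> \<phi> i j + Q_polar \<phi> X \<phi> i j + Q_polar \<phi> \<phi> X i j"

lemma Q_matrix_polynomial:
  "Q_matrix (\<lambda>I. \<phi> I + t * X I) $ i $ j = Q_matrix \<phi> $ i $ j + t * Q_linear \<phi> X i j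
    + t\<^sup>2 * (Q_polar X X \<phi> i j + Q_polar X \<phi> X i j + Q_polar \<phi> X X i j) + t ^ 3 * Q_polar X X X i j"
  unfolding Q_matrix_def vec_lambda_beta Q_linear_def Q_polar_def
  by (simp only: wedge_add_left[abs_def] wedge_add_right[abs_def] wedge_add_left wedge_add_right)
     (simp add: algebra_simps power2_eq_square power3_eq_cube)

lemma has_derivative_Q_matrix:
  "((\<lambda>t. Q_matrix (\<lambda>I. \<phi> I + t * X I) $ i $ j) has_real_derivative Q_linear \<phi> X i j) (at 0)"
  unfolding Q_matrix_polynomial by (auto intro!: derivative_eq_intros)

definition contract :: "tensor \<Rightarrow> tensor \<Rightarrow> 7 \<Rightarrow> 7 \<Rightarrow> real" where
  "contract X Y a b = (\<Sum>j\<in>UNIV. \<Sum>k\<in>UNIV. X [a, j, k] * Y [b, j, k])"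

lemma sum_lessThan_7: "(\<Sum>n<7. f n) = f 0 + f 1 + f 2 + f 3 + f 4 + f 5 + f (6::nat)"
  for f :: "nat \<Rightarrow> real"
proof -
  have "{..<7} = {0,1,2,3,4,5,6::nat}" by auto
  then show ?thesis by (simp add: add.assoc)
qed

lemma contract_ix:
  "contract X Y (ix a) (ix b) = (\<Sum>j<7. \<Sum>k<7. comp3 X a j k * comp3 Y b j k)"
  by (simp add: contract_def sum_ix comp3_def)

text \<open>Both sides are linear in the components of \<open>X\<close>, and the 49 entries are
  compared one by one. The factor 3 / 2 can be seen at \<open>X = \<omega>\<close>: by cubic
  homogeneity the left side is three times Q, that is 18 on the diagonal, where each contraction is
  6.\<close>

lemma Q_linear_standard_ix:
  assumes std: "standard_form \<omega>" and X: "alternating 3 X" and ij: "i < 7" "j < 7"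
  shows "Q_linear \<omega> X (ix i) (ix j) = 3 / 2 * (contract X \<omega> (ix i) (ix j) + contract X \<omega> (ix j) (ix i))"
proof -
  have alt: "alternating 3 \<omega>" using std by (simp add: standard_form_def)
  have alt2: "alternating 2 (\<lambda>I. \<omega> (i # I))" "alternating 2 (\<lambda>I. X (i # I))" for i
    using alternating_Cons[of 2 \<omega>] alternating_Cons[of 2 X] alt X by simp_all
  have alt4: "alternating 4 (wedge 2 2 \<alpha> \<beta>)" for \<alpha> \<beta>
    using alternating_wedge[of 2 2] by simp
  note std' = std[unfolded standard_form_def]
  note Q = Q_linear_def Q_polar_def wedge_4_3[OF alt4 alt] wedge_4_3[OF alt4 X] wedge_2_2[OF alt2(1)
      alt2(1)]
     wedge_2_2[OF alt2(1) alt2(2)] wedge_2_2[OF alt2(2) alt2(1)] comp2_Cons comp3_normal[OF alt]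
         comp3_normal[OF X] std'
     contract_ix sum_lessThan_7
  show ?thesis
    using less_7_cases[OF ij(1)] less_7_cases[OF ij(2)]
    apply (elim disjE; hypsubst)
    apply (simp_all add: Q del: One_nat_def)
    done
qed

lemma Q_linear_standard:
  assumes "standard_form \<omega>" "alternating 3 X"
  shows "Q_linear \<omega> X i j = 3 / 2 * (contract X \<omega> i j + contract X \<omega> j i)"
  using Q_linear_standard_ix[OF assms, of "pos i" "pos j"] by simp

section \<open>The dual 4-form and the contraction identity\<close>

lemma alternating_levi_civita: "alternating 7 levi_civita"
proof (rule alternatingI)
  fix I :: "7 list" and \<tau> assume I: "length I = 7" and \<tau>: "\<tau> permutes {..<7::nat}"
  have "(\<Prod>m<7. if I ! \<tau> m = ix (\<sigma> (\<tau> m)) then 1 else (0::real)) = (\<Prod>m<7. if I ! m = ix (\<sigma> m) then 1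
      else 0)" for \<sigma>
    using prod.permute[OF \<tau>, of "\<lambda>m. if I ! m = ix (\<sigma> m) then 1 else (0::real)"] by (simp add: o_def)
  then have "levi_civita (permute_list \<tau> I) = (\<Sum>\<sigma> | \<sigma> permutes {..<7}. of_int (sign \<tau>) * (of_int (sign \<sigma>) *
      (\<Prod>m<7. if I ! m = ix (\<sigma> m) then 1 else 0)))"
    using I \<tau> unfolding levi_civita_sum[OF I[folded length_permute_list[of \<tau> I]]]
    by (subst sum_permutations_compose_right[OF \<tau>]) (auto simp: sign_mult_of_int mult_ac intro!: sum.cong)
  then show "levi_civita (permute_list \<tau> I) = of_int (sign \<tau>) * levi_civita I"
    unfolding levi_civita_sum[OF I] by (simp add: sum_distrib_left)
qed

text \<open>The Hodge dual of a 3-form in an oriented orthonormal frame.\<close>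
definition dual4 :: "tensor \<Rightarrow> tensor" where
  "dual4 \<omega> = (\<lambda>J. (\<Sum>I | length I = 3. \<omega> I * levi_civita (I @ J)) / 6)"

lemma alternating_append:
  assumes "alternating (k + l) \<omega>" "length I = k"
  shows "alternating l (\<lambda>J. \<omega> (I @ J))"
  using assms
proof (induction k arbitrary: I \<omega>)
  case (Suc k)
  then obtain i I' where I: "I = i # I'" "length I' = k" by (auto simp: length_Suc_conv)
  have "alternating (k + l) (\<lambda>J. \<omega> (i # J))" using alternating_Cons[of "k + l" \<omega>] Suc.prems by simp
  from Suc.IH[OF this I(2)] show ?case by (simp add: I)
qed simp

lemma alternating_dual4: "alternating 4 (dual4 \<omega>)"
proof (rule alternatingI)
  fix J :: "7 list" and \<tau> assume J: "length J = 4" and \<tau>: "\<tau> permutes {..<4::nat}"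
  have "levi_civita (I @ permute_list \<tau> J) = of_int (sign \<tau>) * levi_civita (I @ J)" if "length I = 3" for I
    using alternating_append[of 3 4 levi_civita I] alternating_levi_civita that alternatingD[of 4
        "\<lambda>J. levi_civita (I @ J)" J \<tau>] J \<tau> by simp
  then have "(\<Sum>I | length I = 3. \<omega> I * levi_civita (I @ permute_list \<tau> J)) = (\<Sum>I | length I = 3.
      of_int (sign \<tau>) * (\<omega> I * levi_civita (I @ J)))"
    by (intro sum.cong refl) simp
  then show "dual4 \<omega> (permute_list \<tau> J) = of_int (sign \<tau>) * dual4 \<omega> J"
    by (simp add: dual4_def sum_distrib_left)
qed

definition comp7 :: "tensor \<Rightarrow> nat \<Rightarrow> nat \<Rightarrow> nat \<Rightarrow> nat \<Rightarrow> nat \<Rightarrow> nat \<Rightarrow> nat \<Rightarrow> real" where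
  "comp7 \<omega> a b c d e f g = \<omega> [ix a, ix b, ix c, ix d, ix e, ix f, ix g]"

lemma comp7_swap:
  assumes "alternating 7 \<omega>"
  shows "comp7 \<omega> b a c d e f g = - comp7 \<omega> a b c d e f g" "comp7 \<omega> a c b d e f g = - comp7 \<omega> a b c d e f g"
    "comp7 \<omega> a b d c e f g = - comp7 \<omega> a b c d e f g" "comp7 \<omega> a b c e d f g = - comp7 \<omega> a b c d e f g"
    "comp7 \<omega> a b c d f e g = - comp7 \<omega> a b c d e f g" "comp7 \<omega> a b c d e g f = - comp7 \<omega> a b c d e f g"
  using alternating_transpose[OF assms, of "[ix a, ix b, ix c, ix d, ix e, ix f, ix g]" 0 1]
    alternating_transpose[OF assms, of "[ix a, ix b, ix c, ix d, ix e, ix f, ix g]" 1 2]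
    alternating_transpose[OF assms, of "[ix a, ix b, ix c, ix d, ix e, ix f, ix g]" 2 3]
    alternating_transpose[OF assms, of "[ix a, ix b, ix c, ix d, ix e, ix f, ix g]" 3 4]
    alternating_transpose[OF assms, of "[ix a, ix b, ix c, ix d, ix e, ix f, ix g]" 4 5]
    alternating_transpose[OF assms, of "[ix a, ix b, ix c, ix d, ix e, ix f, ix g]" 5 6]
  by (simp_all add: comp7_def)

lemma comp7_normal:
  assumes "alternating 7 \<omega>"
  shows "comp7 \<omega> a a c d e f g = 0" "comp7 \<omega> a c c d e f g = 0" "comp7 \<omega> a b c c e f g = 0"
    "comp7 \<omega> a b c d d f g = 0" "comp7 \<omega> a b c d e e g = 0" "comp7 \<omega> a b c d e f f = 0"
    "a < b \<Longrightarrow> comp7 \<omega> b a c d e f g = - comp7 \<omega> a b c d e f g" "b < c \<Longrightarrow> comp7 \<omega> a c b d e f g = -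
        comp7 \<omega> a b c d e f g"
    "c < d \<Longrightarrow> comp7 \<omega> a b d c e f g = - comp7 \<omega> a b c d e f g" "d < e \<Longrightarrow> comp7 \<omega> a b c e d f g = -
        comp7 \<omega> a b c d e f g"
    "e < f \<Longrightarrow> comp7 \<omega> a b c d f e g = - comp7 \<omega> a b c d e f g" "f < g \<Longrightarrow> comp7 \<omega> a b c d e g f = -
        comp7 \<omega> a b c d e f g"
  using comp7_swap[OF assms] by (metis neg_equal_zero)+

lemma levi_civita_std: "levi_civita std_index = 1"
proof -
  have "std_index = permute_list \<sigma> std_index \<longleftrightarrow> \<sigma> = id" if \<sigma>: "\<sigma> permutes {..<7}" for \<sigma>
  proof
    assume *: "std_index = permute_list \<sigma> std_index"
    have "\<sigma> m = m" for m
    proof (cases "m < 7")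
      case True
      then have "ix (\<sigma> m) = ix m" using nth_permute_list[of m std_index \<sigma>, folded *] by simp
      then show ?thesis using True \<sigma> by (simp add: permutes_lessThan)
    qed (use \<sigma> in \<open>simp add: permutes_def\<close>)
    then show "\<sigma> = id" by auto
  qed (auto intro!: nth_equalityI)
  then have "levi_civita std_index = (\<Sum>\<sigma> | \<sigma> permutes {..<7::nat}. if \<sigma> = id then of_int (sign \<sigma>) else 0)"
    unfolding levi_civita_eq by (intro sum.cong refl) auto
  also have "\<dots> = 1"
    by (simp add: sum.If_cases finite_permutations Int_def conj_commute permutes_id cong: conj_cong)
  finally show ?thesis .
qed

lemma comp7_levi_civita: "comp7 levi_civita 0 1 2 3 4 5 6 = 1"
proof -
  have "[ix 0, ix 1, ix 2, ix 3, ix 4, ix 5, ix 6] = std_index" by (simp add: std_index_def)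
  then show ?thesis by (simp add: comp7_def levi_civita_std)
qed

lemma dual4_standard:
  assumes std: "standard_form \<omega>" and J: "length J = 4"
  shows "dual4 \<omega> J = levi_civita ([ix 0, ix 1, ix 2] @ J) - levi_civita ([ix 0, ix 3, ix 6] @ J) -
      levi_civita ([ix 0, ix 4, ix 5] @ J) + levi_civita ([ix 1, ix 3, ix 5] @ J) - levi_civita ([ix
      1, ix 4, ix 6] @ J) - levi_civita ([ix 2, ix 3, ix 4] @ J) - levi_civita ([ix 2, ix 5, ix 6] @
      J)"
proof -
  have alt: "alternating 3 \<omega>" using std by (simp add: standard_form_def)
  have altL: "alternating 3 (\<lambda>I. levi_civita (I @ J))"
  proof (rule alternatingI)
    fix I :: "7 list" and \<tau> assume I: "length I = 3" and \<tau>: "\<tau> permutes {..<3::nat}"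
    have "\<tau> permutes {..<7::nat}" by (rule permutes_subset[OF \<tau>]) auto
    moreover have "permute_list \<tau> (I @ J) = permute_list \<tau> I @ J"
      using I J \<tau> by (auto intro!: nth_equalityI simp: nth_append permutes_lessThan permutes_not_in)
    ultimately show "levi_civita (permute_list \<tau> I @ J) = of_int (sign \<tau>) * levi_civita (I @ J)"
      using alternatingD[OF alternating_levi_civita, of "I @ J" \<tau>] I J by simp
  qed
  let ?L = "\<lambda>I. levi_civita (I @ J)"
  have "(\<Sum>I | length I = 3. \<omega> I * ?L I) = (\<Sum>i<7. \<Sum>j<7. \<Sum>k<7. comp3 \<omega> i j k * comp3 ?L i j k)"
    by (simp add: numeral_3_eq_3 sum_lists_Suc sum_ix comp3_def)
  \<comment> \<open>Seven unordered triples carry the form, and each is met in 3! orders; this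
    cancels the 6 in \<open>dual4\<close>.\<close>
  also have "\<dots> = 6 * (comp3 ?L 0 1 2 - comp3 ?L 0 3 6 - comp3 ?L 0 4 5 + comp3 ?L 1 3 5 - comp3 ?L 1
      4 6 - comp3 ?L 2 3 4 - comp3 ?L 2 5 6)"
    unfolding sum_lessThan_7
    by (simp add: comp3_normal[OF alt] comp3_normal[OF altL] std[unfolded standard_form_def] del:
        One_nat_def)
  finally show ?thesis by (simp add: dual4_def comp3_def)
qed

lemma comp4_dual4_standard:
  assumes std: "standard_form \<omega>"
  shows "comp4 (dual4 \<omega>) 0 1 2 3 = 0" "comp4 (dual4 \<omega>) 0 1 2 4 = 0" "comp4 (dual4 \<omega>) 0 1 2 5 = 0"
    "comp4 (dual4 \<omega>) 0 1 2 6 = 0" "comp4 (dual4 \<omega>) 0 1 3 4 = -1" "comp4 (dual4 \<omega>) 0 1 3 5 = 0"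
    "comp4 (dual4 \<omega>) 0 1 3 6 = 0" "comp4 (dual4 \<omega>) 0 1 4 5 = 0" "comp4 (dual4 \<omega>) 0 1 4 6 = 0"
    "comp4 (dual4 \<omega>) 0 1 5 6 = -1" "comp4 (dual4 \<omega>) 0 2 3 4 = 0" "comp4 (dual4 \<omega>) 0 2 3 5 = -1"
    "comp4 (dual4 \<omega>) 0 2 3 6 = 0" "comp4 (dual4 \<omega>) 0 2 4 5 = 0" "comp4 (dual4 \<omega>) 0 2 4 6 = 1"
    "comp4 (dual4 \<omega>) 0 2 5 6 = 0" "comp4 (dual4 \<omega>) 0 3 4 5 = 0" "comp4 (dual4 \<omega>) 0 3 4 6 = 0"
    "comp4 (dual4 \<omega>) 0 3 5 6 = 0" "comp4 (dual4 \<omega>) 0 4 5 6 = 0" "comp4 (dual4 \<omega>) 1 2 3 4 = 0"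
    "comp4 (dual4 \<omega>) 1 2 3 5 = 0" "comp4 (dual4 \<omega>) 1 2 3 6 = -1" "comp4 (dual4 \<omega>) 1 2 4 5 = -1"
    "comp4 (dual4 \<omega>) 1 2 4 6 = 0" "comp4 (dual4 \<omega>) 1 2 5 6 = 0" "comp4 (dual4 \<omega>) 1 3 4 5 = 0"
    "comp4 (dual4 \<omega>) 1 3 4 6 = 0" "comp4 (dual4 \<omega>) 1 3 5 6 = 0" "comp4 (dual4 \<omega>) 1 4 5 6 = 0"
    "comp4 (dual4 \<omega>) 2 3 4 5 = 0" "comp4 (dual4 \<omega>) 2 3 4 6 = 0" "comp4 (dual4 \<omega>) 2 3 5 6 = 0"
    "comp4 (dual4 \<omega>) 2 4 5 6 = 0" "comp4 (dual4 \<omega>) 3 4 5 6 = 1"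
proof -
  have d: "comp4 (dual4 \<omega>) i j k l = comp7 levi_civita 0 1 2 i j k l - comp7 levi_civita 0 3 6 i j k
      l - comp7 levi_civita 0 4 5 i j k l + comp7 levi_civita 1 3 5 i j k l - comp7 levi_civita 1 4
      6 i j k l - comp7 levi_civita 2 3 4 i j k l - comp7 levi_civita 2 5 6 i j k l" for i j k l
    unfolding comp4_def by (subst dual4_standard[OF std]) (simp_all add: comp7_def)
  show "comp4 (dual4 \<omega>) 0 1 2 3 = 0" "comp4 (dual4 \<omega>) 0 1 2 4 = 0" "comp4 (dual4 \<omega>) 0 1 2 5 = 0"
    "comp4 (dual4 \<omega>) 0 1 2 6 = 0" "comp4 (dual4 \<omega>) 0 1 3 4 = -1" "comp4 (dual4 \<omega>) 0 1 3 5 = 0"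
    "comp4 (dual4 \<omega>) 0 1 3 6 = 0" "comp4 (dual4 \<omega>) 0 1 4 5 = 0" "comp4 (dual4 \<omega>) 0 1 4 6 = 0"
    "comp4 (dual4 \<omega>) 0 1 5 6 = -1" "comp4 (dual4 \<omega>) 0 2 3 4 = 0" "comp4 (dual4 \<omega>) 0 2 3 5 = -1"
    "comp4 (dual4 \<omega>) 0 2 3 6 = 0" "comp4 (dual4 \<omega>) 0 2 4 5 = 0" "comp4 (dual4 \<omega>) 0 2 4 6 = 1"
    "comp4 (dual4 \<omega>) 0 2 5 6 = 0" "comp4 (dual4 \<omega>) 0 3 4 5 = 0" "comp4 (dual4 \<omega>) 0 3 4 6 = 0"
    "comp4 (dual4 \<omega>) 0 3 5 6 = 0" "comp4 (dual4 \<omega>) 0 4 5 6 = 0" "comp4 (dual4 \<omega>) 1 2 3 4 = 0"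
    "comp4 (dual4 \<omega>) 1 2 3 5 = 0" "comp4 (dual4 \<omega>) 1 2 3 6 = -1" "comp4 (dual4 \<omega>) 1 2 4 5 = -1"
    "comp4 (dual4 \<omega>) 1 2 4 6 = 0" "comp4 (dual4 \<omega>) 1 2 5 6 = 0" "comp4 (dual4 \<omega>) 1 3 4 5 = 0"
    "comp4 (dual4 \<omega>) 1 3 4 6 = 0" "comp4 (dual4 \<omega>) 1 3 5 6 = 0" "comp4 (dual4 \<omega>) 1 4 5 6 = 0"
    "comp4 (dual4 \<omega>) 2 3 4 5 = 0" "comp4 (dual4 \<omega>) 2 3 4 6 = 0" "comp4 (dual4 \<omega>) 2 3 5 6 = 0"
    "comp4 (dual4 \<omega>) 2 4 5 6 = 0" "comp4 (dual4 \<omega>) 3 4 5 6 = 1"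
    by (simp_all add: d comp7_normal[OF alternating_levi_civita] comp7_levi_civita del: One_nat_def)
qed

lemma contraction_identity_ix:
  assumes std: "standard_form \<omega>" and ij: "i < j" "j < 7" and kl: "k < l" "l < 7"
  shows "(\<Sum>m<7. comp3 \<omega> m i j * comp3 \<omega> m k l) =
    of_bool (i = k \<and> j = l) - of_bool (i = l \<and> j = k) + comp4 (dual4 \<omega>) i j k l"
proof -
  have alt: "alternating 3 \<omega>" using std by (simp add: standard_form_def)
  note simps = sum_lessThan_7 comp3_normal[OF alt] std[unfolded standard_form_def] comp4_normal[OF
      alternating_dual4]
    comp4_dual4_standard[OF std]
  \<comment> \<open>The 21 increasing pairs of indices; listing them turns the claim into 441 closed
    instances.\<close>
  define S :: "(nat \<times> nat) set" where "S = {(0, 1), (0, 2), (0, 3), (0, 4), (0, 5), (0, 6), (1, 2),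
      (1, 3), (1, 4), (1, 5), (1, 6), (2, 3), (2, 4), (2, 5), (2, 6), (3, 4), (3, 5), (3, 6), (4,
      5), (4, 6), (5, 6)}"
  have "\<forall>(i, j) \<in> S. \<forall>(k, l) \<in> S. (\<Sum>m<7. comp3 \<omega> m i j * comp3 \<omega> m k l) =
    of_bool (i = k \<and> j = l) - of_bool (i = l \<and> j = k) + comp4 (dual4 \<omega>) i j k l"
    unfolding S_def by (simp add: simps del: One_nat_def)
  moreover have "(i, j) \<in> S" if "i < j" "j < 7" for i j
  proof -
    have "i < 7" using that by simp
    then show ?thesis
      unfolding S_def using less_7_cases[of i] less_7_cases[OF that(2)] that(1) by (elim impE disjE; simp)
  qed
  ultimately show ?thesis using ij kl by blast
qed

lemma contraction_identity:
  assumes std: "standard_form \<omega>"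
  shows "(\<Sum>m\<in>UNIV. \<omega> [m, i, j] * \<omega> [m, k, l]) =
    of_bool (i = k \<and> j = l) - of_bool (i = l \<and> j = k) + dual4 \<omega> [i, j, k, l]"
proof -
  have alt: "alternating 3 \<omega>" using std by (simp add: standard_form_def)
  \<comment> \<open>The defect of the identity. It is antisymmetric in its first and in its last
    pair of indices, which reduces everything to increasing pairs.\<close>
  define G where "G i j k l = (\<Sum>m<7. comp3 \<omega> m i j * comp3 \<omega> m k l) -
    (of_bool (i = k \<and> j = l) - of_bool (i = l \<and> j = k) + comp4 (dual4 \<omega>) i j k l)" for i j k l :: nat
  have swap1: "G j i k l = - G i j k l" for i j k l
  proof -
    have *: "comp4 (dual4 \<omega>) j i k l = - comp4 (dual4 \<omega>) i j k l" "\<And>m. comp3 \<omega> m j i = - comp3 \<omega> m i j"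
      using comp4_swap(1)[OF alternating_dual4] comp3_swap(2)[OF alt] by blast+
    show ?thesis
      unfolding G_def * mult_minus_left sum_negf by (simp add: conj_commute)
  qed
  have swap2: "G i j l k = - G i j k l" for i j k l
  proof -
    have *: "comp4 (dual4 \<omega>) i j l k = - comp4 (dual4 \<omega>) i j k l" "\<And>m. comp3 \<omega> m l k = - comp3 \<omega> m k l"
      using comp4_swap(3)[OF alternating_dual4] comp3_swap(2)[OF alt] by blast+
    show ?thesis
      unfolding G_def * mult_minus_right sum_negf by (simp add: conj_commute)
  qed
  have G1: "G i j k l = 0" if "i < j" "j < 7" "k < 7" "l < 7" for i j k l
  proof (cases k l rule: linorder_cases)
    case less then show ?thesis using contraction_identity_ix[OF std, of i j k l] that by (simp add: G_def)
  next
    case equal then show ?thesis using swap2[of i j k k] by simp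
  next
    case greater then show ?thesis using contraction_identity_ix[OF std, of i j l k] that swap2[of i
        j k l] by (simp add: G_def)
  qed
  have "G i j k l = 0" if "i < 7" "j < 7" "k < 7" "l < 7" for i j k l
  proof (cases i j rule: linorder_cases)
    case less then show ?thesis using G1 that by simp
  next
    case equal then show ?thesis using swap1[of i i k l] by simp
  next
    case greater then show ?thesis using G1[of j i k l] that swap1[of i j k l] by simp
  qed
  then have "G (pos i) (pos j) (pos k) (pos l) = 0" by simp
  moreover have "pos i = pos j \<longleftrightarrow> i = j" for i j by (metis ix_pos)
  ultimately show ?thesis
    by (simp add: G_def comp3_def comp4_def sum_ix)
qed

section \<open>The inner product of two metric variations in a standard frame\<close>

definition gram3 :: "tensor \<Rightarrow> tensor \<Rightarrow> real" where
  "gram3 X Y = (\<Sum>i\<in>UNIV. \<Sum>j\<in>UNIV. \<Sum>k\<in>UNIV. X [i, j, k] * Y [i, j, k]) / 6"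

definition psi_term :: "tensor \<Rightarrow> tensor \<Rightarrow> tensor \<Rightarrow> real" where
  "psi_term \<omega> X Y = (\<Sum>a\<in>UNIV. \<Sum>j\<in>UNIV. \<Sum>k\<in>UNIV. \<Sum>b\<in>UNIV. \<Sum>d\<in>UNIV. X [a, j, k] * Y [a, b, d] * dual4
      \<omega> [j, k, b, d])"

text \<open>The sum over the common index of the two copies of the form is evaluated by
  \<open>contraction_identity\<close>. Its two delta terms agree by antisymmetry of \<open>Y\<close>
  and give 2 * 6 times \<open>gram3\<close>, which carries the factor 1 / 6; the remaining term is
  \<open>psi_term\<close>.\<close>

lemma sum_contract_contract:
  assumes std: "standard_form \<omega>" and Y: "alternating 3 Y"
  shows "(\<Sum>a\<in>UNIV. \<Sum>b\<in>UNIV. contract X \<omega> a b * contract Y \<omega> a b) = 12 * gram3 X Y + psi_term \<omega> X Y"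
proof -
  have s: "Y [a, k, j] = - Y [a, j, k]" for a j k
    using comp3_swap(2)[OF Y, of "pos a" "pos k" "pos j"] by (simp add: comp3_def)
  have "(\<Sum>b\<in>UNIV. contract X \<omega> a b * contract Y \<omega> a b) =
     (\<Sum>j\<in>UNIV. \<Sum>k\<in>UNIV. 2 * (X [a, j, k] * Y [a, j, k]) + (\<Sum>l\<in>UNIV. \<Sum>m\<in>UNIV. X [a, j, k] * Y [a, l,
         m] * dual4 \<omega> [j, k, l, m]))" (is "?l = _") for a
  proof -
    have "?l = (\<Sum>b\<in>UNIV. \<Sum>j\<in>UNIV. \<Sum>k\<in>UNIV. \<Sum>l\<in>UNIV. \<Sum>m\<in>UNIV. X [a, j, k] * Y [a, l, m] * (\<omega> [b, j,
        k] * \<omega> [b, l, m]))"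
      unfolding contract_def sum_distrib_right unfolding sum_distrib_left by (simp add: mult_ac)
    also have "\<dots> = (\<Sum>j\<in>UNIV. \<Sum>k\<in>UNIV. \<Sum>l\<in>UNIV. \<Sum>m\<in>UNIV. \<Sum>b\<in>UNIV. X [a, j, k] * Y [a, l, m] * (\<omega> [b,
        j, k] * \<omega> [b, l, m]))"
      by (subst sum.swap, rule sum.cong[OF refl], subst sum.swap, rule sum.cong[OF refl], subst
          sum.swap, rule sum.cong[OF refl], rule sum.swap)
    also have "\<dots> = (\<Sum>j\<in>UNIV. \<Sum>k\<in>UNIV. \<Sum>l\<in>UNIV. \<Sum>m\<in>UNIV. X [a, j, k] * Y [a, l, m] *
        (of_bool (j = l \<and> k = m) - of_bool (j = m \<and> k = l) + dual4 \<omega> [j, k, l, m]))"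
      unfolding sum_distrib_left[symmetric] contraction_identity[OF std] ..
    also have "\<dots> = (\<Sum>j\<in>UNIV. \<Sum>k\<in>UNIV. X [a, j, k] * Y [a, j, k] - X [a, j, k] * Y [a, k, j] +
        (\<Sum>l\<in>UNIV. \<Sum>m\<in>UNIV. X [a, j, k] * Y [a, l, m] * dual4 \<omega> [j, k, l, m]))"
    proof (intro sum.cong refl)
      fix j k :: 7
      have "(\<Sum>l\<in>UNIV. \<Sum>m\<in>UNIV. c l m * of_bool (j = l \<and> k = m)) = (c j k :: real)" for c
      proof -
        have "(\<Sum>l\<in>UNIV. \<Sum>m\<in>UNIV. c l m * of_bool (j = l \<and> k = m)) = (\<Sum>l\<in>UNIV. \<Sum>m\<in>UNIV. if m = k then
            (if l = j then c l m else 0) else 0)"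
          by (intro sum.cong refl) auto
        then show ?thesis by simp
      qed
      moreover have "(\<Sum>l\<in>UNIV. \<Sum>m\<in>UNIV. c l m * of_bool (j = m \<and> k = l)) = (c k j :: real)" for c
      proof -
        have "(\<Sum>l\<in>UNIV. \<Sum>m\<in>UNIV. c l m * of_bool (j = m \<and> k = l)) = (\<Sum>l\<in>UNIV. \<Sum>m\<in>UNIV. if m = j then
            (if l = k then c l m else 0) else 0)"
          by (intro sum.cong refl) auto
        then show ?thesis by simp
      qed
      ultimately show "(\<Sum>l\<in>UNIV. \<Sum>m\<in>UNIV. X [a, j, k] * Y [a, l, m] *
        (of_bool (j = l \<and> k = m) - of_bool (j = m \<and> k = l) + dual4 \<omega> [j, k, l, m])) =
        X [a, j, k] * Y [a, j, k] - X [a, j, k] * Y [a, k, j] +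
        (\<Sum>l\<in>UNIV. \<Sum>m\<in>UNIV. X [a, j, k] * Y [a, l, m] * dual4 \<omega> [j, k, l, m])"
        unfolding distrib_left right_diff_distrib sum.distrib sum_subtractf by simp
    qed
    also have "\<dots> = (\<Sum>j\<in>UNIV. \<Sum>k\<in>UNIV. 2 * (X [a, j, k] * Y [a, j, k]) + (\<Sum>l\<in>UNIV. \<Sum>m\<in>UNIV. X [a, j,
        k] * Y [a, l, m] * dual4 \<omega> [j, k, l, m]))"
      by (intro sum.cong refl) (subst s, simp)
    finally show ?thesis .
  qed
  then show ?thesis
    by (simp add: gram3_def psi_term_def sum.distrib sum_distrib_left[symmetric])
qed

text \<open>The derivative of the metric in a frame that puts the form into standard shape.\<close>
definition metric_variation :: "tensor \<Rightarrow> tensor \<Rightarrow> 7 \<Rightarrow> 7 \<Rightarrow> real" where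
  "metric_variation \<omega> X i j = (contract X \<omega> i j + contract X \<omega> j i) / 4 - of_bool (i = j) * gram3 X \<omega> / 3"

lemma sum_contract_diag: "(\<Sum>i\<in>UNIV. contract X \<omega> i i) = 6 * gram3 X \<omega>"
  by (simp add: contract_def gram3_def)

text \<open>Origin of the constants, with S and S' the two contractions: the symmetrised parts
  contribute 1/16 (S.S' + S.S'^T), and S.S' contains 12 g(X, Y), hence 3/4. Since tr S = 6 g(X,
  phi), the products with the identity contribute -1 times g(X, phi) g(Y, phi), and the identity in
  dimension 7 contributes 7/18 of it, together -11/18.\<close>

lemma metric_variation_inner:
  assumes std: "standard_form \<omega>" and Y: "alternating 3 Y"
  shows "(\<Sum>i\<in>UNIV. \<Sum>j\<in>UNIV. metric_variation \<omega> X i j * metric_variation \<omega> Y i j) / 2 =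
    3 / 4 * gram3 X Y - (11 / 18 * gram3 X \<omega> * gram3 Y \<omega>
      - 1 / 16 * (psi_term \<omega> X Y + (\<Sum>i\<in>UNIV. \<Sum>j\<in>UNIV. contract X \<omega> i j * contract Y \<omega> j i)))"
proof -
  let ?S = "contract X \<omega>" and ?S' = "contract Y \<omega>" and ?x = "gram3 X \<omega>" and ?y = "gram3 Y \<omega>"
  let ?U = "UNIV :: 7 set"
  have e: "metric_variation \<omega> X i j * metric_variation \<omega> Y i j = (?S i j * ?S' i j + ?S j i * ?S' j
      i + (?S i j * ?S' j i + ?S j i * ?S' i j)) / 16
     - (if j = i then (?S i i * ?y + ?S' i i * ?x) / 6 - ?x * ?y / 9 else 0)" for i j
    by (simp add: metric_variation_def field_simps)
  have sw: "(\<Sum>i\<in>?U. \<Sum>j\<in>?U. ?S j i * ?S' j i) = (\<Sum>i\<in>?U. \<Sum>j\<in>?U. ?S i j * ?S' i j)"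
    "(\<Sum>i\<in>?U. \<Sum>j\<in>?U. ?S j i * ?S' i j) = (\<Sum>i\<in>?U. \<Sum>j\<in>?U. ?S i j * ?S' j i)"
    by (rule sum.swap)+
  have "(\<Sum>i\<in>?U. \<Sum>j\<in>?U. metric_variation \<omega> X i j * metric_variation \<omega> Y i j) =
    ((\<Sum>i\<in>?U. \<Sum>j\<in>?U. ?S i j * ?S' i j) + (\<Sum>i\<in>?U. \<Sum>j\<in>?U. ?S i j * ?S' j i)) / 8
    - ((\<Sum>i\<in>?U. ?S i i) * ?y + (\<Sum>i\<in>?U. ?S' i i) * ?x) / 6 + 7 * (?x * ?y) / 9"
    unfolding e sum_subtractf sum.distrib sum_divide_distrib[symmetric] sw
    by (simp add: sum_subtractf sum.distrib sum_divide_distrib[symmetric] sum_distrib_right[symmetric])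
  then show ?thesis
    unfolding sum_contract_diag sum_contract_contract[OF std Y] by (simp add: field_simps)
qed

section \<open>The identity at a point\<close>

lemma pull_Cons: "pull R S (i # I) = (\<Sum>j\<in>UNIV. R $ j $ i * pull R (\<lambda>L. S (j # L)) I)"
  by (simp add: pull_def sum_lists_Suc prod.lessThan_Suc_shift sum_distrib_left mult_ac del:
      prod.lessThan_Suc)

lemma pull_swap:
  "pull P (\<lambda>J. pull P (\<lambda>I. L (I @ J)) I') K = pull P L (I' @ K)"
proof -
  have "pull P (\<lambda>J. pull P (\<lambda>I. L (I @ J)) I') K = (\<Sum>J | length J = length K. \<Sum>I | length I = length I'.
     (\<Prod>m<length K. P $ (J ! m) $ (K ! m)) * ((\<Prod>m<length I'. P $ (I ! m) $ (I' ! m)) * L (I @ J)))"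
    by (simp add: pull_def sum_distrib_left)
  also have "\<dots> = (\<Sum>I | length I = length I'. \<Sum>J | length J = length K.
     (\<Prod>m<length K. P $ (J ! m) $ (K ! m)) * ((\<Prod>m<length I'. P $ (I ! m) $ (I' ! m)) * L (I @ J)))"
    by (rule sum.swap)
  also have "\<dots> = pull P L (I' @ K)"
    unfolding pull_append by (intro sum.cong refl) (simp add: mult_ac)
  finally show ?thesis .
qed

lemma pull_linear:
  "pull P (\<lambda>I. \<Sum>i\<in>S. c i * A i I) I = (\<Sum>i\<in>S. c i * pull P (A i) I)"
proof -
  have "pull P (\<lambda>I. \<Sum>i\<in>S. c i * A i I) I = (\<Sum>J | length J = length I. \<Sum>i\<in>S. c i * ((\<Prod>m<length I. P $
      (J ! m) $ (I ! m)) * A i J))"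
    unfolding pull_def by (intro sum.cong refl) (simp add: sum_distrib_left sum_distrib_right mult_ac)
  also have "\<dots> = (\<Sum>i\<in>S. \<Sum>J | length J = length I. c i * ((\<Prod>m<length I. P $ (J ! m) $ (I ! m)) * A i J))"
    by (rule sum.swap)
  finally show ?thesis by (simp add: pull_def sum_distrib_left)
qed

lemma pull_add_scaled: "pull P (\<lambda>I. A I + t * B I) = (\<lambda>I. pull P A I + t * pull P B I)"
  by (rule ext) (simp add: pull_def sum.distrib sum_distrib_left algebra_simps)

text \<open>The contraction of two 2-tensors with a 4-tensor, kept as sums over two blocks so that a
  change of frame can be moved across block by block.\<close>

definition pair22 :: "tensor \<Rightarrow> tensor \<Rightarrow> tensor \<Rightarrow> real" where
  "pair22 u v \<psi> = (\<Sum>I | length I = 2. \<Sum>J | length J = 2. u I * v J * \<psi> (I @ J))"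

lemma pair22_pull: "pair22 (pull (transpose P) u) (pull (transpose P) v) \<psi> = pair22 u v (pull P \<psi>)"
proof -
  let ?p = "pull (transpose P)"
  have "pair22 (?p u) (?p v) \<psi> = (\<Sum>I | length I = 2. \<Sum>J | length J = 2. ?p v J * (?p u I * \<psi> (I @ J)))"
    by (simp add: pair22_def mult_ac)
  also have "\<dots> = (\<Sum>I | length I = 2. ?p u I * (\<Sum>J | length J = 2. v J * pull P (\<lambda>J. \<psi> (I @ J)) J))"
  proof (intro sum.cong refl)
    fix I
    show "(\<Sum>J | length J = 2. ?p v J * (?p u I * \<psi> (I @ J))) = ?p u I * (\<Sum>J | length J = 2. v J *
        pull P (\<lambda>J. \<psi> (I @ J)) J)"
      using sum_pull[where k = 2 and P = "transpose P" and S = v and S' = "\<lambda>J. \<psi> (I @ J)"] by (simp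
          add: sum_distrib_left[symmetric] mult.left_commute)
  qed
  also have "\<dots> = (\<Sum>J | length J = 2. \<Sum>I | length I = 2. ?p u I * (v J * pull P (\<lambda>J. \<psi> (I @ J)) J))"
    unfolding sum_distrib_left by (rule sum.swap)
  also have "\<dots> = (\<Sum>J | length J = 2. v J * (\<Sum>I | length I = 2. ?p u I * pull P (\<lambda>J. \<psi> (I @ J)) J))"
    by (simp add: sum_distrib_left mult.left_commute)
  also have "\<dots> = (\<Sum>J | length J = 2. v J * (\<Sum>I | length I = 2. u I * pull P \<psi> (I @ J)))"
    using sum_pull[where k = 2 and P = "transpose P" and S = u and S' = "\<lambda>I. pull P (\<lambda>J. \<psi> (I @ J))
        _"] by (simp add: pull_append')
  also have "\<dots> = (\<Sum>J | length J = 2. \<Sum>I | length I = 2. u I * v J * pull P \<psi> (I @ J))"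
    by (simp add: sum_distrib_left mult_ac)
  also have "\<dots> = pair22 u v (pull P \<psi>)"
    unfolding pair22_def by (rule sum.swap)
  finally show ?thesis .
qed

lemma pair22_eq: "pair22 u v \<psi> = (\<Sum>j\<in>UNIV. \<Sum>k\<in>UNIV. \<Sum>b\<in>UNIV. \<Sum>d\<in>UNIV. u [j, k] * v [b, d] * \<psi> [j, k, b, d])"
  by (simp add: pair22_def numeral_2_eq_2 sum_lists_Suc)

lemma pair22_sum_left: "pair22 (\<lambda>I. \<Sum>i\<in>S. c i * A i I) v \<psi> = (\<Sum>i\<in>S. c i * pair22 (A i) v \<psi>)"
proof -
  have "pair22 (\<lambda>I. \<Sum>i\<in>S. c i * A i I) v \<psi> = (\<Sum>I | length I = 2. \<Sum>i\<in>S. \<Sum>J | length J = 2. c i * (A i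
      I * v J * \<psi> (I @ J)))"
    unfolding pair22_def by (subst (2) sum.swap) (simp add: sum_distrib_left sum_distrib_right mult_ac)
  also have "\<dots> = (\<Sum>i\<in>S. \<Sum>I | length I = 2. \<Sum>J | length J = 2. c i * (A i I * v J * \<psi> (I @ J)))"
    by (rule sum.swap)
  finally show ?thesis by (simp add: pair22_def sum_distrib_left)
qed

lemma pair22_sum_right: "pair22 u (\<lambda>I. \<Sum>i\<in>S. c i * A i I) \<psi> = (\<Sum>i\<in>S. c i * pair22 u (A i) \<psi>)"
proof -
  have "pair22 u (\<lambda>I. \<Sum>i\<in>S. c i * A i I) \<psi> = (\<Sum>I | length I = 2. \<Sum>i\<in>S. \<Sum>J | length J = 2. c i * (u I
      * A i J * \<psi> (I @ J)))"
    unfolding pair22_def by (subst (2) sum.swap) (simp add: sum_distrib_left sum_distrib_right mult_ac)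
  also have "\<dots> = (\<Sum>i\<in>S. \<Sum>I | length I = 2. \<Sum>J | length J = 2. c i * (u I * A i J * \<psi> (I @ J)))"
    by (rule sum.swap)
  finally show ?thesis by (simp add: pair22_def sum_distrib_left)
qed

section \<open>Positively oriented orthonormal frames\<close>

locale orthonormal_frame =
  fixes g P :: "real^7^7"
  assumes det_P: "det P > 0"
    and orthonormal: "transpose P ** g ** P = mat 1"
begin

lemma inv_g: "matrix_inv g = P ** transpose P"
proof (rule matrix_inv_eqI)
  have "(g ** P) ** transpose P = mat 1"
    using orthonormal matrix_left_right_inverse[of "transpose P" "g ** P"] by (simp add: matrix_mul_assoc)
  then show "g ** (P ** transpose P) = mat 1" by (simp add: matrix_mul_assoc)
qed

lemma det_g: "sqrt (det g) * det P = 1"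
proof -
  have "det P * det g * det P = 1"
    using arg_cong[OF orthonormal, of det] by (simp add: det_mul)
  then have "det g = 1 / (det P)\<^sup>2" using det_P by (simp add: field_simps power2_eq_square)
  then show ?thesis using det_P by (simp add: real_sqrt_divide)
qed

text \<open>Since the inverse metric is \<open>P ** transpose P\<close>, raising indices passes into
  the frame, where it does nothing, and comes back to coordinates by the transpose.\<close>

lemma raise_g: "raise g S = pull (transpose P) (pull P S)"
  by (simp add: raise_eq_pull inv_g matrix_transpose_mul pull_pull)

lemma tensor_inner_g:
  "tensor_inner g k S S' = (\<Sum>I | length I = k. pull P S I * pull P S' I) / fact k"
proof -
  have "(\<Sum>I | length I = k. \<Sum>J | length J = k. S I * S' J * (\<Prod>m<k. matrix_inv g $ (I ! m) $ (J ! m))) =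
    (\<Sum>I | length I = k. raise g S' I * S I)"
    unfolding raise_def by (intro sum.cong refl) (simp add: sum_distrib_left sum_distrib_right mult_ac)
  also have "\<dots> = (\<Sum>I | length I = k. pull P S' I * pull P S I)"
    unfolding raise_g by (subst sum_pull) simp
  also have "\<dots> = (\<Sum>I | length I = k. pull P S I * pull P S' I)"
    by (simp add: mult.commute)
  finally show ?thesis by (simp add: tensor_inner_def)
qed

text \<open>The \<open>sqrt (det g)\<close> of the volume form and the \<open>det P\<close> from
  \<open>levi_civita\<close> multiply to 1 because the frame is orthonormal and positively
  oriented.\<close>

lemma pull_hodge3:
  assumes "length K = 4"
  shows "pull P (hodge g 3 \<phi>) K = dual4 (pull P \<phi>) K"
proof -
  have "hodge g 3 \<phi> J = sqrt (det g) / 6 * (\<Sum>I | length I = 3. pull P \<phi> I * pull P (\<lambda>I. levi_civita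
      (I @ J)) I)" for J
  proof -
    have "(\<Sum>I | length I = 3. raise g \<phi> I * vol_form g (I @ J)) = sqrt (det g) * (\<Sum>I | length I = 3.
        raise g \<phi> I * levi_civita (I @ J))"
      by (simp add: vol_form_def sum_distrib_left mult_ac)
    also have "(\<Sum>I | length I = 3. raise g \<phi> I * levi_civita (I @ J)) = (\<Sum>I | length I = 3. pull P \<phi>
        I * pull P (\<lambda>I. levi_civita (I @ J)) I)"
      using sum_pull[where k = 3 and P = "transpose P" and S = "pull P \<phi>" and S' = "\<lambda>I. levi_civita
          (I @ J)"] by (simp add: raise_g)
    finally show ?thesis by (simp add: hodge_def fact_numeral)
  qed
  then have "hodge g 3 \<phi> = (\<lambda>J. \<Sum>I | length I = 3. (sqrt (det g) / 6 * pull P \<phi> I) * pull P (\<lambda>I.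
      levi_civita (I @ J)) I)"
    by (simp add: sum_distrib_left mult.assoc fun_eq_iff)
  then have "pull P (hodge g 3 \<phi>) K = (\<Sum>I | length I = 3. (sqrt (det g) / 6 * pull P \<phi> I) * pull P
      levi_civita (I @ K))"
    by (simp only: pull_linear pull_swap)
  also have "\<dots> = (\<Sum>I | length I = 3. (sqrt (det g) * det P) * (pull P \<phi> I * levi_civita (I @ K) / 6))"
    using assms by (intro sum.cong refl) (simp add: pull_levi_civita)
  also have "\<dots> = dual4 (pull P \<phi>) K"
    by (simp add: det_g dual4_def sum_divide_distrib)
  finally show ?thesis .
qed

text \<open>The four indices contracted with psi move into the frame by \<open>pair22_pull\<close>.
  The index \<open>a\<close> is lower in \<open>X\<close> and raised in \<open>Y\<close>; the factor
  of \<open>P\<close> that raising leaves in \<open>Y\<close> is absorbed into \<open>X\<close> by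
  \<open>pull_Cons\<close>.\<close>

lemma psi_contraction_frame:
  "(\<Sum>a\<in>UNIV. \<Sum>j\<in>UNIV. \<Sum>k\<in>UNIV. \<Sum>b\<in>UNIV. \<Sum>d\<in>UNIV.
       raise g (\<lambda>L. X (a # L)) [j, k] * raise g Y [a, b, d] * hodge g 3 \<phi> [j, k, b, d]) =
   psi_term (pull P \<phi>) (pull P X) (pull P Y)"
proof -
  let ?\<psi> = "hodge g 3 \<phi>" and ?p = "pull (transpose P)"
  have "(\<Sum>j\<in>UNIV. \<Sum>k\<in>UNIV. \<Sum>b\<in>UNIV. \<Sum>d\<in>UNIV. raise g (\<lambda>L. X (a # L)) [j, k] * raise g Y [a, b, d] *
      ?\<psi> [j, k, b, d]) =
     (\<Sum>c\<in>UNIV. P $ a $ c * pair22 (pull P (\<lambda>L. X (a # L))) (\<lambda>L. pull P Y (c # L)) (pull P ?\<psi>))" (is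
         "?l = _") for a
  proof -
    have "?l = pair22 (?p (pull P (\<lambda>L. X (a # L)))) (\<lambda>L. \<Sum>c\<in>UNIV. P $ a $ c * ?p (\<lambda>L. pull P Y (c #
        L)) L) ?\<psi>"
      by (simp add: pair22_eq raise_g pull_Cons[of "transpose P"]) (simp add: transpose_def)
    then show ?thesis by (simp add: pair22_sum_right pair22_pull)
  qed
  then have "(\<Sum>a\<in>UNIV. \<Sum>j\<in>UNIV. \<Sum>k\<in>UNIV. \<Sum>b\<in>UNIV. \<Sum>d\<in>UNIV.
       raise g (\<lambda>L. X (a # L)) [j, k] * raise g Y [a, b, d] * ?\<psi> [j, k, b, d]) =
     (\<Sum>a\<in>UNIV. \<Sum>c\<in>UNIV. P $ a $ c * pair22 (pull P (\<lambda>L. X (a # L))) (\<lambda>L. pull P Y (c # L)) (pull P ?\<psi>))"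
    by simp
  also have "\<dots> = (\<Sum>c\<in>UNIV. \<Sum>a\<in>UNIV. P $ a $ c * pair22 (pull P (\<lambda>L. X (a # L))) (\<lambda>L. pull P Y (c #
      L)) (pull P ?\<psi>))"
    by (rule sum.swap)
  also have "\<dots> = (\<Sum>c\<in>UNIV. pair22 (\<lambda>L. pull P X (c # L)) (\<lambda>L. pull P Y (c # L)) (pull P ?\<psi>))"
    by (simp add: pair22_sum_left[symmetric] pull_Cons[symmetric])
  also have "\<dots> = psi_term (pull P \<phi>) (pull P X) (pull P Y)"
    by (simp add: pair22_eq psi_term_def pull_hodge3)
  finally show ?thesis .
qed

lemma phi_contraction_frame:
  "(\<Sum>a\<in>UNIV. \<Sum>j\<in>UNIV. \<Sum>k\<in>UNIV. \<Sum>i\<in>UNIV. \<Sum>b\<in>UNIV. \<Sum>d\<in>UNIV.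
       \<phi> [a, j, k] * raise g X [i, j, k] * \<phi> [i, b, d] * raise g Y [a, b, d]) =
   (\<Sum>i\<in>UNIV. \<Sum>j\<in>UNIV. contract (pull P X) (pull P \<phi>) i j * contract (pull P Y) (pull P \<phi>) j i)"
proof -
  let ?U = "UNIV :: 7 set"
  \<comment> \<open>The contraction is the trace of a product of two mixed tensors
    \<open>U X\<close> and \<open>U Y\<close>, whose first index is lower and whose second is
    raised. In \<open>W\<close> every index except \<open>a\<close> is already in the frame.\<close>
  define U where "U X a i = (\<Sum>j\<in>?U. \<Sum>k\<in>?U. \<phi> [a, j, k] * raise g X [i, j, k])" for X a i
  define W where "W X a i = (\<Sum>j\<in>?U. \<Sum>k\<in>?U. pull P (\<lambda>L. \<phi> (a # L)) [j, k] * pull P X [i, j, k])" for X a i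
  have sum2: "(\<Sum>j\<in>?U. \<Sum>k\<in>?U. f [j, k]) = (\<Sum>L | length L = 2. f L)" for f :: "7 list \<Rightarrow> real"
    by (simp add: numeral_2_eq_2 sum_lists_Suc)
  have UW: "U X a i = (\<Sum>c\<in>?U. P $ i $ c * W X a c)" for X a i
  proof -
    have "U X a i = (\<Sum>L | length L = 2. \<Sum>c\<in>?U. P $ i $ c * (pull (transpose P) (\<lambda>L. pull P X (c #
        L)) L * \<phi> (a # L)))"
      unfolding U_def sum2[symmetric] raise_g pull_Cons[of "transpose P"]
      by (simp add: sum_distrib_left transpose_def mult_ac)
    also have "\<dots> = (\<Sum>c\<in>?U. \<Sum>L | length L = 2. P $ i $ c * (pull (transpose P) (\<lambda>L. pull P X (c # L))
        L * \<phi> (a # L)))"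
      by (rule sum.swap)
    also have "\<dots> = (\<Sum>c\<in>?U. P $ i $ c * (\<Sum>L | length L = 2. pull P X (c # L) * pull P (\<lambda>L. \<phi> (a # L)) L))"
      unfolding sum_distrib_left[symmetric] sum_pull by simp
    finally show ?thesis by (simp add: W_def sum2[symmetric] mult_ac)
  qed
  have WC: "(\<Sum>a\<in>?U. P $ a $ c * W X a i) = contract (pull P X) (pull P \<phi>) i c" for X c i
  proof -
    have "(\<Sum>a\<in>?U. P $ a $ c * W X a i) = (\<Sum>a\<in>?U. \<Sum>j\<in>?U. \<Sum>k\<in>?U. P $ a $ c * pull P (\<lambda>L. \<phi> (a # L))
        [j, k] * pull P X [i, j, k])"
      by (simp add: W_def sum_distrib_left mult_ac)
    also have "\<dots> = (\<Sum>j\<in>?U. \<Sum>k\<in>?U. \<Sum>a\<in>?U. P $ a $ c * pull P (\<lambda>L. \<phi> (a # L)) [j, k] * pull P X [i, j, k])"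
      by (subst sum.swap, rule sum.cong[OF refl], rule sum.swap)
    also have "\<dots> = contract (pull P X) (pull P \<phi>) i c"
      unfolding contract_def pull_Cons[of P \<phi> c] by (intro sum.cong refl) (simp add:
          sum_distrib_left mult_ac)
    finally show ?thesis .
  qed
  have "(\<Sum>j\<in>?U. \<Sum>k\<in>?U. \<Sum>i\<in>?U. \<Sum>b\<in>?U. \<Sum>d\<in>?U.
       \<phi> [a, j, k] * raise g X [i, j, k] * \<phi> [i, b, d] * raise g Y [a, b, d]) = (\<Sum>i\<in>?U. U X a i * U
           Y i a)" for a
  proof -
    have "(\<Sum>j\<in>?U. \<Sum>k\<in>?U. \<Sum>i\<in>?U. \<Sum>b\<in>?U. \<Sum>d\<in>?U. \<phi> [a, j, k] * raise g X [i, j, k] * \<phi> [i, b, d] *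
        raise g Y [a, b, d]) =
      (\<Sum>j\<in>?U. \<Sum>k\<in>?U. \<Sum>i\<in>?U. \<phi> [a, j, k] * raise g X [i, j, k] * U Y i a)"
      by (simp add: U_def sum_distrib_left mult_ac)
    also have "\<dots> = (\<Sum>i\<in>?U. \<Sum>j\<in>?U. \<Sum>k\<in>?U. \<phi> [a, j, k] * raise g X [i, j, k] * U Y i a)"
      by (rule trans[OF sum.cong[OF refl sum.swap] sum.swap])
    finally show ?thesis by (simp add: U_def[of X] sum_distrib_right)
  qed
  then have "(\<Sum>a\<in>?U. \<Sum>j\<in>?U. \<Sum>k\<in>?U. \<Sum>i\<in>?U. \<Sum>b\<in>?U. \<Sum>d\<in>?U.
       \<phi> [a, j, k] * raise g X [i, j, k] * \<phi> [i, b, d] * raise g Y [a, b, d]) =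
     (\<Sum>a\<in>?U. \<Sum>i\<in>?U. (\<Sum>c\<in>?U. P $ i $ c * W X a c) * (\<Sum>e\<in>?U. P $ a $ e * W Y i e))"
    by (simp add: UW)
  also have "\<dots> = (\<Sum>a\<in>?U. \<Sum>i\<in>?U. \<Sum>c\<in>?U. \<Sum>e\<in>?U. (P $ a $ e * W X a c) * (P $ i $ c * W Y i e))"
    by (simp add: sum_product mult_ac)
  also have "\<dots> = (\<Sum>a\<in>?U. \<Sum>c\<in>?U. \<Sum>e\<in>?U. \<Sum>i\<in>?U. (P $ a $ e * W X a c) * (P $ i $ c * W Y i e))"
    by (rule sum.cong[OF refl], subst sum.swap, rule sum.cong[OF refl], rule sum.swap)
  also have "\<dots> = (\<Sum>a\<in>?U. \<Sum>c\<in>?U. \<Sum>e\<in>?U. (P $ a $ e * W X a c) * contract (pull P Y) (pull P \<phi>) e c)"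
    by (simp add: sum_distrib_left[symmetric] WC)
  also have "\<dots> = (\<Sum>c\<in>?U. \<Sum>e\<in>?U. \<Sum>a\<in>?U. (P $ a $ e * W X a c) * contract (pull P Y) (pull P \<phi>) e c)"
    by (subst sum.swap, rule sum.cong[OF refl], rule sum.swap)
  also have "\<dots> = (\<Sum>c\<in>?U. \<Sum>e\<in>?U. contract (pull P X) (pull P \<phi>) c e * contract (pull P Y) (pull P \<phi>) e c)"
    by (simp add: sum_distrib_right[symmetric] WC)
  finally show ?thesis .
qed

end

text \<open>That Q is 6 times the identity in the frame says that \<open>?c *\<^sub>R ?N\<close> is
  the identity, where \<open>?c\<close> squared is \<open>det ?N\<close>. Taking determinants gives
  \<open>?c ^ 9 = 1\<close>, so \<open>?c = 1\<close>.\<close>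

lemma orthonormal_frame_g2_metric:
  assumes alt: "alternating 3 \<phi>" and pos: "positive_form \<phi>"
    and P: "det P > 0" and std: "standard_form (pull P \<phi>)"
  shows "orthonormal_frame (g2_metric_at \<phi>) P"
proof
  let ?g = "g2_metric_at \<phi>"
  let ?N = "transpose P ** ?g ** P"
  let ?c = "sqrt (det ?g) * det P"
  have d: "det ?g > 0" by (rule inner_product_matrix_det) (rule g2_metric_at_eq[OF alt pos])
  have "6 *\<^sub>R mat 1 = det P *\<^sub>R (transpose P ** Q_matrix \<phi> ** P)"
    using Q_matrix_standard[OF std] by (simp add: Q_matrix_pull)
  also have "Q_matrix \<phi> = (6 * sqrt (det ?g)) *\<^sub>R ?g" by (rule g2_metric_at_eq(3)[OF alt pos, symmetric])
  also have "transpose P ** ((6 * sqrt (det ?g)) *\<^sub>R ?g) ** P = (6 * sqrt (det ?g)) *\<^sub>R ?N"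
    by (simp add: vec_eq_iff matrix_matrix_mult_def sum_distrib_left sum_distrib_right mult_ac)
  finally have "6 *\<^sub>R mat 1 = 6 *\<^sub>R (?c *\<^sub>R ?N)" by (simp add: mult_ac)
  then have N: "?c *\<^sub>R ?N = mat 1" by (metis scaleR_cancel_left zero_neq_numeral)
  have c: "?c > 0" using d P by simp
  have "det ?N = ?c\<^sup>2" using d by (simp add: det_mul power_mult_distrib power2_eq_square)
  then have "?c ^ 9 = 1"
    using arg_cong[OF N, of det] by (simp add: det_scaleR flip: power_add)
  then have "?c = 1" using c by (metis less_eq_real_def power_eq_1_iff zero_neq_numeral
      real_norm_def abs_of_pos)
  then show "?N = mat 1" using N by simp
qed (rule P)

section \<open>Differentiating the metric along a line of forms\<close>

lemma has_derivative_det_scalar: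
  fixes M :: "real \<Rightarrow> real^7^7"
  assumes D: "\<And>i j. ((\<lambda>t. M t $ i $ j) has_real_derivative D i j) (at x)"
    and M: "M x = c *\<^sub>R mat 1"
  shows "((\<lambda>t. det (M t)) has_real_derivative c ^ 6 * (\<Sum>i\<in>UNIV. D i i)) (at x)"
proof -
  let ?U = "UNIV :: 7 set"
  have "((\<lambda>t. det (M t)) has_real_derivative
      (\<Sum>p | p permutes ?U. of_int (sign p) * (\<Sum>i\<in>?U. D i (p i) * (\<Prod>j\<in>?U - {i}. M x $ j $ p j)))) (at x)"
    unfolding det_def by (intro DERIV_sum DERIV_cmult has_field_derivative_prod D)
  also have "(\<Sum>p | p permutes ?U. of_int (sign p) * (\<Sum>i\<in>?U. D i (p i) * (\<Prod>j\<in>?U - {i}. M x $ j $ p j))) =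
     (\<Sum>p | p permutes ?U. if p = id then c ^ 6 * (\<Sum>i\<in>?U. D i i) else 0)"
  proof (intro sum.cong refl)
    fix p assume "p \<in> {p. p permutes ?U}"
    then have p: "p permutes ?U" by simp
    show "of_int (sign p) * (\<Sum>i\<in>?U. D i (p i) * (\<Prod>j\<in>?U - {i}. M x $ j $ p j)) = (if p = id then c ^
        6 * (\<Sum>i\<in>?U. D i i) else 0)"
    proof (cases "p = id")
      case True
      have "(\<Prod>j\<in>?U - {i}. M x $ j $ p j) = c ^ 6" for i
        using True by (simp add: M mat_def card_Diff_singleton)
      then show ?thesis using True by (simp add: sum_distrib_right[symmetric] mult.commute)
    next
      case False
      \<comment> \<open>A nontrivial permutation moves at least two points, so after the
        differentiated factor is removed an off-diagonal zero of the scalar matrix is left.\<close>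
      then obtain a where a: "p a \<noteq> a" by (auto simp: fun_eq_iff)
      then have b: "p (p a) \<noteq> p a" using permutes_inj[OF p] by (metis injD)
      have z: "(\<Prod>j\<in>?U - {i}. M x $ j $ p j) = 0" for i
      proof -
        obtain k where "k \<noteq> i" "p k \<noteq> k" using a b by metis
        then have "M x $ k $ p k = 0" by (auto simp: M mat_def)
        then show ?thesis using \<open>k \<noteq> i\<close> by (intro prod_zero) auto
      qed
      show ?thesis unfolding z using False by simp
    qed
  qed
  also have "\<dots> = c ^ 6 * (\<Sum>i\<in>?U. D i i)"
    by (simp add: sum.If_cases finite_permutations Int_def conj_commute permutes_id cong: conj_cong)
  finally show ?thesis .
qed

lemma has_vector_derivative_matrix:
  fixes M :: "real \<Rightarrow> real^7^7"
  assumes "\<And>i j. ((\<lambda>t. M t $ i $ j) has_real_derivative D $ i $ j) (at x)"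
  shows "(M has_vector_derivative D) (at x)"
proof -
  let ?E = "\<lambda>i j. (\<chi> r s. of_bool (r = i \<and> s = j)) :: real^7^7"
  have e: "N = (\<Sum>i\<in>UNIV. \<Sum>j\<in>UNIV. N $ i $ j *\<^sub>R ?E i j)" for N :: "real^7^7"
  proof -
    have "(\<Sum>i\<in>UNIV. \<Sum>j\<in>UNIV. N $ i $ j * of_bool (r = i \<and> s = j)) = N $ r $ s" for r s
    proof -
      have "(\<Sum>i\<in>UNIV. \<Sum>j\<in>UNIV. N $ i $ j * of_bool (r = i \<and> s = j)) =
         (\<Sum>i\<in>UNIV. \<Sum>j\<in>UNIV. if j = s then (if i = r then N $ i $ j else 0) else 0)"
        by (intro sum.cong refl) auto
      then show ?thesis by simp
    qed
    then show ?thesis by (simp add: vec_eq_iff)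
  qed
  have "((\<lambda>t. \<Sum>i\<in>UNIV. \<Sum>j\<in>UNIV. M t $ i $ j *\<^sub>R ?E i j) has_vector_derivative
     (\<Sum>i\<in>UNIV. \<Sum>j\<in>UNIV. D $ i $ j *\<^sub>R ?E i j)) (at x)"
    using assms by (intro has_vector_derivative_sum) (auto intro!: derivative_eq_intros)
  then show ?thesis unfolding e[symmetric] .
qed

lemma near_scalar_positive:
  fixes M :: "real^7^7"
  assumes near: "\<And>i j. \<bar>M $ i $ j - 6 * of_bool (i = j)\<bar> < 1 / 10" and v: "v \<noteq> 0"
  shows "v \<bullet> (M *v v) > 0"
proof -
  let ?E = "\<lambda>i j. M $ i $ j - 6 * of_bool (i = j)"
  have "v \<bullet> (M *v v) = (\<Sum>i\<in>UNIV. \<Sum>j\<in>UNIV. v $ i * v $ j * M $ i $ j)"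
    by (simp add: inner_vec_def matrix_vector_mult_def sum_distrib_left mult_ac)
  also have "\<dots> = (\<Sum>i\<in>UNIV. \<Sum>j\<in>UNIV. v $ i * v $ j * ?E i j + (if j = i then 6 * (v $ i * v $ i) else 0))"
    by (intro sum.cong refl) (simp add: algebra_simps)
  also have "\<dots> = (\<Sum>i\<in>UNIV. \<Sum>j\<in>UNIV. v $ i * v $ j * ?E i j) + 6 * (v \<bullet> v)"
    by (simp add: sum.distrib inner_vec_def sum_distrib_left)
  finally have eq: "v \<bullet> (M *v v) = (\<Sum>i\<in>UNIV. \<Sum>j\<in>UNIV. v $ i * v $ j * ?E i j) + 6 * (norm v)\<^sup>2"
    by (simp add: power2_norm_eq_inner)
  have "\<bar>v $ i * v $ j * ?E i j\<bar> \<le> (norm v)\<^sup>2 * (1 / 10)" for i j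
    unfolding abs_mult power2_eq_square
    using near[of i j] by (intro mult_mono component_le_norm_cart) auto
  then have "\<bar>\<Sum>i\<in>UNIV. \<Sum>j\<in>UNIV. v $ i * v $ j * ?E i j\<bar> \<le> (\<Sum>i\<in>(UNIV::7 set). \<Sum>j\<in>(UNIV::7 set). (norm
      v)\<^sup>2 * (1 / 10))"
    by (intro order_trans[OF sum_abs] sum_mono)
  \<comment> \<open>49 entries with an error of at most 1/10 each: 4.9 stays below the 6 on the
    diagonal.\<close>
  also have "\<dots> = 49 / 10 * (norm v)\<^sup>2" by simp
  finally have "(\<Sum>i\<in>UNIV. \<Sum>j\<in>UNIV. v $ i * v $ j * ?E i j) \<ge> - (49 / 10 * (norm v)\<^sup>2)" by linarith
  moreover have "(norm v)\<^sup>2 > 0" using v by simp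
  ultimately show ?thesis unfolding eq by linarith
qed

text \<open>\<open>g2_metric_at\<close> is a definite description, so its derivative is taken from
  an explicit formula that agrees with it near t = 0, where positivity persists. The formula is set
  up in the frame, where Q starts at 6 times the identity, and is carried back to coordinates by
  \<open>?R\<close>.\<close>

lemma vector_derivative_g2_metric:
  assumes alt: "alternating 3 \<phi>" "alternating 3 X"
    and P: "det P > 0" and std: "standard_form (pull P \<phi>)"
  defines "D \<equiv> vector_derivative (\<lambda>t. g2_metric_at (\<lambda>I. \<phi> I + t * X I)) (at 0)"
  shows "(transpose P ** D ** P) $ i $ j = metric_variation (pull P \<phi>) (pull P X) i j"
proof -
  let ?\<omega> = "pull P \<phi>" and ?X = "pull P X" and ?R = "matrix_inv P"
  define \<phi>t where "\<phi>t t = (\<lambda>I. \<phi> I + t * X I)" for t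
  define M where "M t = Q_matrix (\<lambda>I. ?\<omega> I + t * ?X I)" for t
  define s where "s t = root 9 (det (M t) / 6 ^ 7)" for t
  define N where "N t = (1 / (6 * s t)) *\<^sub>R M t" for t
  define N' :: "real^7^7" where "N' = (\<chi> i j. metric_variation ?\<omega> ?X i j)"
  have altX: "alternating 3 ?X" by (rule alternating_pull[OF alt(2)])
  have R: "P ** ?R = mat 1" "?R ** P = mat 1" using P matrix_inv_mult[of P] by auto
  have M_pull: "M t = det P *\<^sub>R (transpose P ** Q_matrix (\<phi>t t) ** P)" for t
    by (simp add: M_def \<phi>t_def pull_add_scaled[symmetric] Q_matrix_pull)
  have M0: "M 0 = 6 *\<^sub>R mat 1" using Q_matrix_standard[OF std] by (simp add: M_def)
  have DM: "((\<lambda>t. M t $ i $ j) has_real_derivative Q_linear ?\<omega> ?X i j) (at 0)" for i j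
    unfolding M_def by (rule has_derivative_Q_matrix)
  \<comment> \<open>3/2 * 2 * 6 = 18, by \<open>sum_contract_diag\<close>.\<close>
  have tr: "(\<Sum>i\<in>UNIV. Q_linear ?\<omega> ?X i i) = 18 * gram3 ?X ?\<omega>"
    by (simp add: Q_linear_standard[OF std altX] sum_distrib_left[symmetric] sum_contract_diag)
  have det0: "det (M 0) / 6 ^ 7 = 1" by (simp add: M0 det_scaleR)
  have "((\<lambda>t. det (M t)) has_real_derivative 6 ^ 6 * (18 * gram3 ?X ?\<omega>)) (at 0)"
    using has_derivative_det_scalar[OF DM M0] by (simp add: tr)
  then have "((\<lambda>t. det (M t) / 6 ^ 7) has_real_derivative 3 * gram3 ?X ?\<omega>) (at 0)"
    by (auto intro!: derivative_eq_intros)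
  moreover have "(root 9 has_real_derivative inverse (real 9 * root 9 1 ^ (9 - Suc 0))) (at (det (M
      0) / 6 ^ 7))"
    unfolding det0 by (rule DERIV_real_root) simp_all
  ultimately have "(s has_real_derivative inverse (real 9 * root 9 1 ^ (9 - Suc 0)) * (3 * gram3 ?X
      ?\<omega>)) (at 0)"
    unfolding s_def by (intro DERIV_chain2[where f = "root 9"])
  \<comment> \<open>The slope 6^6 * 18 / 6^7 = 3 of the radicand meets the slope 1/9 of the ninth
    root at 1.\<close>
  then have Ds: "(s has_real_derivative gram3 ?X ?\<omega> / 3) (at 0)" by (simp add: field_simps)
  have s0: "s 0 = 1" unfolding s_def det0 by simp
  have DN: "((\<lambda>t. N t $ i $ j) has_real_derivative N' $ i $ j) (at 0)" for i j
  proof -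
    have "((\<lambda>t. M t $ i $ j / (6 * s t)) has_real_derivative
       (Q_linear ?\<omega> ?X i j * (6 * s 0) - M 0 $ i $ j * (6 * (gram3 ?X ?\<omega> / 3))) / ((6 * s 0) * (6 *
           s 0))) (at 0)"
      by (intro DERIV_divide DM DERIV_cmult Ds) (simp add: s0)
    also have "(Q_linear ?\<omega> ?X i j * (6 * s 0) - M 0 $ i $ j * (6 * (gram3 ?X ?\<omega> / 3))) / ((6 * s 0)
        * (6 * s 0)) = N' $ i $ j"
      by (simp add: s0 M0 N'_def metric_variation_def Q_linear_standard[OF std altX] mat_def field_simps)
    finally show ?thesis by (simp add: N_def)
  qed
  have ev: "\<forall>\<^sub>F t in nhds 0. g2_metric_at (\<phi>t t) = transpose ?R ** N t ** ?R"
  proof -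
    have "\<forall>\<^sub>F t in nhds 0. \<bar>M t $ i $ j - 6 * of_bool (i = j)\<bar> < 1 / 10" for i j
    proof -
      define h where "h t = \<bar>M t $ i $ j - 6 * of_bool (i = j)\<bar>" for t
      have "isCont h 0"
        unfolding h_def by (intro isCont_rabs isCont_diff DERIV_isCont[OF DM] continuous_const)
      then have "(h \<longlongrightarrow> h 0) (nhds 0)"
        by (simp add: isCont_def tendsto_at_iff_tendsto_nhds)
      moreover have "h 0 < 1 / 10" by (simp add: h_def M0 mat_def)
      ultimately show ?thesis unfolding h_def by (rule order_tendstoD(2))
    qed
    then have "\<forall>\<^sub>F t in nhds 0. \<forall>i j. \<bar>M t $ i $ j - 6 * of_bool (i = j)\<bar> < 1 / 10"
      by (simp add: eventually_all_finite)
    then show ?thesis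
    proof (rule eventually_mono)
      fix t assume "\<forall>i j. \<bar>M t $ i $ j - 6 * of_bool (i = j)\<bar> < 1 / 10"
      then have Mpos: "v \<bullet> (M t *v v) > 0" if "v \<noteq> 0" for v using that by (intro near_scalar_positive) auto
      have pos: "positive_form (\<phi>t t)"
        unfolding positive_form_iff
      proof (intro allI impI)
        fix v :: "real^7" assume "v \<noteq> 0"
        have v: "P *v (?R *v v) = v" by (simp add: matrix_vector_mul_assoc R)
        then have "?R *v v \<noteq> 0" using \<open>v \<noteq> 0\<close> by auto
        then have "(?R *v v) \<bullet> (M t *v (?R *v v)) > 0" by (rule Mpos)
        then have "det P * (v \<bullet> (Q_matrix (\<phi>t t) *v v)) > 0"
          by (simp add: M_pull scaleR_matrix_vector_assoc[symmetric] inner_matrix_congruence v)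
        then show "v \<bullet> (Q_matrix (\<phi>t t) *v v) > 0" using P by (simp add: zero_less_mult_iff)
      qed
      have altt: "alternating 3 (\<phi>t t)"
        using alt by (simp add: alternating_def \<phi>t_def algebra_simps)
      \<comment> \<open>Seven factors \<open>det P\<close> come from the scalar in front and two
        from the congruence; the ninth root leaves the single one that cancels in
        \<open>N t\<close>.\<close>
      have "det (M t) / 6 ^ 7 = det P ^ 9 * (det (Q_matrix (\<phi>t t)) / 6 ^ 7)"
        by (simp add: M_pull det_scaleR det_mul power_numeral_reduce)
      then have "s t = det P * Q_scale (\<phi>t t)"
        using P by (simp add: s_def Q_scale_def real_root_mult real_root_power_cancel del:
            times_divide_eq_right)
      then have "N t = transpose P ** g2_metric_at (\<phi>t t) ** P"
        using P by (simp add: N_def M_pull g2_metric_at_eq(1)[OF altt pos] vec_eq_iff matrix_matrix_mult_def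
            sum_distrib_left sum_divide_distrib field_simps)
      then have "transpose ?R ** N t ** ?R = transpose (P ** ?R) ** g2_metric_at (\<phi>t t) ** (P ** ?R)"
        by (simp only: matrix_transpose_mul matrix_mul_assoc)
      then show "g2_metric_at (\<phi>t t) = transpose ?R ** N t ** ?R"
        by (simp add: R)
    qed
  qed
  have "((\<lambda>t. transpose ?R ** N t ** ?R) has_vector_derivative transpose ?R ** N' ** ?R) (at 0)"
    by (rule has_vector_derivative_matrix)
       (auto simp: matrix_matrix_mult_def intro!: DERIV_sum DERIV_cmult DERIV_cmult_right DN)
  moreover have "((\<lambda>t. g2_metric_at (\<phi>t t)) has_vector_derivative transpose ?R ** N' ** ?R) (at 0) \<longleftrightarrow>
      ((\<lambda>t. transpose ?R ** N t ** ?R) has_vector_derivative transpose ?R ** N' ** ?R) (at 0)"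
    by (rule has_vector_derivative_cong_ev)
       (use ev eventually_nhds_x_imp_x[OF ev] in \<open>auto elim: eventually_mono\<close>)
  ultimately have "((\<lambda>t. g2_metric_at (\<phi>t t)) has_vector_derivative transpose ?R ** N' ** ?R) (at
      0)" by blast
  then have "D = transpose ?R ** N' ** ?R"
    unfolding D_def \<phi>t_def by (rule vector_derivative_at)
  then have "transpose P ** D ** P = transpose (?R ** P) ** N' ** (?R ** P)"
    by (simp only: matrix_transpose_mul matrix_mul_assoc)
  then show ?thesis by (simp add: R N'_def)
qed

lemma pull_matrix_tensor: "pull P (matrix_tensor A) [i, j] = (transpose P ** A ** P) $ i $ j"
proof -
  have "pull P (matrix_tensor A) [i, j] = (\<Sum>a\<in>UNIV. \<Sum>b\<in>UNIV. P $ a $ i * (A $ a $ b * P $ b $ j))"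
    by (simp add: pull_def matrix_tensor_def numeral_2_eq_2 sum_lists_Suc prod.lessThan_Suc_shift
        mult_ac del: prod.lessThan_Suc)
  also have "\<dots> = (transpose P ** (A ** P)) $ i $ j"
    by (simp add: matrix_matrix_mult_def transpose_def sum_distrib_left)
  finally show ?thesis by (simp add: matrix_mul_assoc)
qed

lemma pointwise_identity:
  assumes alt: "alternating 3 \<phi>" "alternating 3 X" "alternating 3 Y" and pos: "positive_form \<phi>"
  defines "g \<equiv> g2_metric_at \<phi>"
    and "D \<equiv> \<lambda>X. vector_derivative (\<lambda>t. g2_metric_at (\<lambda>I. \<phi> I + t * X I)) (at 0)"
  shows "tensor_inner g 2 (matrix_tensor (D X)) (matrix_tensor (D Y)) =
    3 / 4 * tensor_inner g 3 X Y - (11 / 18 * tensor_inner g 3 X \<phi> * tensor_inner g 3 Y \<phi>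
     - 1 / 16 * ((\<Sum>a\<in>UNIV. \<Sum>j\<in>UNIV. \<Sum>k\<in>UNIV. \<Sum>b\<in>UNIV. \<Sum>d\<in>UNIV.
         raise g (\<lambda>L. X (a # L)) [j, k] * raise g Y [a, b, d] * hodge g 3 \<phi> [j, k, b, d]) +
       (\<Sum>a\<in>UNIV. \<Sum>j\<in>UNIV. \<Sum>k\<in>UNIV. \<Sum>i\<in>UNIV. \<Sum>b\<in>UNIV. \<Sum>d\<in>UNIV.
         \<phi> [a, j, k] * raise g X [i, j, k] * \<phi> [i, b, d] * raise g Y [a, b, d])))"
proof -
  obtain P where P: "det P > 0" "standard_form (pull P \<phi>)"
    by (rule exists_standard_frame[OF alt(1) pos])
  interpret orthonormal_frame g P
    unfolding g_def by (rule orthonormal_frame_g2_metric[OF alt(1) pos P])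
  have inner2: "tensor_inner g 2 (matrix_tensor (D X)) (matrix_tensor (D Y)) =
    (\<Sum>i\<in>UNIV. \<Sum>j\<in>UNIV. metric_variation (pull P \<phi>) (pull P X) i j * metric_variation (pull P \<phi>)
        (pull P Y) i j) / 2"
    unfolding tensor_inner_g
    by (simp add: numeral_2_eq_2 sum_lists_Suc pull_matrix_tensor D_def vector_derivative_g2_metric alt P)
  have inner3: "tensor_inner g 3 X Y = gram3 (pull P X) (pull P Y)" for X Y
    unfolding tensor_inner_g by (simp add: gram3_def numeral_3_eq_3 sum_lists_Suc fact_numeral)
  show ?thesis
    unfolding inner2 inner3 psi_contraction_frame phi_contraction_frame
    by (rule metric_variation_inner[OF P(2) alternating_pull[OF alt(3)]])
qed

section \<open>Integration\<close>

lemma exists_bump_function: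
  assumes norm: "normal_space T" and haus: "Hausdorff_space T" and U: "openin T U" and p: "p \<in> U"
  shows "\<exists>V f. openin T V \<and> p \<in> V \<and> continuous_map T euclideanreal f \<and> (\<forall>q\<in>topspace T. 0 \<le> f q) \<and>
    (\<forall>q\<in>V. f q = 1) \<and> T closure_of {q \<in> topspace T. f q \<noteq> 0} \<subseteq> U"
proof -
  have pT: "p \<in> topspace T" using U p openin_subset by blast
  have shrink: "\<exists>V. openin T V \<and> S \<subseteq> V \<and> T closure_of V \<subseteq> U'" if "closedin T S" "openin T U'" "S \<subseteq>
      U'" for S U'
    using norm that by (simp add: normal_space_alt)
  \<comment> \<open>Two shrinkings: the function has to equal 1 on an open set, and the closure of
    the set where it is nonzero has to stay inside \<open>U\<close>.\<close>
  obtain V where V: "openin T V" "{p} \<subseteq> V" "T closure_of V \<subseteq> U"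
    using shrink[of "{p}" U] closedin_Hausdorff_singleton[OF haus pT] U p by blast
  obtain W where W: "openin T W" "T closure_of V \<subseteq> W" "T closure_of W \<subseteq> U"
    using shrink[OF closedin_closure_of U V(3)] by blast
  have "closedin T (topspace T - W)" using W(1) by blast
  moreover have "disjnt (topspace T - W) (T closure_of V)" using W(2) by (auto simp: disjnt_iff)
  ultimately obtain f where f: "continuous_map T (top_of_set {0..1::real}) f" "f ` (topspace T - W)
      \<subseteq> {0}" "f ` (T closure_of V) \<subseteq> {1}"
    using Urysohn_lemma[OF norm, of "topspace T - W" "T closure_of V" 0 1] by (metis
        closedin_closure_of zero_le_one)
  have VT: "V \<subseteq> topspace T" using V(1) openin_subset by blast
  have "continuous_map T euclideanreal f" "\<forall>q\<in>topspace T. 0 \<le> f q"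
    using f(1) by (auto simp: continuous_map_in_subtopology image_subset_iff)
  moreover have "\<forall>q\<in>V. f q = 1" using f(3) closure_of_subset[OF VT] by blast
  moreover have "{q \<in> topspace T. f q \<noteq> 0} \<subseteq> W" using f(2) by blast
  then have "T closure_of {q \<in> topspace T. f q \<noteq> 0} \<subseteq> U" using W(3) closure_of_mono by blast
  ultimately show ?thesis using V by blast
qed

text \<open>\<open>form_integral\<close> selects its partition by \<open>SOME\<close>, so the
  properties of the selected list become available through existence. Finitely many bump functions,
  equal to 1 on the sets of a finite cover, are divided by their positive sum.\<close>

lemma exists_partition_of_unity:
  assumes comp: "compact_space T" and haus: "Hausdorff_space T"
    and open_A: "\<And>c. c \<in> A \<Longrightarrow> openin T (fst c)" and cover: "\<Union> (fst ` A) = topspace T"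
  shows "\<exists>P. partition_of_unity T A P"
proof -
  have norm: "normal_space T" using comp haus compact_Hausdorff_or_regular_imp_normal_space by blast
  define good where "good p x \<longleftrightarrow> (case x of (c, V, f) \<Rightarrow> c \<in> A \<and> openin T V \<and> p \<in> V \<and> continuous_map T
      euclideanreal f \<and>
      (\<forall>q\<in>topspace T. 0 \<le> f q) \<and> (\<forall>q\<in>V. f q = 1) \<and> T closure_of {q \<in> topspace T. f q \<noteq> 0} \<subseteq> fst c)" for p x
  have "\<forall>p\<in>topspace T. \<exists>x. good p x"
  proof
    fix p assume "p \<in> topspace T"
    then obtain c where c: "c \<in> A" "p \<in> fst c" using cover by blast
    obtain V f where "openin T V \<and> p \<in> V \<and> continuous_map T euclideanreal f \<and> (\<forall>q\<in>topspace T. 0 \<le> f q) \<and>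
        (\<forall>q\<in>V. f q = 1) \<and> T closure_of {q \<in> topspace T. f q \<noteq> 0} \<subseteq> fst c"
      using exists_bump_function[OF norm haus open_A[OF c(1)] c(2)] by blast
    then have "good p (c, V, f)" using c(1) by (simp add: good_def)
    then show "\<exists>x. good p x" ..
  qed
  from bchoice[OF this] obtain h where h: "\<forall>p\<in>topspace T. good p (h p)" ..
  define c V f where "c p = fst (h p)" and "V p = fst (snd (h p))" and "f p = snd (snd (h p))" for p
  have cVf: "c p \<in> A \<and> openin T (V p) \<and> p \<in> V p \<and> continuous_map T euclideanreal (f p) \<and>
      (\<forall>q\<in>topspace T. 0 \<le> f p q) \<and> (\<forall>q\<in>V p. f p q = 1) \<and> T closure_of {q \<in> topspace T. f p q \<noteq> 0} \<subseteq>
          fst (c p)"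
    if "p \<in> topspace T" for p
    using bspec[OF h that] by (simp add: good_def c_def V_def f_def case_prod_beta)
  have "\<exists>\<F>. finite \<F> \<and> \<F> \<subseteq> V ` topspace T \<and> topspace T \<subseteq> \<Union>\<F>"
  proof (rule comp[unfolded compact_space_alt, rule_format])
    show "(\<forall>U\<in>V ` topspace T. openin T U) \<and> topspace T \<subseteq> \<Union> (V ` topspace T)" using cVf by blast
  qed
  then obtain F where F: "finite F" "F \<subseteq> topspace T" "topspace T \<subseteq> \<Union> (V ` F)"
    by (metis finite_subset_image)
  obtain ps where ps: "set ps = F" "distinct ps" using finite_distinct_list[OF F(1)] by blast
  define s where "s q = (\<Sum>p\<in>F. f p q)" for q
  have s: "s q > 0" if q: "q \<in> topspace T" for q
  proof -
    obtain p where "p \<in> F" "q \<in> V p" using F(3) q by blast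
    then show ?thesis
      unfolding s_def using cVf F(1,2) q by (intro sum_pos2[of F p]) auto
  qed
  have s_cont: "continuous_map T euclideanreal s"
    unfolding s_def using cVf F by (intro continuous_map_sum) auto
  have "partition_of_unity T A (map (\<lambda>p. (c p, \<lambda>q. f p q / s q)) ps)"
    unfolding partition_of_unity_def
  proof (intro conjI ballI, goal_cases)
    case (1 x)
    then obtain p where p: "p \<in> F" "x = (c p, \<lambda>q. f p q / s q)" using ps by auto
    then have pT: "p \<in> topspace T" using F by blast
    have "continuous_map T euclideanreal (\<lambda>q. f p q / s q)"
      using cVf[OF pT] s_cont s by (intro continuous_map_real_divide) (auto simp: less_imp_neq[symmetric])
    moreover have "T closure_of {q \<in> topspace T. f p q / s q \<noteq> 0} \<subseteq> T closure_of {q \<in> topspace T. f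
        p q \<noteq> 0}"
      by (intro closure_of_mono) auto
    moreover have "0 \<le> f p q / s q" if "q \<in> topspace T" for q
      using cVf[OF pT] s[OF that] that by auto
    ultimately show ?case using cVf[OF pT] p(2) by auto
  next
    case (2 q)
    have "(\<Sum>p\<leftarrow>ps. f p q / s q) = (\<Sum>p\<in>F. f p q / s q)"
      using ps sum_list_distinct_conv_sum_set by metis
    also have "\<dots> = 1" using s[OF 2] by (simp add: sum_divide_distrib[symmetric] s_def)
    finally show ?case by (simp add: o_def)
  qed
  then show ?thesis by blast
qed

section \<open>Integrability in a chart\<close>

lemma set_integrable_compact_support:
  fixes h :: "'a::euclidean_space \<Rightarrow> real"
  assumes "continuous_on U h" "compact K" "K \<subseteq> U" "\<And>x. x \<in> U - K \<Longrightarrow> h x = 0"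
  shows "set_integrable lborel U h"
proof -
  have "integrable lborel (\<lambda>x. indicator K x *\<^sub>R h x)"
    by (rule borel_integrable_compact[OF assms(2) continuous_on_subset[OF assms(1,3)]])
  also have "(\<lambda>x. indicator K x *\<^sub>R h x) = (\<lambda>x. indicator U x *\<^sub>R h x)"
  proof
    fix x show "indicator K x *\<^sub>R h x = indicator U x *\<^sub>R h x"
      using assms(3) assms(4)[of x] by (cases "x \<in> K"; cases "x \<in> U") auto
  qed
  finally show ?thesis by (simp add: set_integrable_def)
qed

lemma chart_inverse:
  assumes "is_chart T c"
  shows "continuous_map (top_of_set (snd c ` fst c)) (subtopology T (fst c)) (cinv c)"
    "inj_on (snd c) (fst c)" "continuous_map (subtopology T (fst c)) (top_of_set (snd c ` fst c)) (snd c)"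
proof -
  have op: "openin T (fst c)" and hom: "homeomorphic_map (subtopology T (fst c)) (top_of_set (snd c
      ` fst c)) (snd c)"
    using assms by (auto simp: is_chart_def)
  have top: "topspace (subtopology T (fst c)) = fst c"
    using openin_subset[OF op] by auto
  obtain g where g: "homeomorphic_maps (subtopology T (fst c)) (top_of_set (snd c ` fst c)) (snd c) g"
    using hom by (auto simp: homeomorphic_map_maps)
  then have g': "continuous_map (top_of_set (snd c ` fst c)) (subtopology T (fst c)) g" "\<And>p. p \<in> fst
      c \<Longrightarrow> g (snd c p) = p"
    "continuous_map (subtopology T (fst c)) (top_of_set (snd c ` fst c)) (snd c)"
    using openin_subset[OF op] by (auto simp: homeomorphic_maps_def top)
  show inj: "inj_on (snd c) (fst c)" using g'(2) by (metis inj_on_inverseI)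
  have "g x = cinv c x" if "x \<in> topspace (top_of_set (snd c ` fst c))" for x
    using that g'(2) inj by (auto simp: cinv_def)
  then show "continuous_map (top_of_set (snd c ` fst c)) (subtopology T (fst c)) (cinv c)"
    using g'(1) continuous_map_eq by blast
  show "continuous_map (subtopology T (fst c)) (top_of_set (snd c ` fst c)) (snd c)" by (rule g'(3))
qed

text \<open>The support of \<open>\<rho>\<close> is closed in a compact space, so its image in the
  chart is a compact set off which the integrand vanishes.\<close>

lemma set_integrable_partition:
  assumes comp: "compact_space T" and chart: "is_chart T c" and h: "continuous_on (snd c ` fst c) h"
    and \<rho>: "continuous_map T euclideanreal \<rho>" "T closure_of {p \<in> topspace T. \<rho> p \<noteq> 0} \<subseteq> fst c"
  shows "set_integrable lborel (snd c ` fst c) (\<lambda>x. \<rho> (cinv c x) * h x)"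
proof (rule set_integrable_compact_support)
  let ?K = "T closure_of {p \<in> topspace T. \<rho> p \<noteq> 0}"
  have "continuous_map (top_of_set (snd c ` fst c)) euclideanreal (\<rho> \<circ> cinv c)"
    using continuous_map_compose[OF chart_inverse(1)[OF chart] continuous_map_from_subtopology[OF \<rho>(1)]] .
  then have "continuous_on (snd c ` fst c) (\<lambda>x. \<rho> (cinv c x))" by (simp add: o_def)
  then show "continuous_on (snd c ` fst c) (\<lambda>x. \<rho> (cinv c x) * h x)" using h by (rule continuous_on_mult)
  have "compactin T ?K" by (intro closedin_compact_space[OF comp]) simp
  then have "compactin (subtopology T (fst c)) ?K" using \<rho>(2) by (simp add: compactin_subtopology)
  then have "compactin (top_of_set (snd c ` fst c)) (snd c ` ?K)"
    by (rule image_compactin[OF _ chart_inverse(3)[OF chart]])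
  then show "compact (snd c ` ?K)" by (simp add: compactin_subtopology)
  show "snd c ` ?K \<subseteq> snd c ` fst c" using \<rho>(2) by blast
  show "\<rho> (cinv c x) * h x = 0" if x: "x \<in> snd c ` fst c - snd c ` ?K" for x
  proof -
    obtain p where p: "p \<in> fst c" "x = snd c p" "p \<notin> ?K" using x by blast
    have "p \<in> topspace T" using p(1) chart openin_subset by (force simp: is_chart_def)
    then have "\<rho> p = 0" using p(3) closure_of_subset[of "{p \<in> topspace T. \<rho> p \<noteq> 0}" T] by blast
    then show ?thesis using p chart_inverse(2)[OF chart] by (simp add: cinv_def)
  qed
qed

section \<open>Continuity of the metric and of contractions\<close>

lemma continuous_on_det:
  fixes M :: "'a::topological_space \<Rightarrow> real^7^7"
  assumes "\<And>i j. continuous_on U (\<lambda>x. M x $ i $ j)"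
  shows "continuous_on U (\<lambda>x. det (M x))"
  unfolding det_def by (intro continuous_on_sum continuous_on_mult continuous_on_const
      continuous_on_prod assms)

text \<open>Cramer's rule applied to a column of the inverse; it expresses the inverse through
  determinants, from which continuity can be read off.\<close>

lemma matrix_inv_component:
  assumes "det (M :: real^7^7) \<noteq> 0"
  shows "matrix_inv M $ i $ j = det (\<chi> a b. if b = i then axis j 1 $ a else M $ a $ b) / det M"
proof -
  have "M *v (matrix_inv M *v axis j 1) = axis j 1"
    by (simp add: matrix_vector_mul_assoc matrix_inv_mult assms)
  then have "matrix_inv M *v axis j 1 = (\<chi> k. det (\<chi> a b. if b = k then axis j 1 $ a else M $ a $ b)
      / det M)"
    by (rule cramer[OF assms, THEN iffD1])
  from arg_cong[OF this, of "\<lambda>v. v $ i"] show ?thesis by (simp add: matrix_vector_mult_basis column_def)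
qed

lemma continuous_on_matrix_inv:
  fixes M :: "'a::topological_space \<Rightarrow> real^7^7"
  assumes M: "\<And>i j. continuous_on U (\<lambda>x. M x $ i $ j)" and d: "\<And>x. x \<in> U \<Longrightarrow> det (M x) \<noteq> 0"
  shows "continuous_on U (\<lambda>x. matrix_inv (M x) $ i $ j)"
proof -
  have "continuous_on U (\<lambda>x. det (\<chi> a b. if b = i then axis j 1 $ a else M x $ a $ b) / det (M x))"
  proof (intro continuous_on_divide continuous_on_det M ballI d)
    fix a b
    show "continuous_on U (\<lambda>x. (\<chi> a b. if b = i then axis j 1 $ a else M x $ a $ b) $ a $ b)"
      using M by (cases "b = i") auto
  qed
  then show ?thesis by (rule continuous_on_eq) (simp add: matrix_inv_component d)
qed

lemma continuous_on_raise:
  fixes S :: "'a::topological_space \<Rightarrow> tensor"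
  assumes "\<And>i j. continuous_on U (\<lambda>x. matrix_inv (g x) $ i $ j)"
    "\<And>J. length J = length I \<Longrightarrow> continuous_on U (\<lambda>x. S x J)"
  shows "continuous_on U (\<lambda>x. raise (g x) (S x) I)"
  unfolding raise_def by (intro continuous_on_sum continuous_on_mult continuous_on_prod assms) auto

lemma continuous_on_tensor_inner:
  fixes S S' :: "'a::topological_space \<Rightarrow> tensor"
  assumes "\<And>i j. continuous_on U (\<lambda>x. matrix_inv (g x) $ i $ j)"
    "\<And>J. length J = k \<Longrightarrow> continuous_on U (\<lambda>x. S x J)" "\<And>J. length J = k \<Longrightarrow> continuous_on U (\<lambda>x. S' x J)"
  shows "continuous_on U (\<lambda>x. tensor_inner (g x) k (S x) (S' x))"
  unfolding tensor_inner_def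
  by (intro continuous_on_divide continuous_on_sum continuous_on_mult continuous_on_prod
      continuous_on_const assms) auto

lemma continuous_on_Q_matrix:
  fixes S :: "'a::topological_space \<Rightarrow> tensor"
  assumes "\<And>J. length J = 3 \<Longrightarrow> continuous_on U (\<lambda>x. S x J)"
  shows "continuous_on U (\<lambda>x. Q_matrix (S x) $ i $ j)"
  unfolding Q_matrix_def vec_lambda_beta wedge_def by (intro continuous_intros assms) auto

lemma continuous_on_g2_metric_at:
  fixes S :: "'a::topological_space \<Rightarrow> tensor"
  assumes S: "\<And>J. length J = 3 \<Longrightarrow> continuous_on U (\<lambda>x. S x J)"
    and alt: "\<And>x. x \<in> U \<Longrightarrow> alternating 3 (S x)" "\<And>x. x \<in> U \<Longrightarrow> positive_form (S x)"
  shows "continuous_on U (\<lambda>x. g2_metric_at (S x) $ i $ j)"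
proof -
  have "continuous_on U (\<lambda>x. 1 / (6 * Q_scale (S x)) * Q_matrix (S x) $ i $ j)"
    unfolding Q_scale_def
    by (intro continuous_intros continuous_on_det continuous_on_Q_matrix S)
       (use Q_scale_pos[OF alt(2)] in \<open>force simp: Q_scale_def\<close>)+
  then show ?thesis by (rule continuous_on_eq) (simp add: g2_metric_at_eq(1) alt)
qed

text \<open>The three integrals run over the same selected partition, so linearity can be checked
  chart by chart. Continuity is asked of the two integrands on the right, and the left one is their
  combination.\<close>

lemma form_integral_linear:
  assumes man: "compact_oriented_manifold T A"
    and cont: "\<And>c. c \<in> A \<Longrightarrow> continuous_on (snd c ` fst c) (\<lambda>x. \<beta> c (cinv c x) std_index)"
      "\<And>c. c \<in> A \<Longrightarrow> continuous_on (snd c ` fst c) (\<lambda>x. \<gamma> c (cinv c x) std_index)"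
    and eq: "\<And>c p. c \<in> A \<Longrightarrow> p \<in> fst c \<Longrightarrow> \<alpha> c p std_index = r * \<beta> c p std_index - \<gamma> c p std_index"
  shows "form_integral T A \<alpha> = r * form_integral T A \<beta> - form_integral T A \<gamma>"
proof -
  let ?P = "SOME P. partition_of_unity T A P"
  let ?I = "\<lambda>\<alpha> (c, \<rho>). LINT x:snd c ` fst c|lborel. \<rho> (cinv c x) * \<alpha> c (cinv c x) std_index"
  have comp: "compact_space T" and chart: "\<And>c. c \<in> A \<Longrightarrow> is_chart T c"
    using man by (auto simp: compact_oriented_manifold_def)
  have "\<exists>P. partition_of_unity T A P"
    using man by (intro exists_partition_of_unity) (auto simp: compact_oriented_manifold_def is_chart_def)
  then have P: "partition_of_unity T A ?P" by (rule someI_ex)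
  have "?I \<alpha> x = r * ?I \<beta> x - ?I \<gamma> x" if x: "x \<in> set ?P" for x
  proof -
    obtain c \<rho> where x': "x = (c, \<rho>)" by (cases x)
    let ?U = "snd c ` fst c"
    have c: "c \<in> A" and \<rho>: "continuous_map T euclideanreal \<rho>" "T closure_of {p \<in> topspace T. \<rho> p \<noteq>
        0} \<subseteq> fst c"
      using P x by (auto simp: partition_of_unity_def x')
    have U: "?U \<in> sets lborel" using chart[OF c] by (simp add: is_chart_def)
    note int = set_integrable_partition[OF comp chart[OF c] _ \<rho>]
    have "?I \<alpha> x = (LINT x:?U|lborel. r * (\<rho> (cinv c x) * \<beta> c (cinv c x) std_index) - \<rho> (cinv c x) *
        \<gamma> c (cinv c x) std_index)"
      unfolding x' prod.case
    proof (rule set_lebesgue_integral_cong[OF U], intro allI impI)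
      fix y assume "y \<in> ?U"
      then have y: "cinv c y \<in> fst c" by (simp add: cinv_def inv_into_into)
      show "\<rho> (cinv c y) * \<alpha> c (cinv c y) std_index =
        r * (\<rho> (cinv c y) * \<beta> c (cinv c y) std_index) - \<rho> (cinv c y) * \<gamma> c (cinv c y) std_index"
        unfolding eq[OF c y] by (simp add: algebra_simps)
    qed
    also have "\<dots> = (LINT x:?U|lborel. r * (\<rho> (cinv c x) * \<beta> c (cinv c x) std_index)) - (LINT
        x:?U|lborel. \<rho> (cinv c x) * \<gamma> c (cinv c x) std_index)"
      by (intro set_integral_diff set_integrable_mult_right int cont c)
    also have "\<dots> = r * ?I \<beta> x - ?I \<gamma> x" by (simp add: x')
    finally show ?thesis .
  qed
  then have "(\<Sum>x\<leftarrow>?P. ?I \<alpha> x) = (\<Sum>x\<leftarrow>?P. r * ?I \<beta> x - ?I \<gamma> x)"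
    by (intro arg_cong[of _ _ sum_list] map_cong refl)
  also have "\<dots> = r * (\<Sum>x\<leftarrow>?P. ?I \<beta> x) - (\<Sum>x\<leftarrow>?P. ?I \<gamma> x)"
    by (simp only: sum_list_subtractf sum_list_const_mult)
  finally show ?thesis by (simp only: form_integral_def)
qed

theorem theorem5p22:
  fixes T :: "'a topology" and A :: "'a chart set" and \<phi> X Y :: "'a tensor_field"
  assumes "compact_oriented_manifold T A"
    and "\<phi> \<in> G2_structures A"
    and "X \<in> smooth_forms A 3"
    and "Y \<in> smooth_forms A 3"
  shows "pullback_ebin_metric T A \<phi> X Y =
    3 / 4 * laplacian_metric T A \<phi> X Y
    - vol_integral T A (g2_metric \<phi>) (\<lambda>c p.
        11 / 18 * field_inner (g2_metric \<phi>) 3 X \<phi> c p * field_inner (g2_metric \<phi>) 3 Y \<phi> c p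
        - 1 / 16 * (psi_contraction \<phi> X Y c p + phi_contraction \<phi> X Y c p))"
proof -
  have \<phi>: "\<phi> \<in> smooth_forms A 3" and pos: "\<And>c p. c \<in> A \<Longrightarrow> p \<in> fst c \<Longrightarrow> positive_form (\<phi> c p)"
    using assms(2) by (auto simp: G2_structures_def)
  have alt: "alternating 3 (\<omega> c p)" if "\<omega> \<in> smooth_forms A 3" "c \<in> A" "p \<in> fst c" for \<omega> c p
    using that by (auto simp: smooth_forms_def)
  have cont: "continuous_on (snd c ` fst c) (\<lambda>x. \<omega> c (cinv c x) I)" if "\<omega> \<in> smooth_forms A 3" "c \<in>
      A" "length I = 3" for \<omega> c I
  proof -
    \<comment> \<open>Order 0 in the definition of smoothness is continuity.\<close>
    have "\<forall>k. times_cont_diff_on k (\<lambda>x. \<omega> c (cinv c x) I) (snd c ` fst c)"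
      using that by (simp add: smooth_forms_def smooth_on_def)
    from spec[OF this, of 0] show ?thesis by simp
  qed
  have cinv: "cinv c x \<in> fst c" if "x \<in> snd c ` fst c" for c :: "'a chart" and x
    using that by (simp add: cinv_def inv_into_into)
  have g: "continuous_on (snd c ` fst c) (\<lambda>x. g2_metric \<phi> c (cinv c x) $ i $ j)" if "c \<in> A" for c i j
    unfolding g2_metric_def
    by (intro continuous_on_g2_metric_at cont alt pos \<phi> that cinv)
  have det: "det (g2_metric \<phi> c p) > 0" if "c \<in> A" "p \<in> fst c" for c p
    unfolding g2_metric_def
    by (intro inner_product_matrix_det g2_metric_at_eq alt pos \<phi> that)
  have ginv: "continuous_on (snd c ` fst c) (\<lambda>x. matrix_inv (g2_metric \<phi> c (cinv c x)) $ i $ j)" if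
      "c \<in> A" for c i j
    using det[OF that] cinv by (intro continuous_on_matrix_inv g that) (simp add: less_imp_neq[symmetric])
  have vol: "continuous_on (snd c ` fst c) (\<lambda>x. vol_form (g2_metric \<phi> c (cinv c x)) I)" if "c \<in> A" for c I
    unfolding vol_form_def by (intro continuous_intros continuous_on_det g that)
  have inner: "continuous_on (snd c ` fst c) (\<lambda>x. field_inner (g2_metric \<phi>) 3 \<omega> \<omega>' c (cinv c x))"
    if "\<omega> \<in> smooth_forms A 3" "\<omega>' \<in> smooth_forms A 3" "c \<in> A" for \<omega> \<omega>' c
    unfolding field_inner_def by (intro continuous_on_tensor_inner ginv cont that)
  have psi: "continuous_on (snd c ` fst c) (\<lambda>x. g2_psi \<phi> c (cinv c x) I)" if "c \<in> A" for c I
    unfolding g2_psi_def hodge_def by (intro continuous_intros continuous_on_raise ginv cont vol \<phi>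
        that) auto
  have raise: "continuous_on (snd c ` fst c) (\<lambda>x. raise (g2_metric \<phi> c (cinv c x)) (\<omega> c (cinv c x)) I)"
    if "\<omega> \<in> smooth_forms A 3" "c \<in> A" "length I = 3" for \<omega> c I
    using that by (intro continuous_on_raise ginv cont) auto
  have raise2: "continuous_on (snd c ` fst c) (\<lambda>x. raise (g2_metric \<phi> c (cinv c x)) (\<lambda>L. X c (cinv c
      x) (a # L)) I)"
    if "c \<in> A" "length I = 2" for c I a
    using that by (intro continuous_on_raise ginv cont assms(3)) auto
  have psi_c: "continuous_on (snd c ` fst c) (\<lambda>x. psi_contraction \<phi> X Y c (cinv c x))" if "c \<in> A" for c
    unfolding psi_contraction_def by (intro continuous_intros raise raise2 psi assms(4) that) auto
  have phi_c: "continuous_on (snd c ` fst c) (\<lambda>x. phi_contraction \<phi> X Y c (cinv c x))" if "c \<in> A" for c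
    unfolding phi_contraction_def by (intro continuous_intros raise cont \<phi> assms(3,4) that) auto
  show ?thesis
    unfolding pullback_ebin_metric_def ebin_metric_def laplacian_metric_def vol_integral_def
  proof (rule form_integral_linear[OF assms(1)])
    fix c assume c: "c \<in> A"
    show "continuous_on (snd c ` fst c) (\<lambda>x. field_inner (g2_metric \<phi>) 3 X Y c (cinv c x) * vol_form
        (g2_metric \<phi> c (cinv c x)) std_index)"
      by (intro continuous_intros inner vol assms c)
    show "continuous_on (snd c ` fst c) (\<lambda>x. (11 / 18 * field_inner (g2_metric \<phi>) 3 X \<phi> c (cinv c x)
        * field_inner (g2_metric \<phi>) 3 Y \<phi> c (cinv c x)
        - 1 / 16 * (psi_contraction \<phi> X Y c (cinv c x) + phi_contraction \<phi> X Y c (cinv c x))) *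
            vol_form (g2_metric \<phi> c (cinv c x)) std_index)"
      by (intro continuous_intros inner vol psi_c phi_c assms \<phi> c)
    fix p assume p: "p \<in> fst c"
    \<comment> \<open>The differential of the metric is a derivative in \<open>t\<close> at a fixed
      point and chart, so the identity at a point applies to the components there.\<close>
    have "field_inner (g2_metric \<phi>) 2 (\<lambda>c p. matrix_tensor (g2_metric_diff \<phi> X c p)) (\<lambda>c p.
        matrix_tensor (g2_metric_diff \<phi> Y c p)) c p =
       3 / 4 * field_inner (g2_metric \<phi>) 3 X Y c p - (11 / 18 * field_inner (g2_metric \<phi>) 3 X \<phi> c p
           * field_inner (g2_metric \<phi>) 3 Y \<phi> c p
        - 1 / 16 * (psi_contraction \<phi> X Y c p + phi_contraction \<phi> X Y c p))"
      unfolding field_inner_def psi_contraction_def phi_contraction_def g2_metric_diff_def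
          g2_psi_def g2_metric_def
      by (rule pointwise_identity) (intro alt pos \<phi> assms(3,4) c p)+
    then show "field_inner (g2_metric \<phi>) 2 (\<lambda>c p. matrix_tensor (g2_metric_diff \<phi> X c p)) (\<lambda>c p.
        matrix_tensor (g2_metric_diff \<phi> Y c p)) c p * vol_form (g2_metric \<phi> c p) std_index =
       3 / 4 * (field_inner (g2_metric \<phi>) 3 X Y c p * vol_form (g2_metric \<phi> c p) std_index) -
       (11 / 18 * field_inner (g2_metric \<phi>) 3 X \<phi> c p * field_inner (g2_metric \<phi>) 3 Y \<phi> c p
        - 1 / 16 * (psi_contraction \<phi> X Y c p + phi_contraction \<phi> X Y c p)) * vol_form (g2_metric \<phi>
            c p) std_index"
      by (simp only: left_diff_distrib mult.assoc)
  qed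
qed

end
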